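(* Let $K$ be a field and let $\mathcal{C}$ be a small $K$-linear category. If $\mathcal{C}$ is separable, then $\mathcal{C}$ is locally finite dimensional, i.e. $\dim_K\mathcal{C}(x,y)<\infty$ for all objects $x,y$ of $\mathcal{C}$.
   Context: Write $\mathcal{C}_0$ for the set of objects and $\mathcal{C}(x,y)$ for $\mathrm{Hom}_{\mathcal{C}}(x,y)$. A category is $K$-linear if each $\mathcal{C}(x,y)$ is a $K$-vector space and composition is $K$-bilinear; a functor between $K$-linear categories is $K$-linear if it is $K$-linear on each Hom space. Tensor products are over $K$. Bimodules: $\mathcal{C}\boxtimes_K\mathcal{C}^{op}$ is the $K$-linear category whose objects are pairs $(x,y)\in\mathcal{C}_0\times\mathcal{C}_0$, with morphisms from $(x,y)$ to $(x',y')$ given by $\mathcal{C}(x,x')\otimes\mathcal{C}(y',y)$ and the evident composition. A $\mathcal{C}$-bimodule is a $K$-linear functor $M:\mathcal{C}\boxtimes_K\mathcal{C}^{op}\to K\text{-}\mathrm{Mod}$, with value ${}_xM_y$ at $(x,y)$; morphisms are natural transformations. The category of $\mathcal{C}$-bimodules is abelian with enough projectives and injectives. $\mathcal{C}$ itself is a bimodule by ${}_x\mathcal{C}_y=\mathcal{C}(y,x)$, with actions given by composition. Hochschild-Mitchell cohomology: $H^{n}(\mathcal{C},M):=\mathrm{Ext}^{n}_{\mathcal{C}-\mathcal{C}}(\mathcal{C},M)$, with $\mathrm{Ext}$ computed in the category of $\mathcal{C}$-bimodules. $\mathcal{C}$ is called separable if $H^{1}(\mathcal{C},M)=0$ for every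 $\mathcal{C}$-bimodule $M$. *)

theory Defs
  imports "HOL-Algebra.AbelCoset" "Jordan_Normal_Form.Missing_VectorSpace"
begin

section \<open>Quotients and tensor products of vector spaces\<close>

text \<open>
  The fields \<open>mult\<close> and \<open>one\<close>, which \<^typ>\<open>('k, 'v) module\<close> inherits from \<open>ring\<close>, play no role in
  the theory of modules and are left undefined below.
\<close>

text \<open>In a quotient \<open>V / N\<close>, the set of all \<open>c \<odot> v\<close> for \<open>v\<close> in a coset \<open>A\<close> need not be a full coset
  (take \<open>c = 0\<close>), which is why \<open>N\<close> is added to it.\<close>
definition quotient_module :: "('k, 'v, 'z) module_scheme \<Rightarrow> 'v set \<Rightarrow> ('k, 'v set) module" where
  "quotient_module V N =
    \<lparr>carrier = A_RCOSETS V N, mult = undefined, one = undefined, zero = N,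
     add = set_add V, smult = (\<lambda>c A. set_add V N ((\<lambda>v. c \<odot>\<^bsub>V\<^esub> v) ` A))\<rparr>"

definition free_module :: "('k, 'r) ring_scheme \<Rightarrow> 's set \<Rightarrow> ('k, 's \<Rightarrow> 'k) module" where
  "free_module K S = (ring.func_space K S)
    \<lparr>carrier := {p \<in> carrier (ring.func_space K S). finite {s \<in> S. p s \<noteq> \<zero>\<^bsub>K\<^esub>}}\<rparr>"

definition generator :: "('k, 'r) ring_scheme \<Rightarrow> 's set \<Rightarrow> 's \<Rightarrow> 's \<Rightarrow> 'k" where
  "generator K S s = (\<lambda>t\<in>S. if t = s then \<one>\<^bsub>K\<^esub> else \<zero>\<^bsub>K\<^esub>)"

definition tensor_relations ::
  "('k, 'r) ring_scheme \<Rightarrow> ('k, 'v) module \<Rightarrow> ('k, 'w) module \<Rightarrow> ('v \<times> 'w \<Rightarrow> 'k) set" where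
  "tensor_relations K V W =
    (let S = carrier V \<times> carrier W; F = free_module K S; e = (\<lambda>v w. generator K S (v, w)) in
      {e (v \<oplus>\<^bsub>V\<^esub> v') w \<ominus>\<^bsub>F\<^esub> (e v w \<oplus>\<^bsub>F\<^esub> e v' w) | v v' w.
         v \<in> carrier V \<and> v' \<in> carrier V \<and> w \<in> carrier W} \<union>
      {e v (w \<oplus>\<^bsub>W\<^esub> w') \<ominus>\<^bsub>F\<^esub> (e v w \<oplus>\<^bsub>F\<^esub> e v w') | v w w'.
         v \<in> carrier V \<and> w \<in> carrier W \<and> w' \<in> carrier W} \<union>
      {e (c \<odot>\<^bsub>V\<^esub> v) w \<ominus>\<^bsub>F\<^esub> c \<odot>\<^bsub>F\<^esub> e v w | c v w.
         c \<in> carrier K \<and> v \<in> carrier V \<and> w \<in> carrier W} \<union>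
      {e v (c \<odot>\<^bsub>W\<^esub> w) \<ominus>\<^bsub>F\<^esub> c \<odot>\<^bsub>F\<^esub> e v w | c v w.
         c \<in> carrier K \<and> v \<in> carrier V \<and> w \<in> carrier W})"

definition tensor_null ::
  "('k, 'r) ring_scheme \<Rightarrow> ('k, 'v) module \<Rightarrow> ('k, 'w) module \<Rightarrow> ('v \<times> 'w \<Rightarrow> 'k) set" where
  "tensor_null K V W =
    module.span K (free_module K (carrier V \<times> carrier W)) (tensor_relations K V W)"

definition tensor_product ::
  "('k, 'r) ring_scheme \<Rightarrow> ('k, 'v) module \<Rightarrow> ('k, 'w) module \<Rightarrow> ('k, ('v \<times> 'w \<Rightarrow> 'k) set) module"
  where
  "tensor_product K V W =
    quotient_module (free_module K (carrier V \<times> carrier W)) (tensor_null K V W)"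

definition pure_tensor ::
  "('k, 'r) ring_scheme \<Rightarrow> ('k, 'v) module \<Rightarrow> ('k, 'w) module \<Rightarrow> 'v \<Rightarrow> 'w \<Rightarrow> ('v \<times> 'w \<Rightarrow> 'k) set"
  where
  "pure_tensor K V W v w =
    a_r_coset (free_module K (carrier V \<times> carrier W)) (tensor_null K V W)
      (generator K (carrier V \<times> carrier W) (v, w))"

text \<open>The linear map \<open>V \<otimes> W \<rightarrow> X\<close> with \<open>v \<otimes> w \<mapsto> \<beta> v w\<close>, for a bilinear \<open>\<beta>\<close>. Bilinearity makes the
  value independent of the representing formal sum \<open>p\<close>.\<close>
definition tensor_lift ::
  "('k, 'r) ring_scheme \<Rightarrow> ('k, 'v) module \<Rightarrow> ('k, 'w) module \<Rightarrow> ('k, 'x) module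
    \<Rightarrow> ('v \<Rightarrow> 'w \<Rightarrow> 'x) \<Rightarrow> ('v \<times> 'w \<Rightarrow> 'k) set \<Rightarrow> 'x" where
  "tensor_lift K V W X \<beta> t =
    (let p = (SOME p. p \<in> t) in
      \<Oplus>\<^bsub>X\<^esub> s \<in> {s \<in> carrier V \<times> carrier W. p s \<noteq> \<zero>\<^bsub>K\<^esub>}. p s \<odot>\<^bsub>X\<^esub> \<beta> (fst s) (snd s))"

section \<open>Linear categories\<close>

text \<open>\<open>Comp C x y z g f\<close> is the composite \<open>g \<circ> f\<close> of \<open>f : x \<rightarrow> y\<close> and \<open>g : y \<rightarrow> z\<close>. It depends on the
  objects because the carriers of different Hom spaces may overlap.\<close>
record ('k, 'o, 'a) linear_cat =
  Obj :: "'o set"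
  Hom :: "'o \<Rightarrow> 'o \<Rightarrow> ('k, 'a) module"
  Comp :: "'o \<Rightarrow> 'o \<Rightarrow> 'o \<Rightarrow> 'a \<Rightarrow> 'a \<Rightarrow> 'a"
  Id :: "'o \<Rightarrow> 'a"

locale linear_category = field K for K :: "('k, 'r) ring_scheme" (structure) +
  fixes C :: "('k, 'o, 'a) linear_cat"
  assumes Hom_vectorspace:
      "\<lbrakk>x \<in> Obj C; y \<in> Obj C\<rbrakk> \<Longrightarrow> vectorspace K (Hom C x y)"
    and Comp_linear_left:
      "\<lbrakk>x \<in> Obj C; y \<in> Obj C; z \<in> Obj C; f \<in> carrier (Hom C x y)\<rbrakk>
        \<Longrightarrow> linear_map K (Hom C y z) (Hom C x z) (\<lambda>g. Comp C x y z g f)"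
    and Comp_linear_right:
      "\<lbrakk>x \<in> Obj C; y \<in> Obj C; z \<in> Obj C; g \<in> carrier (Hom C y z)\<rbrakk>
        \<Longrightarrow> linear_map K (Hom C x y) (Hom C x z) (\<lambda>f. Comp C x y z g f)"
    and Comp_assoc:
      "\<lbrakk>w \<in> Obj C; x \<in> Obj C; y \<in> Obj C; z \<in> Obj C;
        f \<in> carrier (Hom C w x); g \<in> carrier (Hom C x y); h \<in> carrier (Hom C y z)\<rbrakk>
        \<Longrightarrow> Comp C w y z h (Comp C w x y g f) = Comp C w x z (Comp C x y z h g) f"
    and Id_closed: "x \<in> Obj C \<Longrightarrow> Id C x \<in> carrier (Hom C x x)"
    and Id_left:
      "\<lbrakk>x \<in> Obj C; y \<in> Obj C; f \<in> carrier (Hom C x y)\<rbrakk> \<Longrightarrow> Comp C x y y (Id C y) f = f"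
    and Id_right:
      "\<lbrakk>x \<in> Obj C; y \<in> Obj C; f \<in> carrier (Hom C x y)\<rbrakk> \<Longrightarrow> Comp C x x y f (Id C x) = f"

definition opposite_cat :: "('k, 'o, 'a) linear_cat \<Rightarrow> ('k, 'o, 'a) linear_cat" where
  "opposite_cat C =
    \<lparr>Obj = Obj C, Hom = (\<lambda>x y. Hom C y x), Comp = (\<lambda>x y z g f. Comp C z y x f g), Id = Id C\<rparr>"

text \<open>Composition is determined by \<open>(f' \<otimes> g') \<circ> (f \<otimes> g) = (f' \<circ> f) \<otimes> (g' \<circ> g)\<close>.\<close>
definition tensor_cat ::
  "('k, 'r) ring_scheme \<Rightarrow> ('k, 'o, 'a) linear_cat \<Rightarrow> ('k, 'p, 'b) linear_cat
    \<Rightarrow> ('k, 'o \<times> 'p, ('a \<times> 'b \<Rightarrow> 'k) set) linear_cat" where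
  "tensor_cat K C D =
    \<lparr>Obj = Obj C \<times> Obj D,
     Hom = (\<lambda>(x, y) (x', y'). tensor_product K (Hom C x x') (Hom D y y')),
     Comp = (\<lambda>(x, y) (x', y') (x'', y'') t' t.
       let H = tensor_product K (Hom C x x'') (Hom D y y'') in
       tensor_lift K (Hom C x' x'') (Hom D y' y'') H
         (\<lambda>f' g'. tensor_lift K (Hom C x x') (Hom D y y') H
            (\<lambda>f g. pure_tensor K (Hom C x x'') (Hom D y y'')
               (Comp C x x' x'' f' f) (Comp D y y' y'' g' g)) t) t'),
     Id = (\<lambda>(x, y). pure_tensor K (Hom C x x) (Hom D y y) (Id C x) (Id D y))\<rparr>"

section \<open>Linear functors to vector spaces\<close>

record ('k, 'd, 'b, 'm) vect_functor =
  Val :: "'d \<Rightarrow> ('k, 'm) module"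
  Act :: "'d \<Rightarrow> 'd \<Rightarrow> 'b \<Rightarrow> 'm \<Rightarrow> 'm"

locale linear_functor = linear_category K D
  for K :: "('k, 'r) ring_scheme" (structure) and D :: "('k, 'd, 'b) linear_cat" +
  fixes M :: "('k, 'd, 'b, 'm) vect_functor"
  assumes Val_vectorspace: "x \<in> Obj D \<Longrightarrow> vectorspace K (Val M x)"
    and Act_linear:
      "\<lbrakk>x \<in> Obj D; y \<in> Obj D; f \<in> carrier (Hom D x y)\<rbrakk>
        \<Longrightarrow> linear_map K (Val M x) (Val M y) (Act M x y f)"
    and Act_linear_Hom:
      "\<lbrakk>x \<in> Obj D; y \<in> Obj D; m \<in> carrier (Val M x)\<rbrakk>
        \<Longrightarrow> linear_map K (Hom D x y) (Val M y) (\<lambda>f. Act M x y f m)"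
    and Act_Id: "\<lbrakk>x \<in> Obj D; m \<in> carrier (Val M x)\<rbrakk> \<Longrightarrow> Act M x x (Id D x) m = m"
    and Act_Comp:
      "\<lbrakk>x \<in> Obj D; y \<in> Obj D; z \<in> Obj D; f \<in> carrier (Hom D x y); g \<in> carrier (Hom D y z);
        m \<in> carrier (Val M x)\<rbrakk>
        \<Longrightarrow> Act M x z (Comp D x y z g f) m = Act M y z g (Act M x y f m)"

text \<open>Natural transformations are normalised to be \<open>undefined\<close> off their domain, so that two of them
  are equal as soon as they agree on the objects and on the carriers.\<close>
definition nat_trans ::
  "('k, 'r) ring_scheme \<Rightarrow> ('k, 'd, 'b) linear_cat \<Rightarrow> ('k, 'd, 'b, 'm) vect_functor
    \<Rightarrow> ('k, 'd, 'b, 'n) vect_functor \<Rightarrow> ('d \<Rightarrow> 'm \<Rightarrow> 'n) set" where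
  "nat_trans K D M N =
    {\<eta> \<in> extensional (Obj D).
      (\<forall>x \<in> Obj D. \<eta> x \<in> module_hom K (Val M x) (Val N x) \<inter> extensional (carrier (Val M x))) \<and>
      (\<forall>x \<in> Obj D. \<forall>y \<in> Obj D. \<forall>f \<in> carrier (Hom D x y). \<forall>m \<in> carrier (Val M x).
        \<eta> y (Act M x y f m) = Act N x y f (\<eta> x m))}"

definition nat_module ::
  "('k, 'r) ring_scheme \<Rightarrow> ('k, 'd, 'b) linear_cat \<Rightarrow> ('k, 'd, 'b, 'm) vect_functor
    \<Rightarrow> ('k, 'd, 'b, 'n) vect_functor \<Rightarrow> ('k, 'd \<Rightarrow> 'm \<Rightarrow> 'n) module" where
  "nat_module K D M N =
    \<lparr>carrier = nat_trans K D M N, mult = undefined, one = undefined,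
     zero = (\<lambda>x\<in>Obj D. \<lambda>m\<in>carrier (Val M x). \<zero>\<^bsub>Val N x\<^esub>),
     add = (\<lambda>\<eta> \<theta>. \<lambda>x\<in>Obj D. \<lambda>m\<in>carrier (Val M x). \<eta> x m \<oplus>\<^bsub>Val N x\<^esub> \<theta> x m),
     smult = (\<lambda>c \<eta>. \<lambda>x\<in>Obj D. \<lambda>m\<in>carrier (Val M x). c \<odot>\<^bsub>Val N x\<^esub> \<eta> x m)\<rparr>"

text \<open>\<open>nat_comp D L \<eta> \<theta>\<close> is \<open>\<eta> \<circ> \<theta>\<close>, where \<open>L\<close> is the source of \<open>\<theta>\<close>.\<close>
definition nat_comp ::
  "('k, 'd, 'b) linear_cat \<Rightarrow> ('k, 'd, 'b, 'l) vect_functor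
    \<Rightarrow> ('d \<Rightarrow> 'm \<Rightarrow> 'n) \<Rightarrow> ('d \<Rightarrow> 'l \<Rightarrow> 'm) \<Rightarrow> ('d \<Rightarrow> 'l \<Rightarrow> 'n)" where
  "nat_comp D L \<eta> \<theta> = (\<lambda>x\<in>Obj D. compose (carrier (Val L x)) (\<eta> x) (\<theta> x))"

section \<open>Ext of linear functors\<close>

text \<open>Kernels and images of functors are computed objectwise, so epimorphisms are the objectwise
  surjective transformations and exactness is objectwise exactness.

  A single functor category consists of the functors whose values are carried by subsets of one type
  \<open>'m\<close>; projectivity of an \<open>'m\<close>-valued functor is tested against \<open>'m\<close>-valued functors. The type \<open>'m\<close> must
  be large enough for the category to have enough projectives.\<close>

definition nat_epi ::
  "('k, 'd, 'b) linear_cat \<Rightarrow> ('k, 'd, 'b, 'm) vect_functor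
    \<Rightarrow> ('k, 'd, 'b, 'n) vect_functor \<Rightarrow> ('d \<Rightarrow> 'm \<Rightarrow> 'n) \<Rightarrow> bool" where
  "nat_epi D M N \<eta> \<longleftrightarrow> (\<forall>x \<in> Obj D. \<eta> x ` carrier (Val M x) = carrier (Val N x))"

definition projective_functor ::
  "('k, 'r) ring_scheme \<Rightarrow> ('k, 'd, 'b) linear_cat \<Rightarrow> ('k, 'd, 'b, 'm) vect_functor \<Rightarrow> bool" where
  "projective_functor K D P \<longleftrightarrow>
    linear_functor K D P \<and>
    (\<forall>(X :: ('k, 'd, 'b, 'm) vect_functor) (Y :: ('k, 'd, 'b, 'm) vect_functor).
      linear_functor K D X \<longrightarrow> linear_functor K D Y \<longrightarrow>
      (\<forall>\<pi> \<in> nat_trans K D X Y. nat_epi D X Y \<pi> \<longrightarrow>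
        (\<forall>\<phi> \<in> nat_trans K D P Y. \<exists>\<psi> \<in> nat_trans K D P X. nat_comp D P \<pi> \<psi> = \<phi>)))"

text \<open>Exact sequences \<open>\<dots> \<rightarrow> P 2 \<rightarrow> P 1 \<rightarrow> P 0 \<rightarrow> A \<rightarrow> 0\<close> with differentials \<open>d n : P (n + 1) \<rightarrow> P n\<close> and
  augmentation \<open>\<epsilon> : P 0 \<rightarrow> A\<close>. The values of \<open>A\<close> may be carried by another type.\<close>
definition projective_resolution ::
  "('k, 'r) ring_scheme \<Rightarrow> ('k, 'd, 'b) linear_cat \<Rightarrow> ('k, 'd, 'b, 'n) vect_functor
    \<Rightarrow> (nat \<Rightarrow> ('k, 'd, 'b, 'm) vect_functor) \<Rightarrow> (nat \<Rightarrow> 'd \<Rightarrow> 'm \<Rightarrow> 'm) \<Rightarrow> ('d \<Rightarrow> 'm \<Rightarrow> 'n) \<Rightarrow> bool"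
  where
  "projective_resolution K D A P d \<epsilon> \<longleftrightarrow>
    (\<forall>n. projective_functor K D (P n)) \<and>
    (\<forall>n. d n \<in> nat_trans K D (P (Suc n)) (P n)) \<and>
    \<epsilon> \<in> nat_trans K D (P 0) A \<and> nat_epi D (P 0) A \<epsilon> \<and>
    (\<forall>x \<in> Obj D.
      a_kernel (Val (P 0) x) (Val A x) (\<epsilon> x) = d 0 x ` carrier (Val (P 1) x) \<and>
      (\<forall>n. a_kernel (Val (P (Suc n)) x) (Val (P n) x) (d n x)
        = d (Suc n) x ` carrier (Val (P (Suc (Suc n))) x)))"

definition cocycles ::
  "('k, 'r) ring_scheme \<Rightarrow> ('k, 'd, 'b) linear_cat
    \<Rightarrow> (nat \<Rightarrow> ('k, 'd, 'b, 'm) vect_functor) \<Rightarrow> (nat \<Rightarrow> 'd \<Rightarrow> 'm \<Rightarrow> 'm)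
    \<Rightarrow> ('k, 'd, 'b, 'n) vect_functor \<Rightarrow> nat \<Rightarrow> ('d \<Rightarrow> 'm \<Rightarrow> 'n) set" where
  "cocycles K D P d M n =
    {\<phi> \<in> nat_trans K D (P n) M.
      nat_comp D (P (Suc n)) \<phi> (d n) = \<zero>\<^bsub>nat_module K D (P (Suc n)) M\<^esub>}"

fun coboundaries ::
  "('k, 'r) ring_scheme \<Rightarrow> ('k, 'd, 'b) linear_cat
    \<Rightarrow> (nat \<Rightarrow> ('k, 'd, 'b, 'm) vect_functor) \<Rightarrow> (nat \<Rightarrow> 'd \<Rightarrow> 'm \<Rightarrow> 'm)
    \<Rightarrow> ('k, 'd, 'b, 'n) vect_functor \<Rightarrow> nat \<Rightarrow> ('d \<Rightarrow> 'm \<Rightarrow> 'n) set" where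
  "coboundaries K D P d M 0 = {\<zero>\<^bsub>nat_module K D (P 0) M\<^esub>}"
| "coboundaries K D P d M (Suc n) =
    (\<lambda>\<phi>. nat_comp D (P (Suc n)) \<phi> (d n)) ` nat_trans K D (P n) M"

text \<open>The \<open>n\<close>-th cohomology of the complex of natural transformations from a chosen projective
  resolution of \<open>A\<close> to \<open>M\<close>.\<close>
definition Ext ::
  "('k, 'r) ring_scheme \<Rightarrow> ('k, 'd, 'b) linear_cat \<Rightarrow> nat \<Rightarrow> ('k, 'd, 'b, 'n) vect_functor
    \<Rightarrow> ('k, 'd, 'b, 'm) vect_functor \<Rightarrow> ('k, ('d \<Rightarrow> 'm \<Rightarrow> 'm) set) module" where
  "Ext K D n A M =
    (let (P :: nat \<Rightarrow> ('k, 'd, 'b, 'm) vect_functor, d, \<epsilon>) =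
       (SOME (P, d, \<epsilon>). projective_resolution K D A P d \<epsilon>) in
     quotient_module ((nat_module K D (P n) M)\<lparr>carrier := cocycles K D P d M n\<rparr>)
       (coboundaries K D P d M n))"

section \<open>Bimodules and Hochschild--Mitchell cohomology\<close>

definition enveloping_cat ::
  "('k, 'r) ring_scheme \<Rightarrow> ('k, 'o, 'a) linear_cat
    \<Rightarrow> ('k, 'o \<times> 'o, ('a \<times> 'a \<Rightarrow> 'k) set) linear_cat" where
  "enveloping_cat K C = tensor_cat K C (opposite_cat C)"

type_synonym ('k, 'o, 'a, 'm) bimodule =
  "('k, 'o \<times> 'o, ('a \<times> 'a \<Rightarrow> 'k) set, 'm) vect_functor"

abbreviation bimodule ::
  "('k, 'r) ring_scheme \<Rightarrow> ('k, 'o, 'a) linear_cat \<Rightarrow> ('k, 'o, 'a, 'm) bimodule \<Rightarrow> bool" where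
  "bimodule K C M \<equiv> linear_functor K (enveloping_cat K C) M"

text \<open>The value at \<open>(x, y)\<close> is \<open>Hom C y x\<close>; for \<open>f : x \<rightarrow> x'\<close> and \<open>g : y' \<rightarrow> y\<close> in \<open>C\<close>, the morphism
  \<open>f \<otimes> g\<close> acts by \<open>m \<mapsto> f \<circ> m \<circ> g\<close>.\<close>
definition regular_bimodule ::
  "('k, 'r) ring_scheme \<Rightarrow> ('k, 'o, 'a) linear_cat \<Rightarrow> ('k, 'o, 'a, 'a) bimodule" where
  "regular_bimodule K C =
    \<lparr>Val = (\<lambda>(x, y). Hom C y x),
     Act = (\<lambda>(x, y) (x', y') t m.
       tensor_lift K (Hom C x x') (Hom C y' y) (Hom C y' x')
         (\<lambda>f g. Comp C y' x x' f (Comp C y' y x m g)) t)\<rparr>"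

definition Hochschild_Mitchell ::
  "('k, 'r) ring_scheme \<Rightarrow> ('k, 'o, 'a) linear_cat \<Rightarrow> nat \<Rightarrow> ('k, 'o, 'a, 'm) bimodule
    \<Rightarrow> ('k, ('o \<times> 'o \<Rightarrow> 'm \<Rightarrow> 'm) set) module" where
  "Hochschild_Mitchell K C n M = Ext K (enveloping_cat K C) n (regular_bimodule K C) M"

text \<open>
  A formula cannot quantify over all types of values at once, so the values of functors on \<open>D\<close> are
  taken in the type of hereditarily finite sequences built from objects and morphisms of \<open>D\<close>. Being
  closed under finite sequences, it carries, for every functor \<open>M\<close> with values in it, the direct sum of
  the representables \<open>Hom D x _\<close> over all \<open>x\<close> and all elements of \<open>M\<close> at \<open>x\<close>, which maps onto \<open>M\<close>. It
  likewise carries a cover of the regular bimodule, which is generated by the identities. Hence these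
  functors suffice for projective resolutions, projectivity among them is the same as projectivity
  among all functors, and \<open>Ext\<close> does not depend on having restricted the values.
\<close>
datatype ('d, 'b) hf_sequence = Object 'd | Morphism 'b | Sequence "('d, 'b) hf_sequence list"

definition separable :: "('k, 'r) ring_scheme \<Rightarrow> ('k, 'o, 'a) linear_cat \<Rightarrow> bool" where
  "separable K C \<longleftrightarrow>
    (\<forall>M :: ('k, 'o, 'a, ('o \<times> 'o, ('a \<times> 'a \<Rightarrow> 'k) set) hf_sequence) bimodule. bimodule K C M \<longrightarrow>
      carrier (Hochschild_Mitchell K C 1 M) = {\<zero>\<^bsub>Hochschild_Mitchell K C 1 M\<^esub>})"

definition locally_finite_dimensional ::
  "('k, 'r) ring_scheme \<Rightarrow> ('k, 'o, 'a) linear_cat \<Rightarrow> bool" where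
  "locally_finite_dimensional K C \<longleftrightarrow>
    (\<forall>x \<in> Obj C. \<forall>y \<in> Obj C. vectorspace.fin_dim K (Hom C x y))"

end

theory Submission
  imports Defs
begin

text \<open>
  If \<open>H\<^sup>1\<close> vanishes on the kernel of \<open>P 0 \<rightarrow> C\<close> in a
  projective resolution of the regular bimodule, this map splits. As \<open>P 0\<close> is a summand
  of a direct sum of representables, so is the regular bimodule, and the identity of each object
  \<open>x\<close> becomes a finite sum of tensors \<open>a \<otimes> b\<close>. Comparing the two
  ways in which a morphism \<open>f : x \<rightarrow> y\<close> acts on these finite sums confines
  \<open>f\<close> to the span of finitely many composites \<open>a \<circ> m \<circ> b\<close>,
  chosen independently of \<open>f\<close>.
\<close>

section \<open>Linear algebra\<close>

text \<open>\<open>Ext\<close> is read off from a resolution picked by \<open>SOME\<close>, so its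
  vanishing says nothing until some resolution is known to exist. Its terms must also lie in the one
  value type over which \<open>separable\<close> quantifies. Hence direct sums of representables,
  whose elements are functions, are coded by finite sequences, and their structure is carried over
  to the codes. Projectivity is tested inside the same type, so even splitting \<open>P 0\<close>
  off a free functor passes through a coded copy of that functor. In the finiteness argument no
  tensor factor comes from a space known to be finite-dimensional. One of the two expressions for f
  confines only the right tensor factors, the other only the left ones. Instead of intersecting two
  subspaces of a tensor product, the multiplication map is altered by a linear projection in the
  right factor: one expression does not notice it, and the other becomes confined on both sides.
  This is why complements of subspaces, obtained by Zorn's lemma, appear in the linear
  algebra.\<close>

lemma linear_mapI:
  assumes "vectorspace K V" and "vectorspace K W"
    and "\<And>v. v \<in> carrier V \<Longrightarrow> T v \<in> carrier W"
    and "\<And>u v. \<lbrakk>u \<in> carrier V; v \<in> carrier V\<rbrakk> \<Longrightarrow> T (u \<oplus>\<^bsub>V\<^esub> v) = T u \<oplus>\<^bsub>W\<^esub> T v"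
    and "\<And>c v. \<lbrakk>c \<in> carrier K; v \<in> carrier V\<rbrakk> \<Longrightarrow> T (c \<odot>\<^bsub>V\<^esub> v) = c \<odot>\<^bsub>W\<^esub> T v"
  shows "linear_map K V W T"
  using assms
  by (auto simp: linear_map_def mod_hom_def mod_hom_axioms_def module_hom_def vectorspace_def)

lemma linear_mapD:
  assumes "linear_map K V W T"
  shows "vectorspace K V" and "vectorspace K W"
    and "\<And>v. v \<in> carrier V \<Longrightarrow> T v \<in> carrier W"
    and "\<And>u v. \<lbrakk>u \<in> carrier V; v \<in> carrier V\<rbrakk> \<Longrightarrow> T (u \<oplus>\<^bsub>V\<^esub> v) = T u \<oplus>\<^bsub>W\<^esub> T v"
    and "\<And>c v. \<lbrakk>c \<in> carrier K; v \<in> carrier V\<rbrakk> \<Longrightarrow> T (c \<odot>\<^bsub>V\<^esub> v) = c \<odot>\<^bsub>W\<^esub> T v"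
    and "T \<zero>\<^bsub>V\<^esub> = \<zero>\<^bsub>W\<^esub>"
    and "\<And>u v. \<lbrakk>u \<in> carrier V; v \<in> carrier V\<rbrakk> \<Longrightarrow> T (u \<ominus>\<^bsub>V\<^esub> v) = T u \<ominus>\<^bsub>W\<^esub> T v"
proof -
  interpret linear_map K V W T by fact
  show "vectorspace K V" "vectorspace K W" by unfold_locales
qed (use assms in \<open>simp_all add: linear_map.T_im linear_map.T_add linear_map.T_smult
      linear_map.T0_is_0 linear_map.T_minus\<close>)

lemma vectorspace_closed:
  assumes "vectorspace K V"
  shows "\<zero>\<^bsub>V\<^esub> \<in> carrier V"
    and "\<And>u v. \<lbrakk>u \<in> carrier V; v \<in> carrier V\<rbrakk> \<Longrightarrow> u \<oplus>\<^bsub>V\<^esub> v \<in> carrier V"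
    and "\<And>c v. \<lbrakk>c \<in> carrier K; v \<in> carrier V\<rbrakk> \<Longrightarrow> c \<odot>\<^bsub>V\<^esub> v \<in> carrier V"
    and "\<And>u v. \<lbrakk>u \<in> carrier V; v \<in> carrier V\<rbrakk> \<Longrightarrow> u \<ominus>\<^bsub>V\<^esub> v \<in> carrier V"
proof -
  interpret vectorspace K V by fact
  show "\<zero>\<^bsub>V\<^esub> \<in> carrier V"
    and "\<And>u v. \<lbrakk>u \<in> carrier V; v \<in> carrier V\<rbrakk> \<Longrightarrow> u \<oplus>\<^bsub>V\<^esub> v \<in> carrier V"
    and "\<And>c v. \<lbrakk>c \<in> carrier K; v \<in> carrier V\<rbrakk> \<Longrightarrow> c \<odot>\<^bsub>V\<^esub> v \<in> carrier V"
    and "\<And>u v. \<lbrakk>u \<in> carrier V; v \<in> carrier V\<rbrakk> \<Longrightarrow> u \<ominus>\<^bsub>V\<^esub> v \<in> carrier V"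
    by simp_all
qed

text \<open>\<open>nat_trans\<close> is phrased with \<open>module_hom\<close>, a plain set of
  functions, whereas sums and composites of maps are handled with \<open>linear_map\<close>, which
  carries the two vector spaces along. This passes between the two.\<close>

lemma linear_map_iff_module_hom:
  assumes "vectorspace K V" and "vectorspace K W"
  shows "linear_map K V W T \<longleftrightarrow> T \<in> module_hom K V W"
  using assms by (auto simp: linear_map_def mod_hom_def mod_hom_axioms_def vectorspace_def)

lemma linear_map_cong:
  assumes "linear_map K V W T" and "\<And>v. v \<in> carrier V \<Longrightarrow> T' v = T v"
  shows "linear_map K V W T'"
  by (rule linear_mapI) (use assms in \<open>simp_all add: linear_mapD vectorspace_closed[OF linear_mapD(1)]\<close>)

lemma linear_map_comp:
  assumes "linear_map K U V S" and "linear_map K V W T"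
  shows "linear_map K U W (\<lambda>u. T (S u))"
  by (rule linear_mapI) (use assms in \<open>simp_all add: linear_mapD\<close>)

lemma linear_map_id:
  assumes "vectorspace K V" shows "linear_map K V V (\<lambda>v. v)"
  by (rule linear_mapI) (use assms in simp_all)

lemma linear_map_finsum:
  assumes "linear_map K V W T" and "f \<in> A \<rightarrow> carrier V"
  shows "T (\<Oplus>\<^bsub>V\<^esub>i\<in>A. f i) = (\<Oplus>\<^bsub>W\<^esub>i\<in>A. T (f i))"
proof -
  interpret V: vectorspace K V using assms(1) by (rule linear_mapD)
  interpret W: vectorspace K W using assms(1) by (rule linear_mapD)
  note T = linear_mapD[OF assms(1)]
  show ?thesis using assms(2)
  \<comment> \<open>Over an infinite index set both sums are zero by convention, and
    \<open>T\<close> preserves zero.\<close>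
  proof (induction A rule: infinite_finite_induct)
    case (insert a A)
    then have "f a \<in> carrier V" "f \<in> A \<rightarrow> carrier V" "(\<lambda>i. T (f i)) \<in> A \<rightarrow> carrier W"
      using T(3) by auto
    with insert show ?case
      by (simp add: V.M.finsum_insert W.M.finsum_insert V.M.finsum_closed T)
  qed (simp_all add: T)
qed

lemma linear_map_sum_of_maps:
  assumes "vectorspace K V" and "vectorspace K W"
    and T: "\<And>i. i \<in> A \<Longrightarrow> linear_map K V W (T i)"
  shows "linear_map K V W (\<lambda>v. \<Oplus>\<^bsub>W\<^esub>i\<in>A. T i v)"
proof -
  interpret W: vectorspace K W by fact
  show ?thesis
  proof (rule linear_mapI)
    fix v assume "v \<in> carrier V"
    then show "(\<Oplus>\<^bsub>W\<^esub>i\<in>A. T i v) \<in> carrier W"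
      by (intro W.M.finsum_closed) (auto intro: linear_mapD(3)[OF T])
  next
    fix u v assume uv: "u \<in> carrier V" "v \<in> carrier V"
    have "(\<Oplus>\<^bsub>W\<^esub>i\<in>A. T i (u \<oplus>\<^bsub>V\<^esub> v)) = (\<Oplus>\<^bsub>W\<^esub>i\<in>A. T i u \<oplus>\<^bsub>W\<^esub> T i v)"
      by (rule W.M.finsum_cong') (use uv in \<open>auto simp: linear_mapD(3,4)[OF T]\<close>)
    also have "\<dots> = (\<Oplus>\<^bsub>W\<^esub>i\<in>A. T i u) \<oplus>\<^bsub>W\<^esub> (\<Oplus>\<^bsub>W\<^esub>i\<in>A. T i v)"
      by (rule W.M.finsum_addf) (use uv in \<open>auto intro: linear_mapD(3)[OF T]\<close>)
    finally show "(\<Oplus>\<^bsub>W\<^esub>i\<in>A. T i (u \<oplus>\<^bsub>V\<^esub> v)) = \<dots>" .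
  next
    fix c v assume cv: "c \<in> carrier K" "v \<in> carrier V"
    have "(\<Oplus>\<^bsub>W\<^esub>i\<in>A. T i (c \<odot>\<^bsub>V\<^esub> v)) = (\<Oplus>\<^bsub>W\<^esub>i\<in>A. c \<odot>\<^bsub>W\<^esub> T i v)"
      by (rule W.M.finsum_cong') (use cv in \<open>auto simp: linear_mapD(3,5)[OF T]\<close>)
    also have "\<dots> = c \<odot>\<^bsub>W\<^esub> (\<Oplus>\<^bsub>W\<^esub>i\<in>A. T i v)"
      by (rule W.finsum_smult[symmetric]) (use cv in \<open>auto intro: linear_mapD(3)[OF T]\<close>)
    finally show "(\<Oplus>\<^bsub>W\<^esub>i\<in>A. T i (c \<odot>\<^bsub>V\<^esub> v)) = \<dots>" .
  qed (use assms in simp_all)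
qed

lemma linear_map_smult_of_map:
  assumes "linear_map K V W T" and "c \<in> carrier K"
  shows "linear_map K V W (\<lambda>v. c \<odot>\<^bsub>W\<^esub> T v)"
proof -
  interpret V: vectorspace K V using assms(1) by (rule linear_mapD)
  interpret W: vectorspace K W using assms(1) by (rule linear_mapD)
  show ?thesis
  proof (rule linear_mapI)
    fix a v assume "a \<in> carrier K" "v \<in> carrier V"
    then show "c \<odot>\<^bsub>W\<^esub> T (a \<odot>\<^bsub>V\<^esub> v) = a \<odot>\<^bsub>W\<^esub> (c \<odot>\<^bsub>W\<^esub> T v)"
      using assms(2) linear_mapD(3,5)[OF assms(1)]
      by (simp add: V.R.m_comm flip: W.smult_assoc1)
  qed (use assms in \<open>auto simp: linear_mapD W.smult_r_distr intro: V.vectorspace_axioms W.vectorspace_axioms\<close>)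
qed

text \<open>Surjectivity turns each quantifier over \<open>carrier W\<close> into one over
  \<open>carrier V\<close>, and compatibility with the operations then transfers the axioms one by
  one. This supplies the structure both of quotients and of copies along an injection.\<close>

lemma vectorspace_surj_image:
  assumes "vectorspace K V" and surj: "h ` carrier V = carrier W"
    and zero: "h \<zero>\<^bsub>V\<^esub> = \<zero>\<^bsub>W\<^esub>"
    and add: "\<And>u v. \<lbrakk>u \<in> carrier V; v \<in> carrier V\<rbrakk> \<Longrightarrow> h (u \<oplus>\<^bsub>V\<^esub> v) = h u \<oplus>\<^bsub>W\<^esub> h v"
    and smult: "\<And>c v. \<lbrakk>c \<in> carrier K; v \<in> carrier V\<rbrakk> \<Longrightarrow> h (c \<odot>\<^bsub>V\<^esub> v) = c \<odot>\<^bsub>W\<^esub> h v"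
  shows "vectorspace K W" and "linear_map K V W h"
proof -
  interpret V: vectorspace K V by fact
  have W: "\<And>P. (\<forall>w \<in> carrier W. P w) \<longleftrightarrow> (\<forall>v \<in> carrier V. P (h v))"
    unfolding surj[symmetric] by blast
  show vs: "vectorspace K W"
  proof (rule vs_criteria)
    show "field K" by (rule V.field_axioms)
    show "\<zero>\<^bsub>W\<^esub> \<in> carrier W" using surj zero V.M.zero_closed by (metis imageI)
    have "\<forall>v\<in>carrier W. \<forall>w\<in>carrier W. v \<oplus>\<^bsub>W\<^esub> w \<in> carrier W"
      unfolding W using surj by (auto simp flip: add)
    then show "\<forall>v w. v \<in> carrier W \<and> w \<in> carrier W \<longrightarrow> v \<oplus>\<^bsub>W\<^esub> w \<in> carrier W" by blast
    have "\<exists>n\<in>carrier W. h v \<oplus>\<^bsub>W\<^esub> n = \<zero>\<^bsub>W\<^esub>" if "v \<in> carrier V" for v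
      using that surj
      by (intro bexI[of _ "h (\<ominus>\<^bsub>V\<^esub> v)"]) (auto simp: V.M.r_neg zero simp flip: add)
    then show "\<forall>v\<in>carrier W. \<exists>n\<in>carrier W. v \<oplus>\<^bsub>W\<^esub> n = \<zero>\<^bsub>W\<^esub>"
      unfolding W by blast
    have "\<forall>w\<in>carrier W. \<forall>c\<in>carrier K. c \<odot>\<^bsub>W\<^esub> w \<in> carrier W"
      unfolding W using surj by (auto simp flip: smult)
    then show "\<forall>c w. c \<in> carrier K \<and> w \<in> carrier W \<longrightarrow> c \<odot>\<^bsub>W\<^esub> w \<in> carrier W" by blast
    have "\<forall>v\<in>carrier W. \<forall>w\<in>carrier W. v \<oplus>\<^bsub>W\<^esub> w = w \<oplus>\<^bsub>W\<^esub> v"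
      unfolding W by (auto simp: V.M.a_comm simp flip: add)
    then show "\<forall>v w. v \<in> carrier W \<and> w \<in> carrier W \<longrightarrow> v \<oplus>\<^bsub>W\<^esub> w = w \<oplus>\<^bsub>W\<^esub> v" by blast
    have "\<forall>v\<in>carrier W. \<forall>w\<in>carrier W. \<forall>x\<in>carrier W.
        v \<oplus>\<^bsub>W\<^esub> w \<oplus>\<^bsub>W\<^esub> x = v \<oplus>\<^bsub>W\<^esub> (w \<oplus>\<^bsub>W\<^esub> x)"
      unfolding W by (auto simp: V.M.a_assoc simp flip: add)
    then show "\<forall>v w x. v \<in> carrier W \<and> w \<in> carrier W \<and> x \<in> carrier W \<longrightarrow>
        v \<oplus>\<^bsub>W\<^esub> w \<oplus>\<^bsub>W\<^esub> x = v \<oplus>\<^bsub>W\<^esub> (w \<oplus>\<^bsub>W\<^esub> x)" by blast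
    show "\<forall>v\<in>carrier W. v \<oplus>\<^bsub>W\<^esub> \<zero>\<^bsub>W\<^esub> = v"
      unfolding W by (auto simp flip: add zero)
    have "\<forall>v\<in>carrier W. \<forall>a\<in>carrier K. \<forall>b\<in>carrier K. (a \<otimes>\<^bsub>K\<^esub> b) \<odot>\<^bsub>W\<^esub> v = a \<odot>\<^bsub>W\<^esub> (b \<odot>\<^bsub>W\<^esub> v)"
      unfolding W by (auto simp: V.smult_assoc1 simp flip: smult)
    then show "\<forall>a b v. a \<in> carrier K \<and> b \<in> carrier K \<and> v \<in> carrier W \<longrightarrow>
        (a \<otimes>\<^bsub>K\<^esub> b) \<odot>\<^bsub>W\<^esub> v = a \<odot>\<^bsub>W\<^esub> (b \<odot>\<^bsub>W\<^esub> v)" by blast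
    show "\<forall>v\<in>carrier W. \<one>\<^bsub>K\<^esub> \<odot>\<^bsub>W\<^esub> v = v"
      unfolding W by (auto simp flip: smult)
    have "\<forall>v\<in>carrier W. \<forall>a\<in>carrier K. \<forall>b\<in>carrier K.
        (a \<oplus>\<^bsub>K\<^esub> b) \<odot>\<^bsub>W\<^esub> v = a \<odot>\<^bsub>W\<^esub> v \<oplus>\<^bsub>W\<^esub> b \<odot>\<^bsub>W\<^esub> v"
      unfolding W by (auto simp: V.smult_l_distr simp flip: smult add)
    then show "\<forall>a b v. a \<in> carrier K \<and> b \<in> carrier K \<and> v \<in> carrier W \<longrightarrow>
        (a \<oplus>\<^bsub>K\<^esub> b) \<odot>\<^bsub>W\<^esub> v = a \<odot>\<^bsub>W\<^esub> v \<oplus>\<^bsub>W\<^esub> b \<odot>\<^bsub>W\<^esub> v" by blast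
    have "\<forall>v\<in>carrier W. \<forall>w\<in>carrier W. \<forall>a\<in>carrier K.
        a \<odot>\<^bsub>W\<^esub> (v \<oplus>\<^bsub>W\<^esub> w) = a \<odot>\<^bsub>W\<^esub> v \<oplus>\<^bsub>W\<^esub> a \<odot>\<^bsub>W\<^esub> w"
      unfolding W by (auto simp: V.smult_r_distr simp flip: smult add)
    then show "\<forall>a v w. a \<in> carrier K \<and> v \<in> carrier W \<and> w \<in> carrier W \<longrightarrow>
        a \<odot>\<^bsub>W\<^esub> (v \<oplus>\<^bsub>W\<^esub> w) = a \<odot>\<^bsub>W\<^esub> v \<oplus>\<^bsub>W\<^esub> a \<odot>\<^bsub>W\<^esub> w" by blast
  qed
  show "linear_map K V W h"
    by (rule linear_mapI) (use assms vs in auto)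
qed

section \<open>Subspaces\<close>

lemma subspaceI:
  assumes "vectorspace K V" and "N \<subseteq> carrier V" and "\<zero>\<^bsub>V\<^esub> \<in> N"
    and "\<And>u v. \<lbrakk>u \<in> N; v \<in> N\<rbrakk> \<Longrightarrow> u \<oplus>\<^bsub>V\<^esub> v \<in> N"
    and "\<And>c v. \<lbrakk>c \<in> carrier K; v \<in> N\<rbrakk> \<Longrightarrow> c \<odot>\<^bsub>V\<^esub> v \<in> N"
  shows "subspace K N V"
  using assms by (auto simp: subspace_def submodule_def vectorspace_def)

lemma subspaceD:
  assumes "subspace K N V"
  shows "vectorspace K V" and "N \<subseteq> carrier V" and "\<zero>\<^bsub>V\<^esub> \<in> N"
    and "\<And>u v. \<lbrakk>u \<in> N; v \<in> N\<rbrakk> \<Longrightarrow> u \<oplus>\<^bsub>V\<^esub> v \<in> N"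
    and "\<And>c v. \<lbrakk>c \<in> carrier K; v \<in> N\<rbrakk> \<Longrightarrow> c \<odot>\<^bsub>V\<^esub> v \<in> N"
  using assms by (auto simp: subspace_def submodule_def)

lemma subspace_minus:
  assumes N: "subspace K N V" and "u \<in> N" "v \<in> N"
  shows "u \<ominus>\<^bsub>V\<^esub> v \<in> N"
proof -
  interpret vectorspace K V using N by (rule subspaceD)
  have "v \<in> carrier V" using subspaceD(2)[OF N] assms by auto
  then have "\<ominus>\<^bsub>V\<^esub> v = (\<ominus>\<^bsub>K\<^esub> \<one>\<^bsub>K\<^esub>) \<odot>\<^bsub>V\<^esub> v" by (simp add: smult_minus_1)
  then show ?thesis using assms by (simp add: a_minus_def subspaceD[OF N])
qed

subsection \<open>Quotients\<close>

text \<open>The coset map is onto and additive, so \<open>vectorspace_surj_image\<close> transports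
  the structure. Only the scalar action takes work, because \<open>quotient_module\<close> adds
  \<open>N\<close> to the set of multiples.\<close>

lemma quotient_module_coset:
  assumes N: "subspace K N V"
  shows "vectorspace K (quotient_module V N)"
    and "linear_map K V (quotient_module V N) (a_r_coset V N)"
    and "carrier (quotient_module V N) = a_r_coset V N ` carrier V"
proof -
  interpret V: vectorspace K V using N by (rule subspaceD)
  note NV = subspaceD(2)[OF N]
  have sub: "subgroup N (add_monoid V)"
    by (rule V.M.add.subgroupI)
      (use subspaceD[OF N] subspace_minus[OF N, of "\<zero>\<^bsub>V\<^esub>"] in \<open>auto simp: V.M.minus_eq subset_iff\<close>)
  have norm: "normal N (add_monoid V)"
    using sub by (simp add: V.M.a_comm_group comm_group.subgroup_imp_normal)
  show carrier: "carrier (quotient_module V N) = a_r_coset V N ` carrier V"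
    by (auto simp: quotient_module_def A_RCOSETS_def')
  have zero: "a_r_coset V N \<zero>\<^bsub>V\<^esub> = \<zero>\<^bsub>quotient_module V N\<^esub>"
    using NV by (auto simp: quotient_module_def a_r_coset_def' subset_iff)
  have add: "a_r_coset V N (u \<oplus>\<^bsub>V\<^esub> v) = a_r_coset V N u \<oplus>\<^bsub>quotient_module V N\<^esub> a_r_coset V N v"
    if "u \<in> carrier V" "v \<in> carrier V" for u v
    using normal.rcos_sum[OF norm] that
    by (simp add: quotient_module_def set_add_def a_r_coset_def)
  have smult: "a_r_coset V N (c \<odot>\<^bsub>V\<^esub> v) = c \<odot>\<^bsub>quotient_module V N\<^esub> a_r_coset V N v"
    if c: "c \<in> carrier K" and v: "v \<in> carrier V" for c v
  proof -
    have "n \<oplus>\<^bsub>V\<^esub> c \<odot>\<^bsub>V\<^esub> (n' \<oplus>\<^bsub>V\<^esub> v) = (n \<oplus>\<^bsub>V\<^esub> c \<odot>\<^bsub>V\<^esub> n') \<oplus>\<^bsub>V\<^esub> c \<odot>\<^bsub>V\<^esub> v"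
      if "n \<in> N" "n' \<in> N" for n n'
      using that c v NV by (simp add: V.smult_r_distr V.M.a_assoc subset_iff)
    then have "c \<odot>\<^bsub>quotient_module V N\<^esub> a_r_coset V N v
        = {(n \<oplus>\<^bsub>V\<^esub> c \<odot>\<^bsub>V\<^esub> n') \<oplus>\<^bsub>V\<^esub> c \<odot>\<^bsub>V\<^esub> v | n n'. n \<in> N \<and> n' \<in> N}"
      by (fastforce simp: quotient_module_def set_add_def' a_r_coset_def')
    \<comment> \<open>The elements n + c n' run exactly through \<open>N\<close>: closure keeps them
      inside, and n' = 0 reaches each of them.\<close>
    also have "\<dots> = {n \<oplus>\<^bsub>V\<^esub> c \<odot>\<^bsub>V\<^esub> v | n. n \<in> N}"
    proof (intro equalityI subsetI)
      fix x assume "x \<in> {n \<oplus>\<^bsub>V\<^esub> c \<odot>\<^bsub>V\<^esub> v | n. n \<in> N}"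
      then obtain n where "n \<in> N" "x = n \<oplus>\<^bsub>V\<^esub> c \<odot>\<^bsub>V\<^esub> v" by blast
      moreover from this have "n = n \<oplus>\<^bsub>V\<^esub> c \<odot>\<^bsub>V\<^esub> \<zero>\<^bsub>V\<^esub>" using c NV by auto
      ultimately show "x \<in> {(n \<oplus>\<^bsub>V\<^esub> c \<odot>\<^bsub>V\<^esub> n') \<oplus>\<^bsub>V\<^esub> c \<odot>\<^bsub>V\<^esub> v | n n'. n \<in> N \<and> n' \<in> N}"
        using subspaceD(3)[OF N] by (smt (verit, best) mem_Collect_eq)
    qed (use subspaceD[OF N] c in blast)
    finally show ?thesis by (auto simp: a_r_coset_def')
  qed
  show "vectorspace K (quotient_module V N)" and "linear_map K V (quotient_module V N) (a_r_coset V N)"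
    using vectorspace_surj_image[OF V.vectorspace_axioms carrier[symmetric] zero add smult] by auto
qed

subsection \<open>Complements\<close>

text \<open>A subspace maximal among those meeting \<open>S\<close> trivially is a complement of \<open>S\<close>.\<close>
lemma complement_exists:
  assumes S: "subspace K S V"
  shows "\<exists>U. subspace K U V \<and> U \<inter> S = {\<zero>\<^bsub>V\<^esub>} \<and>
    (\<forall>v \<in> carrier V. \<exists>u \<in> U. \<exists>s \<in> S. v = u \<oplus>\<^bsub>V\<^esub> s)"
proof -
  interpret V: vectorspace K V using S by (rule subspaceD)
  define A where "A = {U. subspace K U V \<and> U \<inter> S = {\<zero>\<^bsub>V\<^esub>}}"
  have "{\<zero>\<^bsub>V\<^esub>} \<in> A"
    using subspaceD[OF S] V.vectorspace_axioms by (auto simp: A_def intro!: subspaceI)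
  then have "A \<noteq> {}" by blast
  \<comment> \<open>The hypothesis of Zorn's lemma. Members of a chain are comparable, so two
    vectors of the union already lie in a common member.\<close>
  moreover have "\<Union>Q \<in> A" if "Q \<noteq> {}" and Q: "subset.chain A Q" for Q
  proof -
    have QA: "subspace K U V" "U \<inter> S = {\<zero>\<^bsub>V\<^esub>}" if "U \<in> Q" for U
      using Q that by (auto simp: A_def subset.chain_def)
    have QQ: "U \<subseteq> U' \<or> U' \<subseteq> U" if "U \<in> Q" "U' \<in> Q" for U U'
      using Q that by (auto simp: subset.chain_def)
    have "subspace K (\<Union>Q) V"
    proof (rule subspaceI)
      fix u v assume "u \<in> \<Union>Q" "v \<in> \<Union>Q"
      then obtain U where "U \<in> Q" "u \<in> U" "v \<in> U" using QQ by blast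
      then show "u \<oplus>\<^bsub>V\<^esub> v \<in> \<Union>Q" using subspaceD(4)[OF QA(1)] by blast
    next
      show "\<Union>Q \<subseteq> carrier V" using subspaceD(2)[OF QA(1)] by blast
      show "\<zero>\<^bsub>V\<^esub> \<in> \<Union>Q" using \<open>Q \<noteq> {}\<close> subspaceD(3)[OF QA(1)] by blast
      show "c \<odot>\<^bsub>V\<^esub> v \<in> \<Union>Q" if "c \<in> carrier K" "v \<in> \<Union>Q" for c v
        using that subspaceD(5)[OF QA(1)] by blast
    qed (rule V.vectorspace_axioms)
    moreover have "\<Union>Q \<inter> S = {\<zero>\<^bsub>V\<^esub>}" using QA(2) \<open>Q \<noteq> {}\<close> by blast
    ultimately show ?thesis by (simp add: A_def)
  qed
  ultimately obtain U where "U \<in> A" and max: "\<And>X. \<lbrakk>X \<in> A; U \<subseteq> X\<rbrakk> \<Longrightarrow> X = U"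
    using subset_Zorn_nonempty[of A] by metis
  then have U: "subspace K U V" "U \<inter> S = {\<zero>\<^bsub>V\<^esub>}" by (auto simp: A_def)
  note UV = subspaceD(2)[OF U(1)] and SV = subspaceD(2)[OF S]
  have "\<exists>u \<in> U. \<exists>s \<in> S. v = u \<oplus>\<^bsub>V\<^esub> s" if v: "v \<in> carrier V" for v
  proof (rule ccontr)
    assume neg: "\<not> ?thesis"
    \<comment> \<open>If v had no decomposition, U + K v would still meet S trivially, against the
      maximality of U.\<close>
    define X where "X = {u \<oplus>\<^bsub>V\<^esub> c \<odot>\<^bsub>V\<^esub> v | u c. u \<in> U \<and> c \<in> carrier K}"
    have "subspace K X V"
    proof (rule subspaceI)
      show "X \<subseteq> carrier V" using UV v by (auto simp: X_def)
      show "\<zero>\<^bsub>V\<^esub> \<in> X" using v subspaceD(3)[OF U(1)]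
        by (auto simp: X_def intro!: exI[of _ "\<zero>\<^bsub>V\<^esub>"] exI[of _ "\<zero>\<^bsub>K\<^esub>"])
    next
      fix x y assume "x \<in> X" "y \<in> X"
      then obtain u c u' c' where xy: "x = u \<oplus>\<^bsub>V\<^esub> c \<odot>\<^bsub>V\<^esub> v" "y = u' \<oplus>\<^bsub>V\<^esub> c' \<odot>\<^bsub>V\<^esub> v"
        and *: "u \<in> U" "c \<in> carrier K" "u' \<in> U" "c' \<in> carrier K" by (auto simp: X_def)
      then have "u \<in> carrier V" "u' \<in> carrier V" using UV by auto
      with * v have "x \<oplus>\<^bsub>V\<^esub> y = (u \<oplus>\<^bsub>V\<^esub> u') \<oplus>\<^bsub>V\<^esub> (c \<oplus>\<^bsub>K\<^esub> c') \<odot>\<^bsub>V\<^esub> v"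
        unfolding xy by (simp add: V.smult_l_distr V.M.a_ac)
      then show "x \<oplus>\<^bsub>V\<^esub> y \<in> X" using * subspaceD(4)[OF U(1)] by (auto simp: X_def)
    next
      fix a x assume a: "a \<in> carrier K" and "x \<in> X"
      then obtain u c where x: "x = u \<oplus>\<^bsub>V\<^esub> c \<odot>\<^bsub>V\<^esub> v" and *: "u \<in> U" "c \<in> carrier K"
        by (auto simp: X_def)
      then have "u \<in> carrier V" using UV by auto
      with * v a have "a \<odot>\<^bsub>V\<^esub> x = a \<odot>\<^bsub>V\<^esub> u \<oplus>\<^bsub>V\<^esub> (a \<otimes>\<^bsub>K\<^esub> c) \<odot>\<^bsub>V\<^esub> v"
        unfolding x by (simp add: V.smult_r_distr V.smult_assoc1)
      then show "a \<odot>\<^bsub>V\<^esub> x \<in> X" using * a subspaceD(5)[OF U(1)] by (auto simp: X_def)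
    qed (rule V.vectorspace_axioms)
    moreover have "X \<inter> S = {\<zero>\<^bsub>V\<^esub>}"
    proof (intro equalityI subsetI)
      fix x assume "x \<in> X \<inter> S"
      then obtain u c where x: "x = u \<oplus>\<^bsub>V\<^esub> c \<odot>\<^bsub>V\<^esub> v" "x \<in> S" and *: "u \<in> U" "c \<in> carrier K"
        by (auto simp: X_def)
      then have uV: "u \<in> carrier V" and xV: "x \<in> carrier V" using UV SV by auto
      show "x \<in> {\<zero>\<^bsub>V\<^esub>}"
      proof (cases "c = \<zero>\<^bsub>K\<^esub>")
        case True
        then have "x = u" using x uV v by simp
        then show ?thesis using x * U by blast
      next
        \<comment> \<open>Since c is invertible, x = u + c v can be solved for v, which would write
          v as an element of U plus an element of S.\<close>
        case False
        then have i: "inv\<^bsub>K\<^esub> c \<in> carrier K" "inv\<^bsub>K\<^esub> c \<otimes>\<^bsub>K\<^esub> c = \<one>\<^bsub>K\<^esub>"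
          using * V.field_Units by auto
        have "c \<odot>\<^bsub>V\<^esub> v = x \<ominus>\<^bsub>V\<^esub> u"
          using x(1) uV * v by (simp add: V.M.minus_eq V.M.a_ac V.M.r_neg2)
        then have "inv\<^bsub>K\<^esub> c \<odot>\<^bsub>V\<^esub> (c \<odot>\<^bsub>V\<^esub> v) = inv\<^bsub>K\<^esub> c \<odot>\<^bsub>V\<^esub> (x \<ominus>\<^bsub>V\<^esub> u)" by simp
        then have "v = inv\<^bsub>K\<^esub> c \<odot>\<^bsub>V\<^esub> (\<zero>\<^bsub>V\<^esub> \<ominus>\<^bsub>V\<^esub> u) \<oplus>\<^bsub>V\<^esub> inv\<^bsub>K\<^esub> c \<odot>\<^bsub>V\<^esub> x"
          using i * v uV xV
          by (simp add: V.M.minus_eq V.smult_r_distr V.M.a_comm flip: V.smult_assoc1)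
        moreover have "inv\<^bsub>K\<^esub> c \<odot>\<^bsub>V\<^esub> (\<zero>\<^bsub>V\<^esub> \<ominus>\<^bsub>V\<^esub> u) \<in> U" "inv\<^bsub>K\<^esub> c \<odot>\<^bsub>V\<^esub> x \<in> S"
          using i * x subspaceD[OF U(1)] subspaceD[OF S] subspace_minus[OF U(1)] by auto
        ultimately show ?thesis using neg by blast
      qed
    qed (use subspaceD(3)[OF S] subspaceD(3)[OF \<open>subspace K X V\<close>] in blast)
    moreover have "U \<subseteq> X"
    proof
      fix u assume "u \<in> U"
      moreover from this have "u = u \<oplus>\<^bsub>V\<^esub> \<zero>\<^bsub>K\<^esub> \<odot>\<^bsub>V\<^esub> v" using UV v by auto
      ultimately show "u \<in> X" unfolding X_def by blast
    qed
    ultimately have "X = U" using max by (simp add: A_def)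
    moreover have "v \<in> X"
      using v subspaceD(3)[OF U(1)]
      by (auto simp: X_def intro!: exI[of _ "\<zero>\<^bsub>V\<^esub>"] exI[of _ "\<one>\<^bsub>K\<^esub>"])
    moreover have "v = v \<oplus>\<^bsub>V\<^esub> \<zero>\<^bsub>V\<^esub>" using v by simp
    ultimately show False using neg subspaceD(3)[OF S] by blast
  qed
  then show ?thesis using U by blast
qed

text \<open>\<open>p\<close> takes the S-component along a complement. It is applied at the end with
  S the span of finitely many morphisms in a Hom space of unknown dimension.\<close>

lemma projection_exists:
  assumes S: "subspace K S V"
  shows "\<exists>p. linear_map K V V p \<and> (\<forall>v \<in> carrier V. p v \<in> S) \<and> (\<forall>s \<in> S. p s = s)"
proof -
  interpret V: vectorspace K V using S by (rule subspaceD)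
  obtain U where U: "subspace K U V" "U \<inter> S = {\<zero>\<^bsub>V\<^esub>}"
    and dec: "\<And>v. v \<in> carrier V \<Longrightarrow> \<exists>u \<in> U. \<exists>s \<in> S. v = u \<oplus>\<^bsub>V\<^esub> s"
    using complement_exists[OF S] by blast
  note UV = subspaceD(2)[OF U(1)] and SV = subspaceD(2)[OF S]
  have uniq: "s = s'" if "u \<oplus>\<^bsub>V\<^esub> s = u' \<oplus>\<^bsub>V\<^esub> s'" "u \<in> U" "u' \<in> U" "s \<in> S" "s' \<in> S" for u u' s s'
  proof -
    have c: "u \<in> carrier V" "u' \<in> carrier V" "s \<in> carrier V" "s' \<in> carrier V"
      using that UV SV by auto
    have "u \<ominus>\<^bsub>V\<^esub> u' = s' \<ominus>\<^bsub>V\<^esub> s"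
    proof -
      have "u \<ominus>\<^bsub>V\<^esub> u' = (u \<oplus>\<^bsub>V\<^esub> s) \<oplus>\<^bsub>V\<^esub> (\<ominus>\<^bsub>V\<^esub> s \<oplus>\<^bsub>V\<^esub> \<ominus>\<^bsub>V\<^esub> u')"
        using c by (simp add: V.M.minus_eq V.M.a_assoc V.M.r_neg2)
      also have "\<dots> = (u' \<oplus>\<^bsub>V\<^esub> s') \<oplus>\<^bsub>V\<^esub> (\<ominus>\<^bsub>V\<^esub> u' \<oplus>\<^bsub>V\<^esub> \<ominus>\<^bsub>V\<^esub> s)"
        using c that(1) by (simp add: V.M.a_comm)
      also have "\<dots> = (s' \<oplus>\<^bsub>V\<^esub> u') \<oplus>\<^bsub>V\<^esub> (\<ominus>\<^bsub>V\<^esub> u' \<oplus>\<^bsub>V\<^esub> \<ominus>\<^bsub>V\<^esub> s)"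
        using c by (simp add: V.M.a_comm)
      also have "\<dots> = s' \<ominus>\<^bsub>V\<^esub> s"
        using c by (simp add: V.M.minus_eq V.M.a_assoc V.M.r_neg2)
      finally show ?thesis .
    qed
    moreover have "u \<ominus>\<^bsub>V\<^esub> u' \<in> U" "s' \<ominus>\<^bsub>V\<^esub> s \<in> S"
      using that subspace_minus[OF U(1)] subspace_minus[OF S] by auto
    ultimately have "s' \<ominus>\<^bsub>V\<^esub> s = \<zero>\<^bsub>V\<^esub>" using U(2) by (metis IntI singletonD)
    then show ?thesis using c by simp
  qed
  define p where "p v = (THE s. s \<in> S \<and> (\<exists>u \<in> U. v = u \<oplus>\<^bsub>V\<^esub> s))" for v
  have p: "p (u \<oplus>\<^bsub>V\<^esub> s) = s" if "u \<in> U" "s \<in> S" for u s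
    unfolding p_def using that uniq by (intro the_equality) blast+
  have "linear_map K V V p"
  proof (rule linear_mapI)
    fix v assume "v \<in> carrier V"
    then show "p v \<in> carrier V" using dec p SV by (metis subsetD)
  next
    fix v w assume "v \<in> carrier V" "w \<in> carrier V"
    then obtain u s u' s' where *: "u \<in> U" "s \<in> S" "u' \<in> U" "s' \<in> S"
      and vw: "v = u \<oplus>\<^bsub>V\<^esub> s" "w = u' \<oplus>\<^bsub>V\<^esub> s'" using dec by metis
    then have "v \<oplus>\<^bsub>V\<^esub> w = (u \<oplus>\<^bsub>V\<^esub> u') \<oplus>\<^bsub>V\<^esub> (s \<oplus>\<^bsub>V\<^esub> s')"
      using UV SV by (simp add: V.M.a_ac subset_iff)
    then show "p (v \<oplus>\<^bsub>V\<^esub> w) = p v \<oplus>\<^bsub>V\<^esub> p w"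
      using * vw p subspaceD(4)[OF U(1)] subspaceD(4)[OF S] by simp
  next
    fix c v assume c: "c \<in> carrier K" and "v \<in> carrier V"
    then obtain u s where *: "u \<in> U" "s \<in> S" and v: "v = u \<oplus>\<^bsub>V\<^esub> s" using dec by metis
    then have "c \<odot>\<^bsub>V\<^esub> v = c \<odot>\<^bsub>V\<^esub> u \<oplus>\<^bsub>V\<^esub> c \<odot>\<^bsub>V\<^esub> s"
      using UV SV c by (simp add: V.smult_r_distr subset_iff)
    then show "p (c \<odot>\<^bsub>V\<^esub> v) = c \<odot>\<^bsub>V\<^esub> p v"
      using * v c p subspaceD(5)[OF U(1)] subspaceD(5)[OF S] by simp
  qed (rule V.vectorspace_axioms)+
  moreover have "\<forall>v \<in> carrier V. p v \<in> S" using dec p by metis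
  moreover have "p s = s" if "s \<in> S" for s
    using p[OF subspaceD(3)[OF U(1)] that] that SV by (simp add: subset_iff)
  ultimately show ?thesis by blast
qed

subsection \<open>Finitely supported families\<close>

text \<open>Covers both the free modules of the tensor product (all \<open>U i\<close> equal to the base field) and
  the direct sums of representable functors.\<close>
locale finite_support_sum = field K
  for K :: "('k, 'r) ring_scheme" (structure) +
  fixes V :: "('k, 'i \<Rightarrow> 'u) module" and I :: "'i set" and U :: "'i \<Rightarrow> ('k, 'u) module"
  assumes summand: "i \<in> I \<Longrightarrow> vectorspace K (U i)"
    and carrier_eq: "carrier V = {p \<in> \<Pi>\<^sub>E i\<in>I. carrier (U i). finite {i \<in> I. p i \<noteq> \<zero>\<^bsub>U i\<^esub>}}"
    and zero_eq: "\<zero>\<^bsub>V\<^esub> = (\<lambda>i\<in>I. \<zero>\<^bsub>U i\<^esub>)"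
    and add_eq: "p \<oplus>\<^bsub>V\<^esub> q = (\<lambda>i\<in>I. p i \<oplus>\<^bsub>U i\<^esub> q i)"
    and smult_eq: "c \<odot>\<^bsub>V\<^esub> p = (\<lambda>i\<in>I. c \<odot>\<^bsub>U i\<^esub> p i)"
begin

definition supp :: "('i \<Rightarrow> 'u) \<Rightarrow> 'i set" where
  "supp p = {i \<in> I. p i \<noteq> \<zero>\<^bsub>U i\<^esub>}"

lemma supp_subset: "supp p \<subseteq> I"
  by (auto simp: supp_def)

lemma suppD: "i \<in> supp p \<Longrightarrow> i \<in> I"
  by (simp add: supp_def)

lemma finite_supp: "p \<in> carrier V \<Longrightarrow> finite (supp p)"
  by (simp add: carrier_eq supp_def)

lemma apply_closed: "\<lbrakk>p \<in> carrier V; i \<in> I\<rbrakk> \<Longrightarrow> p i \<in> carrier (U i)"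
  by (auto simp: carrier_eq)

lemma closedI:
  assumes "p \<in> extensional I" and "\<And>i. i \<in> I \<Longrightarrow> p i \<in> carrier (U i)"
    and "finite F" and "\<And>i. \<lbrakk>i \<in> I; i \<notin> F\<rbrakk> \<Longrightarrow> p i = \<zero>\<^bsub>U i\<^esub>"
  shows "p \<in> carrier V"
proof -
  have "{i \<in> I. p i \<noteq> \<zero>\<^bsub>U i\<^esub>} \<subseteq> F" using assms(4) by auto
  then show ?thesis
    using assms finite_subset by (auto simp: carrier_eq PiE_def)
qed

lemma eqI:
  assumes "p \<in> carrier V" "q \<in> carrier V" and "\<And>i. i \<in> I \<Longrightarrow> p i = q i"
  shows "p = q"
  using assms by (auto simp: carrier_eq intro: PiE_ext)

lemma not_supp: "\<lbrakk>i \<in> I; i \<notin> supp p\<rbrakk> \<Longrightarrow> p i = \<zero>\<^bsub>U i\<^esub>"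
  by (simp add: supp_def)

lemma summand_facts:
  assumes i: "i \<in> I"
  shows "abelian_group (U i)" and "module K (U i)"
proof -
  interpret vectorspace K "U i" using i by (rule summand)
  show "abelian_group (U i)" "module K (U i)" by unfold_locales
qed

lemma is_vectorspace: "vectorspace K V"
proof (rule vs_criteria)
  note U = vectorspace_closed[OF summand]
  show zero: "\<zero>\<^bsub>V\<^esub> \<in> carrier V"
    by (rule closedI[of _ "{}"]) (auto simp: zero_eq U)
  show "\<forall>v w. v \<in> carrier V \<and> w \<in> carrier V \<longrightarrow> v \<oplus>\<^bsub>V\<^esub> w \<in> carrier V"
  proof (intro allI impI)
    fix v w assume vw: "v \<in> carrier V \<and> w \<in> carrier V"
    show "v \<oplus>\<^bsub>V\<^esub> w \<in> carrier V"
    proof (rule closedI[of _ "supp v \<union> supp w"])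
      fix i assume i: "i \<in> I" "i \<notin> supp v \<union> supp w"
      interpret vectorspace K "U i" using i(1) by (rule summand)
      show "(v \<oplus>\<^bsub>V\<^esub> w) i = \<zero>\<^bsub>U i\<^esub>" using i by (simp add: add_eq not_supp)
    qed (use vw in \<open>auto simp: add_eq U apply_closed finite_supp\<close>)
  qed
  show smult: "\<forall>c v. c \<in> carrier K \<and> v \<in> carrier V \<longrightarrow> c \<odot>\<^bsub>V\<^esub> v \<in> carrier V"
  proof (intro allI impI)
    fix c v assume cv: "c \<in> carrier K \<and> v \<in> carrier V"
    show "c \<odot>\<^bsub>V\<^esub> v \<in> carrier V"
    proof (rule closedI[of _ "supp v"])
      fix i assume i: "i \<in> I" "i \<notin> supp v"
      interpret vectorspace K "U i" using i(1) by (rule summand)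
      show "(c \<odot>\<^bsub>V\<^esub> v) i = \<zero>\<^bsub>U i\<^esub>" using i cv by (simp add: smult_eq not_supp)
    qed (use cv in \<open>auto simp: smult_eq U apply_closed finite_supp\<close>)
  qed
  \<comment> \<open>Additive inverses are what has to be produced here, so the inverse of v is taken
    to be its multiple by minus one, with the law checked componentwise.\<close>
  have neg: "(\<ominus>\<^bsub>K\<^esub> \<one>\<^bsub>K\<^esub>) \<odot>\<^bsub>V\<^esub> v \<in> carrier V" if "v \<in> carrier V" for v
    using smult that by auto
  have inv: "v i \<oplus>\<^bsub>U i\<^esub> (\<ominus>\<^bsub>K\<^esub> \<one>\<^bsub>K\<^esub>) \<odot>\<^bsub>U i\<^esub> v i = \<zero>\<^bsub>U i\<^esub>" if "v \<in> carrier V" "i \<in> I" for v i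
  proof -
    interpret vectorspace K "U i" using that by (intro summand)
    show ?thesis using apply_closed[OF that] by (simp add: smult_minus_1 M.r_neg)
  qed
  show "\<forall>v\<in>carrier V. \<exists>n\<in>carrier V. v \<oplus>\<^bsub>V\<^esub> n = \<zero>\<^bsub>V\<^esub>"
  proof
    fix v assume v: "v \<in> carrier V"
    have "v \<oplus>\<^bsub>V\<^esub> (\<ominus>\<^bsub>K\<^esub> \<one>\<^bsub>K\<^esub>) \<odot>\<^bsub>V\<^esub> v = \<zero>\<^bsub>V\<^esub>"
      using inv[OF v] by (auto simp: add_eq smult_eq zero_eq)
    with neg[OF v] show "\<exists>n\<in>carrier V. v \<oplus>\<^bsub>V\<^esub> n = \<zero>\<^bsub>V\<^esub>" by blast
  qed
  show "\<forall>v w. v \<in> carrier V \<and> w \<in> carrier V \<longrightarrow> v \<oplus>\<^bsub>V\<^esub> w = w \<oplus>\<^bsub>V\<^esub> v"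
    using abelian_monoid.a_comm[OF abelian_group.axioms(1)[OF summand_facts(1)]]
    by (auto simp: add_eq apply_closed intro!: restrict_ext)
  show "\<forall>v w x. v \<in> carrier V \<and> w \<in> carrier V \<and> x \<in> carrier V \<longrightarrow>
      v \<oplus>\<^bsub>V\<^esub> w \<oplus>\<^bsub>V\<^esub> x = v \<oplus>\<^bsub>V\<^esub> (w \<oplus>\<^bsub>V\<^esub> x)"
    using abelian_monoid.a_assoc[OF abelian_group.axioms(1)[OF summand_facts(1)]]
    by (auto simp: add_eq apply_closed intro!: restrict_ext)
  show "\<forall>v\<in>carrier V. v \<oplus>\<^bsub>V\<^esub> \<zero>\<^bsub>V\<^esub> = v"
  proof
    fix v assume v: "v \<in> carrier V"
    have "v i \<oplus>\<^bsub>U i\<^esub> \<zero>\<^bsub>U i\<^esub> = v i" if "i \<in> I" for i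
      using abelian_monoid.r_zero[OF abelian_group.axioms(1)[OF summand_facts(1)]] v that
      by (simp add: apply_closed)
    moreover have "v \<in> extensional I" using v by (auto simp: carrier_eq PiE_def)
    ultimately show "v \<oplus>\<^bsub>V\<^esub> \<zero>\<^bsub>V\<^esub> = v"
      by (auto simp: add_eq zero_eq extensional_def)
  qed
  show "\<forall>a b v. a \<in> carrier K \<and> b \<in> carrier K \<and> v \<in> carrier V \<longrightarrow>
      (a \<otimes>\<^bsub>K\<^esub> b) \<odot>\<^bsub>V\<^esub> v = a \<odot>\<^bsub>V\<^esub> (b \<odot>\<^bsub>V\<^esub> v)"
    using module.smult_assoc1[OF summand_facts(2)]
    by (auto simp: smult_eq apply_closed intro!: restrict_ext)
  show "\<forall>v\<in>carrier V. \<one>\<^bsub>K\<^esub> \<odot>\<^bsub>V\<^esub> v = v"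
  proof
    fix v assume v: "v \<in> carrier V"
    then have "v \<in> extensional I" by (auto simp: carrier_eq PiE_def)
    then show "\<one>\<^bsub>K\<^esub> \<odot>\<^bsub>V\<^esub> v = v"
      using module.smult_one[OF summand_facts(2)] v
      by (auto simp: smult_eq apply_closed extensional_def)
  qed
  show "\<forall>a b v. a \<in> carrier K \<and> b \<in> carrier K \<and> v \<in> carrier V \<longrightarrow>
      (a \<oplus>\<^bsub>K\<^esub> b) \<odot>\<^bsub>V\<^esub> v = a \<odot>\<^bsub>V\<^esub> v \<oplus>\<^bsub>V\<^esub> b \<odot>\<^bsub>V\<^esub> v"
    using module.smult_l_distr[OF summand_facts(2)]
    by (auto simp: smult_eq add_eq apply_closed intro!: restrict_ext)
  show "\<forall>a v w. a \<in> carrier K \<and> v \<in> carrier V \<and> w \<in> carrier V \<longrightarrow>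
      a \<odot>\<^bsub>V\<^esub> (v \<oplus>\<^bsub>V\<^esub> w) = a \<odot>\<^bsub>V\<^esub> v \<oplus>\<^bsub>V\<^esub> a \<odot>\<^bsub>V\<^esub> w"
    using module.smult_r_distr[OF summand_facts(2)]
    by (auto simp: smult_eq add_eq apply_closed intro!: restrict_ext)
qed (rule field_axioms)

lemma component_linear: "i \<in> I \<Longrightarrow> linear_map K V (U i) (\<lambda>p. p i)"
  by (rule linear_mapI) (auto simp: is_vectorspace summand add_eq smult_eq apply_closed)

definition incl :: "'i \<Rightarrow> 'u \<Rightarrow> 'i \<Rightarrow> 'u" where
  "incl i u = (\<lambda>j\<in>I. if j = i then u else \<zero>\<^bsub>U j\<^esub>)"

lemma incl_apply: "j \<in> I \<Longrightarrow> incl i u j = (if j = i then u else \<zero>\<^bsub>U j\<^esub>)"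
  by (simp add: incl_def)

lemma incl_closed: "\<lbrakk>i \<in> I; u \<in> carrier (U i)\<rbrakk> \<Longrightarrow> incl i u \<in> carrier V"
  by (rule closedI[of _ "{i}"]) (auto simp: incl_def vectorspace_closed[OF summand])

lemma incl_linear:
  assumes i: "i \<in> I" shows "linear_map K (U i) V (incl i)"
proof (rule linear_mapI)
  have z: "\<zero>\<^bsub>U j\<^esub> \<oplus>\<^bsub>U j\<^esub> \<zero>\<^bsub>U j\<^esub> = \<zero>\<^bsub>U j\<^esub>" "\<And>c. c \<in> carrier K \<Longrightarrow> c \<odot>\<^bsub>U j\<^esub> \<zero>\<^bsub>U j\<^esub> = \<zero>\<^bsub>U j\<^esub>"
    if "j \<in> I" for j
  proof -
    interpret vectorspace K "U j" using that by (rule summand)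
    show "\<zero>\<^bsub>U j\<^esub> \<oplus>\<^bsub>U j\<^esub> \<zero>\<^bsub>U j\<^esub> = \<zero>\<^bsub>U j\<^esub>" "\<And>c. c \<in> carrier K \<Longrightarrow> c \<odot>\<^bsub>U j\<^esub> \<zero>\<^bsub>U j\<^esub> = \<zero>\<^bsub>U j\<^esub>"
      by simp_all
  qed
  show "incl i (u \<oplus>\<^bsub>U i\<^esub> v) = incl i u \<oplus>\<^bsub>V\<^esub> incl i v" for u v
    by (auto simp: incl_def add_eq z intro!: restrict_ext)
  show "incl i (c \<odot>\<^bsub>U i\<^esub> v) = c \<odot>\<^bsub>V\<^esub> incl i v" if "c \<in> carrier K" for c v
    using that by (auto simp: incl_def smult_eq z intro!: restrict_ext)
qed (use i in \<open>auto simp: is_vectorspace summand incl_closed\<close>)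

lemma decompose:
  assumes p: "p \<in> carrier V"
  shows "p = (\<Oplus>\<^bsub>V\<^esub>i\<in>supp p. incl i (p i))"
proof (rule eqI)
  interpret V: vectorspace K V by (rule is_vectorspace)
  have cl: "(\<lambda>i. incl i (p i)) \<in> supp p \<rightarrow> carrier V"
    using p by (auto simp: incl_closed apply_closed dest: suppD)
  show "(\<Oplus>\<^bsub>V\<^esub>i\<in>supp p. incl i (p i)) \<in> carrier V"
    using cl by (rule V.M.finsum_closed)
  fix j assume j: "j \<in> I"
  interpret U: vectorspace K "U j" using j by (rule summand)
  have pj: "p j \<in> carrier (U j)" using p j by (rule apply_closed)
  have "(\<Oplus>\<^bsub>V\<^esub>i\<in>supp p. incl i (p i)) j = (\<Oplus>\<^bsub>U j\<^esub>i\<in>supp p. incl i (p i) j)"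
    using linear_map_finsum[OF component_linear[OF j] cl] .
  also have "\<dots> = (\<Oplus>\<^bsub>U j\<^esub>i\<in>supp p. if j = i then p j else \<zero>\<^bsub>U j\<^esub>)"
    by (rule U.M.finsum_cong') (use j pj in \<open>auto simp: incl_apply\<close>)
  also have "\<dots> = p j"
  proof (cases "j \<in> supp p")
    case True
    then show ?thesis
      using U.M.finsum_singleton[of j "supp p" "\<lambda>_. p j"] pj finite_supp[OF p] by simp
  next
    case False
    then have "(\<Oplus>\<^bsub>U j\<^esub>i\<in>supp p. if j = i then p j else \<zero>\<^bsub>U j\<^esub>) = (\<Oplus>\<^bsub>U j\<^esub>i\<in>supp p. \<zero>\<^bsub>U j\<^esub>)"
      by (intro U.M.finsum_cong') auto
    then show ?thesis using not_supp[OF j False] by simp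
  qed
  finally show "p j = (\<Oplus>\<^bsub>V\<^esub>i\<in>supp p. incl i (p i)) j" by simp
qed (rule p)

text \<open>The map given by the universal property of a direct sum. For free modules it produces
  lifts of bilinear maps, for sums of representables the transformation with prescribed values on
  generators.\<close>

definition sum_map :: "('k, 'w) module \<Rightarrow> ('i \<Rightarrow> 'u \<Rightarrow> 'w) \<Rightarrow> ('i \<Rightarrow> 'u) \<Rightarrow> 'w" where
  "sum_map W T p = (\<Oplus>\<^bsub>W\<^esub>i\<in>supp p. T i (p i))"

context
  fixes W :: "('k, 'w) module" and T
  assumes W: "vectorspace K W" and T: "\<And>i. i \<in> I \<Longrightarrow> linear_map K (U i) W (T i)"
begin

text \<open>The supports of p, q and their sum differ, so additivity needs one common finite index
  set. Enlarging the set is harmless because each \<open>T i\<close> sends zero to zero.\<close>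

lemma sum_map_superset:
  assumes p: "p \<in> carrier V" and F: "finite F" "supp p \<subseteq> F" "F \<subseteq> I"
  shows "sum_map W T p = (\<Oplus>\<^bsub>W\<^esub>i\<in>F. T i (p i))"
proof -
  interpret W: vectorspace K W by (rule W)
  show ?thesis unfolding sum_map_def
    by (rule W.M.add.finprod_mono_neutral_cong_left)
      (use assms linear_mapD(3,6)[OF T] apply_closed[OF p] in \<open>auto simp: subset_iff not_supp\<close>)
qed

lemma sum_map_linear: "linear_map K V W (sum_map W T)"
proof (rule linear_mapI)
  interpret W: vectorspace K W by (rule W)
  note V = vectorspace_closed[OF is_vectorspace]
  have TV: "(\<lambda>i. T i (p i)) \<in> F \<rightarrow> carrier W" if "p \<in> carrier V" "F \<subseteq> I" for p F
    using that linear_mapD(3)[OF T] apply_closed by auto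
  show "sum_map W T p \<in> carrier W" if "p \<in> carrier V" for p
    unfolding sum_map_def by (rule W.M.finsum_closed) (rule TV[OF that supp_subset])
  show "sum_map W T (p \<oplus>\<^bsub>V\<^esub> q) = sum_map W T p \<oplus>\<^bsub>W\<^esub> sum_map W T q"
    if p: "p \<in> carrier V" and q: "q \<in> carrier V" for p q
  proof -
    define F where "F = supp p \<union> supp q \<union> supp (p \<oplus>\<^bsub>V\<^esub> q)"
    have F: "finite F" "F \<subseteq> I" using p q V finite_supp supp_subset by (auto simp: F_def)
    have "sum_map W T (p \<oplus>\<^bsub>V\<^esub> q) = (\<Oplus>\<^bsub>W\<^esub>i\<in>F. T i ((p \<oplus>\<^bsub>V\<^esub> q) i))"
      by (rule sum_map_superset) (use p q V F in \<open>auto simp: F_def\<close>)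
    also have "\<dots> = (\<Oplus>\<^bsub>W\<^esub>i\<in>F. T i (p i) \<oplus>\<^bsub>W\<^esub> T i (q i))"
      by (rule W.M.finsum_cong')
        (use p q F linear_mapD(3,4)[OF T] in \<open>auto simp: add_eq apply_closed subset_iff\<close>)
    also have "\<dots> = (\<Oplus>\<^bsub>W\<^esub>i\<in>F. T i (p i)) \<oplus>\<^bsub>W\<^esub> (\<Oplus>\<^bsub>W\<^esub>i\<in>F. T i (q i))"
      by (rule W.M.finsum_addf) (use p q F TV in auto)
    also have "(\<Oplus>\<^bsub>W\<^esub>i\<in>F. T i (p i)) = sum_map W T p"
      by (rule sum_map_superset[symmetric]) (use p F in \<open>auto simp: F_def\<close>)
    also have "(\<Oplus>\<^bsub>W\<^esub>i\<in>F. T i (q i)) = sum_map W T q"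
      by (rule sum_map_superset[symmetric]) (use q F in \<open>auto simp: F_def\<close>)
    finally show ?thesis .
  qed
  show "sum_map W T (c \<odot>\<^bsub>V\<^esub> p) = c \<odot>\<^bsub>W\<^esub> sum_map W T p"
    if c: "c \<in> carrier K" and p: "p \<in> carrier V" for c p
  proof -
    define F where "F = supp p \<union> supp (c \<odot>\<^bsub>V\<^esub> p)"
    have F: "finite F" "F \<subseteq> I" using p c V finite_supp supp_subset by (auto simp: F_def)
    have "sum_map W T (c \<odot>\<^bsub>V\<^esub> p) = (\<Oplus>\<^bsub>W\<^esub>i\<in>F. T i ((c \<odot>\<^bsub>V\<^esub> p) i))"
      by (rule sum_map_superset) (use p c V F in \<open>auto simp: F_def\<close>)
    also have "\<dots> = (\<Oplus>\<^bsub>W\<^esub>i\<in>F. c \<odot>\<^bsub>W\<^esub> T i (p i))"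
      by (rule W.M.finsum_cong')
        (use p c F linear_mapD(3,5)[OF T] in \<open>auto simp: smult_eq apply_closed subset_iff\<close>)
    also have "\<dots> = c \<odot>\<^bsub>W\<^esub> (\<Oplus>\<^bsub>W\<^esub>i\<in>F. T i (p i))"
      by (rule W.finsum_smult[symmetric]) (use p c F TV in auto)
    also have "(\<Oplus>\<^bsub>W\<^esub>i\<in>F. T i (p i)) = sum_map W T p"
      by (rule sum_map_superset[symmetric]) (use p F in \<open>auto simp: F_def\<close>)
    finally show ?thesis .
  qed
qed (use is_vectorspace W in auto)

lemma sum_map_incl:
  assumes i: "i \<in> I" and u: "u \<in> carrier (U i)"
  shows "sum_map W T (incl i u) = T i u"
proof -
  interpret W: vectorspace K W by (rule W)
  have "sum_map W T (incl i u) = (\<Oplus>\<^bsub>W\<^esub>j\<in>{i}. T j (incl i u j))"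
    by (rule sum_map_superset) (use i u in \<open>auto simp: incl_closed supp_def incl_apply split: if_splits\<close>)
  also have "\<dots> = T i u"
    using i linear_mapD(3)[OF T[OF i] u] by (simp add: incl_apply W.M.finsum_insert)
  finally show ?thesis .
qed

end

lemma maps_eqI:
  assumes S: "linear_map K V W S" and S': "linear_map K V W S'"
    and eq: "\<And>i u. \<lbrakk>i \<in> I; u \<in> carrier (U i)\<rbrakk> \<Longrightarrow> S (incl i u) = S' (incl i u)"
    and p: "p \<in> carrier V"
  shows "S p = S' p"
proof -
  interpret W: vectorspace K W using S by (rule linear_mapD)
  have cl: "(\<lambda>i. incl i (p i)) \<in> supp p \<rightarrow> carrier V"
    using p by (auto simp: incl_closed apply_closed dest: suppD)
  have "S (\<Oplus>\<^bsub>V\<^esub>i\<in>supp p. incl i (p i)) = (\<Oplus>\<^bsub>W\<^esub>i\<in>supp p. S (incl i (p i)))"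
    using S cl by (rule linear_map_finsum)
  also have "\<dots> = (\<Oplus>\<^bsub>W\<^esub>i\<in>supp p. S' (incl i (p i)))"
    by (rule W.M.finsum_cong')
      (use p supp_subset cl linear_mapD(3)[OF S'] in \<open>auto simp: eq apply_closed subset_iff\<close>)
  also have "\<dots> = S' (\<Oplus>\<^bsub>V\<^esub>i\<in>supp p. incl i (p i))"
    using S' cl by (rule linear_map_finsum[symmetric])
  finally show ?thesis using decompose[OF p] by simp
qed

end

subsection \<open>Tensor products\<close>

definition field_module :: "('k, 'r) ring_scheme \<Rightarrow> ('k, 'k) module" where
  "field_module K = \<lparr>carrier = carrier K, mult = mult K, one = one K, zero = zero K, add = add K,
     smult = mult K\<rparr>"

lemma (in field) field_module_vectorspace: "vectorspace R (field_module R)"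
proof (rule vs_criteria)
  show "\<forall>v\<in>carrier (field_module R). \<exists>n\<in>carrier (field_module R).
      v \<oplus>\<^bsub>field_module R\<^esub> n = \<zero>\<^bsub>field_module R\<^esub>"
    using r_neg a_inv_closed unfolding field_module_def by auto
qed (simp_all add: field_module_def field_axioms a_ac m_assoc l_distr r_distr)

lemma (in field) free_module_finite_support_sum:
  "finite_support_sum R (free_module R S) S (\<lambda>_. field_module R)"
proof (intro finite_support_sum.intro finite_support_sum_axioms.intro)
  show "field R" by (rule field_axioms)
  show "vectorspace R (field_module R)" by (rule field_module_vectorspace)
qed (simp_all add: free_module_def func_space_def field_module_def)

definition bilinear_map ::
  "('k, 'r) ring_scheme \<Rightarrow> ('k, 'v) module \<Rightarrow> ('k, 'w) module \<Rightarrow> ('k, 'x) module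
    \<Rightarrow> ('v \<Rightarrow> 'w \<Rightarrow> 'x) \<Rightarrow> bool" where
  "bilinear_map K V W X \<beta> \<longleftrightarrow>
    (\<forall>w \<in> carrier W. linear_map K V X (\<lambda>v. \<beta> v w)) \<and>
    (\<forall>v \<in> carrier V. linear_map K W X (\<beta> v))"

lemma bilinear_mapI:
  assumes "\<And>w. w \<in> carrier W \<Longrightarrow> linear_map K V X (\<lambda>v. \<beta> v w)"
    and "\<And>v. v \<in> carrier V \<Longrightarrow> linear_map K W X (\<beta> v)"
  shows "bilinear_map K V W X \<beta>"
  using assms by (simp add: bilinear_map_def)

lemma bilinear_mapD:
  assumes "bilinear_map K V W X \<beta>"
  shows "\<And>w. w \<in> carrier W \<Longrightarrow> linear_map K V X (\<lambda>v. \<beta> v w)"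
    and "\<And>v. v \<in> carrier V \<Longrightarrow> linear_map K W X (\<beta> v)"
  using assms by (simp_all add: bilinear_map_def)

lemma bilinear_map_closed:
  "\<lbrakk>bilinear_map K V W X \<beta>; v \<in> carrier V; w \<in> carrier W\<rbrakk> \<Longrightarrow> \<beta> v w \<in> carrier X"
  by (blast intro: linear_mapD(3) bilinear_mapD)

lemma bilinear_map_precomp:
  assumes "bilinear_map K V W X \<beta>" and "linear_map K V' V S" and "linear_map K W' W T"
  shows "bilinear_map K V' W' X (\<lambda>v w. \<beta> (S v) (T w))"
  using linear_mapD(3)[OF assms(2)] linear_mapD(3)[OF assms(3)]
  by (intro bilinear_mapI linear_map_comp[OF assms(2) bilinear_mapD(1)[OF assms(1)]]
      linear_map_comp[OF assms(3) bilinear_mapD(2)[OF assms(1)]])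

locale vectorspace_pair = V: vectorspace K V + W: vectorspace K W
  for K :: "('k, 'r) ring_scheme" and V :: "('k, 'v) module" and W :: "('k, 'w) module"
begin

abbreviation "S \<equiv> carrier V \<times> carrier W"
abbreviation "F \<equiv> free_module K S"
abbreviation "N \<equiv> tensor_null K V W"
abbreviation "VW \<equiv> tensor_product K V W"
abbreviation "pure \<equiv> pure_tensor K V W"

sublocale free: finite_support_sum K F S "\<lambda>_. field_module K"
  by (rule V.free_module_finite_support_sum)

sublocale F: vectorspace K F
  by (rule free.is_vectorspace)

lemma generator_eq: "generator K S s = free.incl s \<one>\<^bsub>K\<^esub>"
  unfolding generator_def free.incl_def by (auto simp: field_module_def)

lemma generator_closed: "s \<in> S \<Longrightarrow> generator K S s \<in> carrier F"
  unfolding generator_eq by (rule free.incl_closed) (auto simp: field_module_def)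

lemma incl_eq_smult_generator:
  assumes "s \<in> S" and "c \<in> carrier K"
  shows "free.incl s c = c \<odot>\<^bsub>F\<^esub> generator K S s"
  using linear_mapD(5)[OF free.incl_linear[OF assms(1)], of c "\<one>\<^bsub>K\<^esub>"] assms(2)
  by (simp add: generator_eq field_module_def)

lemma relations_closed: "tensor_relations K V W \<subseteq> carrier F"
  by (auto simp: tensor_relations_def Let_def
      intro!: generator_closed F.M.minus_closed F.M.a_closed F.smult_closed)

lemma null_subspace: "subspace K N F"
  unfolding tensor_null_def by (rule F.span_is_subspace) (rule relations_closed)

lemmas tensor_vectorspace =
  quotient_module_coset(1)[OF null_subspace, folded tensor_product_def]
lemmas coset_linear =
  quotient_module_coset(2)[OF null_subspace, folded tensor_product_def]
lemmas tensor_carrier =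
  quotient_module_coset(3)[OF null_subspace, folded tensor_product_def]

lemma pure_eq: "pure v w = a_r_coset F N (generator K S (v, w))"
  by (simp add: pure_tensor_def)

lemma pure_closed: "\<lbrakk>v \<in> carrier V; w \<in> carrier W\<rbrakk> \<Longrightarrow> pure v w \<in> carrier VW"
  unfolding pure_eq by (intro linear_mapD(3)[OF coset_linear] generator_closed) simp

text \<open>Write p as (p - q) + q; the coset of p - q is \<open>N\<close> itself, which is the zero
  of the quotient.\<close>

lemma coset_eqI:
  assumes "p \<ominus>\<^bsub>F\<^esub> q \<in> N" and "p \<in> carrier F" "q \<in> carrier F"
  shows "a_r_coset F N p = a_r_coset F N q"
proof -
  interpret Q: vectorspace K VW by (rule tensor_vectorspace)
  have "p = (p \<ominus>\<^bsub>F\<^esub> q) \<oplus>\<^bsub>F\<^esub> q"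
    using assms by (simp add: F.M.minus_eq F.M.a_assoc F.M.l_neg)
  then have "a_r_coset F N p = a_r_coset F N (p \<ominus>\<^bsub>F\<^esub> q) \<oplus>\<^bsub>VW\<^esub> a_r_coset F N q"
    using linear_mapD(4)[OF coset_linear] assms(2,3) by (metis F.M.minus_closed)
  also have "a_r_coset F N (p \<ominus>\<^bsub>F\<^esub> q) = \<zero>\<^bsub>VW\<^esub>"
  proof -
    have "subgroup N (add_monoid F)"
      by (rule F.M.add.subgroupI)
        (use subspaceD[OF null_subspace] subspace_minus[OF null_subspace, of "\<zero>\<^bsub>F\<^esub>"]
          in \<open>auto simp: F.M.minus_eq subset_iff\<close>)
    then have "a_r_coset F N (p \<ominus>\<^bsub>F\<^esub> q) = N"
      using assms(1) F.M.add.coset_join2[of "p \<ominus>\<^bsub>F\<^esub> q" N] assms(2,3)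
      by (simp add: a_r_coset_def)
    then show ?thesis by (simp add: tensor_product_def quotient_module_def)
  qed
  finally show ?thesis
    using assms(3) linear_mapD(3)[OF coset_linear] by simp
qed

lemma null_relation: "r \<in> tensor_relations K V W \<Longrightarrow> r \<in> N"
  unfolding tensor_null_def using F.span_mem[OF relations_closed] by blast

text \<open>The four families in \<open>tensor_relations\<close> are the four identities of
  bilinearity, read modulo \<open>N\<close>.\<close>

lemma pure_bilinear: "bilinear_map K V W VW pure"
proof (rule bilinear_mapI)
  note q = linear_mapD(4,5)[OF coset_linear, symmetric] generator_closed F.smult_closed
  fix w assume w: "w \<in> carrier W"
  show "linear_map K V VW (\<lambda>v. pure v w)"
  proof (rule linear_mapI)
    show "pure (u \<oplus>\<^bsub>V\<^esub> v) w = pure u w \<oplus>\<^bsub>VW\<^esub> pure v w"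
      if "u \<in> carrier V" "v \<in> carrier V" for u v
    proof -
      have "generator K S (u \<oplus>\<^bsub>V\<^esub> v, w) \<ominus>\<^bsub>F\<^esub> (generator K S (u, w) \<oplus>\<^bsub>F\<^esub> generator K S (v, w)) \<in> N"
        using that w by (intro null_relation, unfold tensor_relations_def Let_def) blast
      from coset_eqI[OF this] that w show ?thesis by (simp add: pure_eq q)
    qed
    show "pure (c \<odot>\<^bsub>V\<^esub> v) w = c \<odot>\<^bsub>VW\<^esub> pure v w"
      if "c \<in> carrier K" "v \<in> carrier V" for c v
    proof -
      have "generator K S (c \<odot>\<^bsub>V\<^esub> v, w) \<ominus>\<^bsub>F\<^esub> c \<odot>\<^bsub>F\<^esub> generator K S (v, w) \<in> N"
        using that w by (intro null_relation, unfold tensor_relations_def Let_def) blast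
      from coset_eqI[OF this] that w show ?thesis by (simp add: pure_eq q)
    qed
  qed (use w in \<open>auto simp: tensor_vectorspace pure_closed intro: V.vectorspace_axioms\<close>)
next
  note q = linear_mapD(4,5)[OF coset_linear, symmetric] generator_closed F.smult_closed
  fix v assume v: "v \<in> carrier V"
  show "linear_map K W VW (pure v)"
  proof (rule linear_mapI)
    show "pure v (w \<oplus>\<^bsub>W\<^esub> w') = pure v w \<oplus>\<^bsub>VW\<^esub> pure v w'"
      if "w \<in> carrier W" "w' \<in> carrier W" for w w'
    proof -
      have "generator K S (v, w \<oplus>\<^bsub>W\<^esub> w') \<ominus>\<^bsub>F\<^esub> (generator K S (v, w) \<oplus>\<^bsub>F\<^esub> generator K S (v, w')) \<in> N"
        using that v by (intro null_relation, unfold tensor_relations_def Let_def) blast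
      from coset_eqI[OF this] that v show ?thesis by (simp add: pure_eq q)
    qed
    show "pure v (c \<odot>\<^bsub>W\<^esub> w) = c \<odot>\<^bsub>VW\<^esub> pure v w"
      if "c \<in> carrier K" "w \<in> carrier W" for c w
    proof -
      have "generator K S (v, c \<odot>\<^bsub>W\<^esub> w) \<ominus>\<^bsub>F\<^esub> c \<odot>\<^bsub>F\<^esub> generator K S (v, w) \<in> N"
        using that v by (intro null_relation, unfold tensor_relations_def Let_def) blast
      from coset_eqI[OF this] that v show ?thesis by (simp add: pure_eq q)
    qed
  qed (use v in \<open>auto simp: tensor_vectorspace pure_closed intro: W.vectorspace_axioms\<close>)
qed

text \<open>Pulled back along the coset map, this is agreement on the basis of the free module. It
  is the means by which later identities between maps on tensor products are reduced to pure
  tensors.\<close>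

lemma tensor_maps_eqI:
  assumes R: "linear_map K VW X R" and T: "linear_map K VW X T"
    and eq: "\<And>v w. \<lbrakk>v \<in> carrier V; w \<in> carrier W\<rbrakk> \<Longrightarrow> R (pure v w) = T (pure v w)"
    and t: "t \<in> carrier VW"
  shows "R t = T t"
proof -
  obtain p where p: "p \<in> carrier F" and t_eq: "t = a_r_coset F N p"
    using t by (auto simp: tensor_carrier)
  note RT = linear_map_comp[OF coset_linear R] linear_map_comp[OF coset_linear T]
  show ?thesis unfolding t_eq
  proof (rule free.maps_eqI[OF RT _ p])
    fix s c assume s: "s \<in> S" and "c \<in> carrier (field_module K)"
    then have c: "c \<in> carrier K" by (simp add: field_module_def)
    have "R (a_r_coset F N (generator K S s)) = T (a_r_coset F N (generator K S s))"
      using s eq by (auto simp: pure_eq)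
    then show "R (a_r_coset F N (free.incl s c)) = T (a_r_coset F N (free.incl s c))"
      using s c by (simp add: incl_eq_smult_generator linear_mapD(5)[OF RT(1)]
          linear_mapD(5)[OF RT(2)] generator_closed)
  qed
qed

text \<open>\<open>tensor_lift\<close> evaluates a formal sum picked by \<open>SOME\<close>. A coset
  contains its own representative, so the choice is made from a nonempty set and yields a genuine
  representative.\<close>

lemma representative:
  assumes t: "t \<in> carrier VW"
  shows "(SOME p. p \<in> t) \<in> carrier F" and "a_r_coset F N (SOME p. p \<in> t) = t"
proof -
  obtain q where q: "q \<in> carrier F" and t_eq: "t = a_r_coset F N q"
    using t by (auto simp: tensor_carrier)
  have "\<zero>\<^bsub>F\<^esub> \<oplus>\<^bsub>F\<^esub> q \<in> t"
    using subspaceD(3)[OF null_subspace] by (auto simp: t_eq a_r_coset_def')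
  then have "(SOME p. p \<in> t) \<in> t" by (rule someI[of "\<lambda>p. p \<in> t"])
  then obtain n where n: "n \<in> N" and p: "(SOME p. p \<in> t) = n \<oplus>\<^bsub>F\<^esub> q"
    by (auto simp: t_eq a_r_coset_def')
  have nF: "n \<in> carrier F" using n subspaceD(2)[OF null_subspace] by blast
  then show "(SOME p. p \<in> t) \<in> carrier F" using p q by simp
  have "(n \<oplus>\<^bsub>F\<^esub> q) \<ominus>\<^bsub>F\<^esub> q = n"
    using nF q by (simp add: F.M.minus_eq F.M.a_assoc F.M.r_neg)
  then have "a_r_coset F N (n \<oplus>\<^bsub>F\<^esub> q) = t"
    unfolding t_eq using n nF q by (intro coset_eqI) auto
  then show "a_r_coset F N (SOME p. p \<in> t) = t" by (simp add: p)
qed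

lemma tensor_lift_eq_sum_map:
  "tensor_lift K V W X \<beta> t =
    free.sum_map X (\<lambda>s c. c \<odot>\<^bsub>X\<^esub> \<beta> (fst s) (snd s)) (SOME p. p \<in> t)"
  unfolding tensor_lift_def Let_def free.sum_map_def free.supp_def by (simp add: field_module_def)

lemma tensor_decompose:
  assumes t: "t \<in> carrier VW"
  shows "\<exists>A c. finite A \<and> A \<subseteq> S \<and> c \<in> A \<rightarrow> carrier K \<and>
    t = (\<Oplus>\<^bsub>VW\<^esub>s\<in>A. c s \<odot>\<^bsub>VW\<^esub> pure (fst s) (snd s))"
proof -
  define p where "p = (SOME p. p \<in> t)"
  note p = representative[OF t, folded p_def]
  interpret Q: vectorspace K VW by (rule tensor_vectorspace)
  have pK: "p s \<in> carrier K" if "s \<in> S" for s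
    using free.apply_closed[OF p(1) that] by (simp add: field_module_def)
  have "(\<Oplus>\<^bsub>F\<^esub>s\<in>free.supp p. free.incl s (p s)) = p"
    using p(1) by (rule free.decompose[symmetric])
  then have "t = a_r_coset F N (\<Oplus>\<^bsub>F\<^esub>s\<in>free.supp p. free.incl s (p s))"
    using p(2) by simp
  also have "\<dots> = (\<Oplus>\<^bsub>VW\<^esub>s\<in>free.supp p. a_r_coset F N (free.incl s (p s)))"
    by (rule linear_map_finsum[OF coset_linear])
      (use p free.incl_closed free.apply_closed free.suppD in blast)
  also have "\<dots> = (\<Oplus>\<^bsub>VW\<^esub>s\<in>free.supp p. p s \<odot>\<^bsub>VW\<^esub> pure (fst s) (snd s))"
  proof (rule Q.M.finsum_cong')
    show "(\<lambda>s. p s \<odot>\<^bsub>VW\<^esub> pure (fst s) (snd s)) \<in> free.supp p \<rightarrow> carrier VW"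
    proof
      fix s assume "s \<in> free.supp p"
      then have s: "s \<in> S" by (rule free.suppD)
      then show "p s \<odot>\<^bsub>VW\<^esub> pure (fst s) (snd s) \<in> carrier VW"
        by (intro Q.smult_closed pK pure_closed) auto
    qed
    fix s assume "s \<in> free.supp p"
    then have s: "s \<in> S" by (rule free.suppD)
    then show "a_r_coset F N (free.incl s (p s)) = p s \<odot>\<^bsub>VW\<^esub> pure (fst s) (snd s)"
      using pK[OF s] generator_closed[OF s]
      by (simp add: incl_eq_smult_generator linear_mapD(5)[OF coset_linear] pure_eq)
  qed simp
  finally show ?thesis
    using free.finite_supp[OF p(1)] free.supp_subset pK free.suppD
    by (intro exI[of _ "free.supp p"] exI[of _ p]) blast
qed

context
  fixes X :: "('k, 'x) module" and \<beta>
  assumes \<beta>: "bilinear_map K V W X \<beta>"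
begin

lemma bilinear_target: "vectorspace K X"
  using bilinear_mapD(1)[OF \<beta> W.M.zero_closed] by (rule linear_mapD)

lemma scaled_linear:
  assumes "s \<in> S"
  shows "linear_map K (field_module K) X (\<lambda>c. c \<odot>\<^bsub>X\<^esub> \<beta> (fst s) (snd s))"
proof (rule linear_mapI)
  interpret X: vectorspace K X by (rule bilinear_target)
  have b: "\<beta> (fst s) (snd s) \<in> carrier X"
    using assms by (auto intro: bilinear_map_closed[OF \<beta>])
  show "vectorspace K (field_module K)" by (rule V.field_module_vectorspace)
qed (use assms bilinear_map_closed[OF \<beta>] vectorspace.axioms(1)[OF bilinear_target] bilinear_target in
    \<open>auto simp: field_module_def module.smult_l_distr module.smult_assoc1 module.smult_closed\<close>)

private abbreviation "L \<equiv> free.sum_map X (\<lambda>s c. c \<odot>\<^bsub>X\<^esub> \<beta> (fst s) (snd s))"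

lemma formal_lift_linear: "linear_map K F X L"
  by (rule free.sum_map_linear[OF bilinear_target scaled_linear])

lemma formal_lift_generator:
  assumes "v \<in> carrier V" "w \<in> carrier W"
  shows "L (generator K S (v, w)) = \<beta> v w"
proof -
  interpret X: vectorspace K X by (rule bilinear_target)
  have "L (generator K S (v, w)) = \<one>\<^bsub>K\<^esub> \<odot>\<^bsub>X\<^esub> \<beta> v w"
    unfolding generator_eq
    using free.sum_map_incl[OF bilinear_target scaled_linear, where i = "(v, w)" and u = "\<one>\<^bsub>K\<^esub>"] assms
    by (simp add: field_module_def)
  then show ?thesis using bilinear_map_closed[OF \<beta> assms] by simp
qed

text \<open>By bilinearity each relation lies in the kernel of \<open>L\<close>; the kernel is a
  submodule, so it contains their span. This makes \<open>tensor_lift\<close> independent of the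
  representing formal sum.\<close>

lemma formal_lift_null:
  assumes "n \<in> N" shows "L n = \<zero>\<^bsub>X\<^esub>"
proof -
  interpret X: vectorspace K X by (rule bilinear_target)
  interpret L: linear_map K F X L by (rule formal_lift_linear)
  note lin = linear_mapD[OF formal_lift_linear]
  note cl = generator_closed F.M.a_closed F.smult_closed bilinear_map_closed[OF \<beta>]
  have "L r = \<zero>\<^bsub>X\<^esub>" if "r \<in> tensor_relations K V W" for r
    using that unfolding tensor_relations_def Let_def
    by (auto simp: lin(4,5,7) cl formal_lift_generator
        linear_mapD(4,5)[OF bilinear_mapD(1)[OF \<beta>]] linear_mapD(4,5)[OF bilinear_mapD(2)[OF \<beta>]])
  then have "tensor_relations K V W \<subseteq> L.ker"
    using relations_closed by (auto simp: L.ker_def)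
  then have "N \<subseteq> L.ker"
    unfolding tensor_null_def using L.ker_is_submodule by (rule F.span_is_subset)
  then show ?thesis using assms by (auto simp: L.ker_def)
qed

lemma tensor_lift_coset:
  assumes p: "p \<in> carrier F"
  shows "tensor_lift K V W X \<beta> (a_r_coset F N p) = L p"
proof -
  interpret X: vectorspace K X by (rule bilinear_target)
  note lin = linear_mapD[OF formal_lift_linear]
  define q where "q = (SOME q. q \<in> a_r_coset F N p)"
  have "\<zero>\<^bsub>F\<^esub> \<oplus>\<^bsub>F\<^esub> p \<in> a_r_coset F N p"
    using subspaceD(3)[OF null_subspace] by (auto simp: a_r_coset_def')
  then have "q \<in> a_r_coset F N p" unfolding q_def by (rule someI[of "\<lambda>q. q \<in> a_r_coset F N p"])
  then obtain n where n: "n \<in> N" "q = n \<oplus>\<^bsub>F\<^esub> p" by (auto simp: a_r_coset_def')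
  then have "L q = L p"
    using p subspaceD(2)[OF null_subspace]
    by (simp add: lin(3,4) formal_lift_null subset_iff)
  then show ?thesis by (simp add: tensor_lift_eq_sum_map q_def)
qed

lemma tensor_lift_pure:
  "\<lbrakk>v \<in> carrier V; w \<in> carrier W\<rbrakk> \<Longrightarrow> tensor_lift K V W X \<beta> (pure v w) = \<beta> v w"
  by (simp add: pure_eq tensor_lift_coset generator_closed formal_lift_generator)

lemma tensor_lift_linear: "linear_map K VW X (tensor_lift K V W X \<beta>)"
proof (rule linear_mapI)
  note lin = linear_mapD[OF formal_lift_linear]
  note q = linear_mapD(4,5)[OF coset_linear, symmetric]
  show "tensor_lift K V W X \<beta> t \<in> carrier X" if "t \<in> carrier VW" for t
    using that by (auto simp: tensor_carrier tensor_lift_coset lin(3))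
  show "tensor_lift K V W X \<beta> (t \<oplus>\<^bsub>VW\<^esub> t') = tensor_lift K V W X \<beta> t \<oplus>\<^bsub>X\<^esub> tensor_lift K V W X \<beta> t'"
    if "t \<in> carrier VW" "t' \<in> carrier VW" for t t'
    using that by (auto simp: tensor_carrier tensor_lift_coset lin(4) q)
  show "tensor_lift K V W X \<beta> (c \<odot>\<^bsub>VW\<^esub> t) = c \<odot>\<^bsub>X\<^esub> tensor_lift K V W X \<beta> t"
    if "c \<in> carrier K" "t \<in> carrier VW" for c t
    using that by (auto simp: tensor_carrier tensor_lift_coset lin(5) q)
qed (rule tensor_vectorspace bilinear_target)+

end

text \<open>For a fixed tensor the chosen formal sum is fixed too, so the lift is linear in the bilinear map.\<close>
lemma tensor_lift_linear_parameter:
  assumes t: "t \<in> carrier VW" and Y: "vectorspace K Y" and X: "vectorspace K X"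
    and \<beta>: "\<And>v w. \<lbrakk>v \<in> carrier V; w \<in> carrier W\<rbrakk> \<Longrightarrow> linear_map K Y X (\<lambda>y. \<beta> y v w)"
  shows "linear_map K Y X (\<lambda>y. tensor_lift K V W X (\<beta> y) t)"
  unfolding tensor_lift_eq_sum_map free.sum_map_def
proof (rule linear_map_sum_of_maps[OF Y X])
  fix s assume "s \<in> free.supp (SOME p. p \<in> t)"
  then have s: "s \<in> S" by (rule free.suppD)
  have "(SOME p. p \<in> t) s \<in> carrier K"
    using free.apply_closed[OF representative(1)[OF t] s] by (simp add: field_module_def)
  then show "linear_map K Y X (\<lambda>y. (SOME p. p \<in> t) s \<odot>\<^bsub>X\<^esub> \<beta> y (fst s) (snd s))"
    using s by (intro linear_map_smult_of_map \<beta>) auto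
qed

end

section \<open>Linear functors\<close>

lemma subspace_vectorspace:
  "subspace K N V \<Longrightarrow> vectorspace K (V\<lparr>carrier := N\<rparr>)"
  by (rule vectorspace.subspace_is_vs[OF subspaceD(1)])

lemma linear_map_into_subspace:
  assumes "linear_map K V W T" and "subspace K N W" and "\<And>v. v \<in> carrier V \<Longrightarrow> T v \<in> N"
  shows "linear_map K V (W\<lparr>carrier := N\<rparr>) T"
  by (rule linear_mapI) (use assms in \<open>simp_all add: linear_mapD subspace_vectorspace\<close>)

lemma linear_map_from_subspace:
  assumes "linear_map K V W T" and "subspace K N V"
  shows "linear_map K (V\<lparr>carrier := N\<rparr>) W T"
  by (rule linear_mapI)
    (use assms subspaceD(2)[OF assms(2)] in \<open>auto simp: linear_mapD subspace_vectorspace subset_iff\<close>)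

lemma linear_map_kernel_subspace:
  assumes "linear_map K V W T"
  shows "subspace K (a_kernel V W T) V"
proof -
  interpret W: vectorspace K W using assms by (rule linear_mapD)
  note T = linear_mapD[OF assms] and V = vectorspace_closed[OF linear_mapD(1)[OF assms]]
  show ?thesis
    by (rule subspaceI) (auto simp: a_kernel_def kernel_def T V)
qed

lemma a_kernel_iff: "v \<in> a_kernel V W T \<longleftrightarrow> v \<in> carrier V \<and> T v = \<zero>\<^bsub>W\<^esub>"
  by (simp add: a_kernel_def kernel_def)

text \<open>Puts a family of maps into the normal form that \<open>nat_trans\<close> demands, namely
  \<open>undefined\<close> off the objects and off the carriers.\<close>

definition nat_restrict ::
  "('k, 'd, 'b) linear_cat \<Rightarrow> ('k, 'd, 'b, 'm) vect_functor \<Rightarrow> ('d \<Rightarrow> 'm \<Rightarrow> 'n) \<Rightarrow> 'd \<Rightarrow> 'm \<Rightarrow> 'n" where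
  "nat_restrict D M \<eta> = (\<lambda>x\<in>Obj D. \<lambda>m\<in>carrier (Val M x). \<eta> x m)"

lemma nat_restrict_apply:
  "\<lbrakk>x \<in> Obj D; m \<in> carrier (Val M x)\<rbrakk> \<Longrightarrow> nat_restrict D M \<eta> x m = \<eta> x m"
  by (simp add: nat_restrict_def)

lemma nat_comp_eq: "nat_comp D L \<eta> \<theta> = nat_restrict D L (\<lambda>x m. \<eta> x (\<theta> x m))"
  by (simp add: nat_comp_def nat_restrict_def compose_def)

lemma nat_comp_apply:
  "\<lbrakk>x \<in> Obj D; m \<in> carrier (Val L x)\<rbrakk> \<Longrightarrow> nat_comp D L \<eta> \<theta> x m = \<eta> x (\<theta> x m)"
  by (simp add: nat_comp_eq nat_restrict_apply)

context linear_category
begin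

lemma functor_Act_closed:
  assumes "linear_functor K C M" and "x \<in> Obj C" "y \<in> Obj C"
    and "f \<in> carrier (Hom C x y)" and "m \<in> carrier (Val M x)"
  shows "Act M x y f m \<in> carrier (Val M y)"
  using linear_mapD(3)[OF linear_functor.Act_linear[OF assms(1-4)] assms(5)] .

lemma Comp_closed:
  assumes "x \<in> Obj C" "y \<in> Obj C" "z \<in> Obj C"
    and "f \<in> carrier (Hom C x y)" and "g \<in> carrier (Hom C y z)"
  shows "Comp C x y z g f \<in> carrier (Hom C x z)"
  using linear_mapD(3)[OF Comp_linear_right] assms by blast

lemma nat_transD:
  assumes "\<eta> \<in> nat_trans K C M N" and "linear_functor K C M" and "linear_functor K C N"
  shows "x \<in> Obj C \<Longrightarrow> linear_map K (Val M x) (Val N x) (\<eta> x)"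
    and "\<lbrakk>x \<in> Obj C; y \<in> Obj C; f \<in> carrier (Hom C x y); m \<in> carrier (Val M x)\<rbrakk>
      \<Longrightarrow> \<eta> y (Act M x y f m) = Act N x y f (\<eta> x m)"
  using assms linear_map_iff_module_hom[OF linear_functor.Val_vectorspace[OF assms(2)]
      linear_functor.Val_vectorspace[OF assms(3)]]
  by (auto simp: nat_trans_def)

lemma nat_transI:
  assumes M: "linear_functor K C M" and N: "linear_functor K C N"
    and lin: "\<And>x. x \<in> Obj C \<Longrightarrow> linear_map K (Val M x) (Val N x) (\<eta> x)"
    and nat: "\<And>x y f m. \<lbrakk>x \<in> Obj C; y \<in> Obj C; f \<in> carrier (Hom C x y); m \<in> carrier (Val M x)\<rbrakk>
      \<Longrightarrow> \<eta> y (Act M x y f m) = Act N x y f (\<eta> x m)"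
  shows "nat_restrict C M \<eta> \<in> nat_trans K C M N"
proof -
  have "(\<lambda>m\<in>carrier (Val M x). \<eta> x m) \<in> module_hom K (Val M x) (Val N x)" if x: "x \<in> Obj C" for x
  proof -
    have "linear_map K (Val M x) (Val N x) (\<lambda>m\<in>carrier (Val M x). \<eta> x m)"
      using lin[OF x] by (rule linear_map_cong) simp
    then show ?thesis
      using x by (simp add: linear_map_iff_module_hom linear_functor.Val_vectorspace[OF M]
          linear_functor.Val_vectorspace[OF N])
  qed
  then show ?thesis
    using functor_Act_closed[OF M] by (auto simp: nat_trans_def nat_restrict_def nat)
qed

lemma nat_trans_eqI:
  assumes "\<eta> \<in> nat_trans K C M N" and "\<theta> \<in> nat_trans K C M N'"
    and "\<And>x m. \<lbrakk>x \<in> Obj C; m \<in> carrier (Val M x)\<rbrakk> \<Longrightarrow> \<eta> x m = \<theta> x m"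
  shows "\<eta> = \<theta>"
proof (rule extensionalityI)
  show "\<eta> x = \<theta> x" if "x \<in> Obj C" for x
    by (rule extensionalityI[of _ "carrier (Val M x)"])
      (use assms that in \<open>auto simp: nat_trans_def\<close>)
qed (use assms in \<open>auto simp: nat_trans_def\<close>)

lemma nat_comp_closed:
  assumes L: "linear_functor K C L" and M: "linear_functor K C M" and N: "linear_functor K C N"
    and \<theta>: "\<theta> \<in> nat_trans K C L M" and \<eta>: "\<eta> \<in> nat_trans K C M N"
  shows "nat_comp C L \<eta> \<theta> \<in> nat_trans K C L N"
  unfolding nat_comp_eq
proof (rule nat_transI[OF L N])
  note t = nat_transD[OF \<theta> L M] and e = nat_transD[OF \<eta> M N]
  show "linear_map K (Val L x) (Val N x) (\<lambda>m. \<eta> x (\<theta> x m))" if "x \<in> Obj C" for x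
    using linear_map_comp[OF t(1)[OF that] e(1)[OF that]] .
  show "\<eta> y (\<theta> y (Act L x y f m)) = Act N x y f (\<eta> x (\<theta> x m))"
    if "x \<in> Obj C" "y \<in> Obj C" "f \<in> carrier (Hom C x y)" "m \<in> carrier (Val L x)" for x y f m
    using that t(2) e(2) linear_mapD(3)[OF t(1)] by simp
qed

lemma nat_trans_id:
  assumes M: "linear_functor K C M"
  shows "nat_restrict C M (\<lambda>_ m. m) \<in> nat_trans K C M M"
  by (rule nat_transI[OF M M]) (simp_all add: linear_map_id linear_functor.Val_vectorspace[OF M])

subsection \<open>Subfunctors\<close>

definition sub_functor :: "('k, 'o, 'a, 'm) vect_functor \<Rightarrow> ('o \<Rightarrow> 'm set) \<Rightarrow> ('k, 'o, 'a, 'm) vect_functor"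
  where "sub_functor M N = M\<lparr>Val := \<lambda>x. (Val M x)\<lparr>carrier := N x\<rparr>\<rparr>"

lemma sub_functor_simps [simp]:
  "Val (sub_functor M N) x = (Val M x)\<lparr>carrier := N x\<rparr>" "Act (sub_functor M N) = Act M"
  by (simp_all add: sub_functor_def)

lemma sub_functor_functor:
  assumes M: "linear_functor K C M" and N: "\<And>x. x \<in> Obj C \<Longrightarrow> subspace K (N x) (Val M x)"
    and stable: "\<And>x y f m. \<lbrakk>x \<in> Obj C; y \<in> Obj C; f \<in> carrier (Hom C x y); m \<in> N x\<rbrakk>
      \<Longrightarrow> Act M x y f m \<in> N y"
  shows "linear_functor K C (sub_functor M N)"
proof -
  note NM = subsetD[OF subspaceD(2)[OF N]]
  show ?thesis
  proof (intro linear_functor.intro linear_functor_axioms.intro)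
    show "linear_category K C" by (rule linear_category_axioms)
    show "vectorspace K (Val (sub_functor M N) x)" if "x \<in> Obj C" for x
      using that by (simp add: subspace_vectorspace N)
    show "linear_map K (Val (sub_functor M N) x) (Val (sub_functor M N) y) (Act (sub_functor M N) x y f)"
      if "x \<in> Obj C" "y \<in> Obj C" "f \<in> carrier (Hom C x y)" for x y f
      unfolding sub_functor_simps
      by (rule linear_map_into_subspace)
        (use that in \<open>auto intro: linear_map_from_subspace linear_functor.Act_linear[OF M] N stable\<close>)
    show "linear_map K (Hom C x y) (Val (sub_functor M N) y) (\<lambda>f. Act (sub_functor M N) x y f m)"
      if "x \<in> Obj C" "y \<in> Obj C" "m \<in> carrier (Val (sub_functor M N) x)" for x y m
      unfolding sub_functor_simps
      by (rule linear_map_into_subspace)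
        (use that in \<open>auto intro: linear_functor.Act_linear_Hom[OF M] N stable NM\<close>)
  qed (use NM in \<open>auto simp: linear_functor.Act_Id[OF M] linear_functor.Act_Comp[OF M]\<close>)
qed

text \<open>Only the carriers shrink while the operations and the action remain those of
  \<open>M\<close>. So the kernel has the same value type as \<open>M\<close>, whatever the value
  type of \<open>N\<close>; this keeps it within the reach of \<open>separable\<close>.\<close>

definition kernel_functor ::
  "('k, 'o, 'a, 'm) vect_functor \<Rightarrow> ('k, 'o, 'a, 'n) vect_functor \<Rightarrow> ('o \<Rightarrow> 'm \<Rightarrow> 'n)
    \<Rightarrow> ('k, 'o, 'a, 'm) vect_functor" where
  "kernel_functor M N \<eta> = sub_functor M (\<lambda>x. a_kernel (Val M x) (Val N x) (\<eta> x))"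

lemma kernel_functor_simps [simp]:
  "Val (kernel_functor M N \<eta>) x = (Val M x)\<lparr>carrier := a_kernel (Val M x) (Val N x) (\<eta> x)\<rparr>"
  "Act (kernel_functor M N \<eta>) = Act M"
  by (simp_all add: kernel_functor_def)

lemma kernel_functor_functor:
  assumes M: "linear_functor K C M" and N: "linear_functor K C N" and \<eta>: "\<eta> \<in> nat_trans K C M N"
  shows "linear_functor K C (kernel_functor M N \<eta>)"
  unfolding kernel_functor_def
proof (rule sub_functor_functor[OF M])
  note e = nat_transD[OF \<eta> M N]
  show "subspace K (a_kernel (Val M x) (Val N x) (\<eta> x)) (Val M x)" if "x \<in> Obj C" for x
    by (rule linear_map_kernel_subspace[OF e(1)[OF that]])
  show "Act M x y f m \<in> a_kernel (Val M y) (Val N y) (\<eta> y)"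
    if "x \<in> Obj C" "y \<in> Obj C" "f \<in> carrier (Hom C x y)" "m \<in> a_kernel (Val M x) (Val N x) (\<eta> x)"
    for x y f m
    using that functor_Act_closed[OF M] e(2) linear_mapD(6)[OF linear_functor.Act_linear[OF N]]
    by (auto simp: a_kernel_iff)
qed

lemma nat_trans_into_kernel:
  assumes L: "linear_functor K C L" and M: "linear_functor K C M" and N: "linear_functor K C N"
    and \<eta>: "\<eta> \<in> nat_trans K C M N"
  shows "\<theta> \<in> nat_trans K C L (kernel_functor M N \<eta>) \<longleftrightarrow>
    \<theta> \<in> nat_trans K C L M \<and> (\<forall>x \<in> Obj C. \<forall>m \<in> carrier (Val L x). \<eta> x (\<theta> x m) = \<zero>\<^bsub>Val N x\<^esub>)"
  by (auto simp: nat_trans_def module_hom_def a_kernel_iff Pi_iff)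

end

subsection \<open>Direct sums of representable functors\<close>

definition direct_sum_module :: "'i set \<Rightarrow> ('i \<Rightarrow> ('k, 'u) module) \<Rightarrow> ('k, 'i \<Rightarrow> 'u) module" where
  "direct_sum_module I U =
    \<lparr>carrier = {p \<in> \<Pi>\<^sub>E i\<in>I. carrier (U i). finite {i \<in> I. p i \<noteq> \<zero>\<^bsub>U i\<^esub>}},
     mult = undefined, one = undefined, zero = (\<lambda>i\<in>I. \<zero>\<^bsub>U i\<^esub>),
     add = (\<lambda>p q. \<lambda>i\<in>I. p i \<oplus>\<^bsub>U i\<^esub> q i), smult = (\<lambda>c p. \<lambda>i\<in>I. c \<odot>\<^bsub>U i\<^esub> p i)\<rparr>"

definition free_functor ::
  "('k, 'd, 'b) linear_cat \<Rightarrow> 'i set \<Rightarrow> ('i \<Rightarrow> 'd) \<Rightarrow> ('k, 'd, 'b, 'i \<Rightarrow> 'b) vect_functor" where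
  "free_functor D I ob =
    \<lparr>Val = (\<lambda>y. direct_sum_module I (\<lambda>i. Hom D (ob i) y)),
     Act = (\<lambda>y z g p. \<lambda>i\<in>I. Comp D (ob i) y z g (p i))\<rparr>"

locale free_functor_family = linear_category K D
  for K :: "('k, 'r) ring_scheme" (structure) and D :: "('k, 'd, 'b) linear_cat" +
  fixes I :: "'i set" and ob :: "'i \<Rightarrow> 'd"
  assumes ob: "i \<in> I \<Longrightarrow> ob i \<in> Obj D"
begin

abbreviation "F \<equiv> free_functor D I ob"

lemma Val_F: "Val F y = direct_sum_module I (\<lambda>i. Hom D (ob i) y)"
  by (simp add: free_functor_def)

lemma Act_F: "Act F y z g p = (\<lambda>i\<in>I. Comp D (ob i) y z g (p i))"
  by (simp add: free_functor_def)

lemma finite_support: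
  assumes "y \<in> Obj D"
  shows "finite_support_sum K (Val F y) I (\<lambda>i. Hom D (ob i) y)"
proof (intro finite_support_sum.intro finite_support_sum_axioms.intro)
  show "field K" by (rule field_axioms)
qed (simp_all add: Val_F direct_sum_module_def Hom_vectorspace ob assms)

lemma F_Act_closed:
  assumes y: "y \<in> Obj D" and z: "z \<in> Obj D" and g: "g \<in> carrier (Hom D y z)"
    and p: "p \<in> carrier (Val F y)"
  shows "Act F y z g p \<in> carrier (Val F z)"
proof -
  interpret Y: finite_support_sum K "Val F y" I "\<lambda>i. Hom D (ob i) y" using y by (rule finite_support)
  interpret Z: finite_support_sum K "Val F z" I "\<lambda>i. Hom D (ob i) z" using z by (rule finite_support)
  show ?thesis
  proof (rule Z.closedI[of _ "Y.supp p"])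
    show "Act F y z g p i \<in> carrier (Hom D (ob i) z)" if "i \<in> I" for i
      using that y z g Y.apply_closed[OF p] by (simp add: Act_F Comp_closed ob)
    show "Act F y z g p i = \<zero>\<^bsub>Hom D (ob i) z\<^esub>" if "i \<in> I" "i \<notin> Y.supp p" for i
      using that y z g linear_mapD(6)[OF Comp_linear_right[OF ob y z g]]
      by (simp add: Act_F Y.not_supp)
  qed (use p in \<open>simp_all add: Act_F Y.finite_supp\<close>)
qed

lemma F_functor: "linear_functor K D F"
proof (intro linear_functor.intro linear_functor_axioms.intro)
  show "linear_category K D" by (rule linear_category_axioms)
  show vs: "vectorspace K (Val F y)" if "y \<in> Obj D" for y
    using finite_support[OF that] by (rule finite_support_sum.is_vectorspace)
  note cl = vectorspace_closed[OF vs]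
  fix x y assume x: "x \<in> Obj D" and y: "y \<in> Obj D"
  interpret X: finite_support_sum K "Val F x" I "\<lambda>i. Hom D (ob i) x" using x by (rule finite_support)
  interpret Y: finite_support_sum K "Val F y" I "\<lambda>i. Hom D (ob i) y" using y by (rule finite_support)
  show "linear_map K (Val F x) (Val F y) (Act F x y f)" if f: "f \<in> carrier (Hom D x y)" for f
  proof (rule linear_mapI)
    note c = linear_mapD(4,5)[OF Comp_linear_right[OF ob x y f]]
    show "Act F x y f (p \<oplus>\<^bsub>Val F x\<^esub> q) = Act F x y f p \<oplus>\<^bsub>Val F y\<^esub> Act F x y f q"
      if "p \<in> carrier (Val F x)" "q \<in> carrier (Val F x)" for p q
      using that by (auto simp: Act_F X.add_eq Y.add_eq c X.apply_closed intro!: restrict_ext)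
    show "Act F x y f (a \<odot>\<^bsub>Val F x\<^esub> p) = a \<odot>\<^bsub>Val F y\<^esub> Act F x y f p"
      if "a \<in> carrier K" "p \<in> carrier (Val F x)" for a p
      using that by (auto simp: Act_F X.smult_eq Y.smult_eq c X.apply_closed intro!: restrict_ext)
  qed (use x y f vs F_Act_closed in auto)
  show "linear_map K (Hom D x y) (Val F y) (\<lambda>f. Act F x y f p)" if p: "p \<in> carrier (Val F x)" for p
  proof (rule linear_mapI)
    note c = linear_mapD(4,5)[OF Comp_linear_left[OF ob x y X.apply_closed[OF p]]]
    show "Act F x y (f \<oplus>\<^bsub>Hom D x y\<^esub> g) p = Act F x y f p \<oplus>\<^bsub>Val F y\<^esub> Act F x y g p"
      if "f \<in> carrier (Hom D x y)" "g \<in> carrier (Hom D x y)" for f g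
      using that by (auto simp: Act_F Y.add_eq c intro!: restrict_ext)
    show "Act F x y (a \<odot>\<^bsub>Hom D x y\<^esub> f) p = a \<odot>\<^bsub>Val F y\<^esub> Act F x y f p"
      if "a \<in> carrier K" "f \<in> carrier (Hom D x y)" for a f
      using that by (auto simp: Act_F Y.smult_eq c intro!: restrict_ext)
  qed (use x y p vs F_Act_closed Hom_vectorspace in auto)
next
  fix x p assume x: "x \<in> Obj D" and p: "p \<in> carrier (Val F x)"
  interpret X: finite_support_sum K "Val F x" I "\<lambda>i. Hom D (ob i) x" using x by (rule finite_support)
  show "Act F x x (Id D x) p = p"
    using x p F_Act_closed Id_closed Id_left[OF ob x X.apply_closed[OF p]]
    by (intro X.eqI) (auto simp: Act_F)
next
  fix x y z f g p
  assume x: "x \<in> Obj D" and y: "y \<in> Obj D" and z: "z \<in> Obj D"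
    and fg: "f \<in> carrier (Hom D x y)" "g \<in> carrier (Hom D y z)" and p: "p \<in> carrier (Val F x)"
  interpret X: finite_support_sum K "Val F x" I "\<lambda>i. Hom D (ob i) x" using x by (rule finite_support)
  show "Act F x z (Comp D x y z g f) p = Act F y z g (Act F x y f p)"
    using Comp_assoc[OF ob x y z X.apply_closed[OF p] fg] by (auto simp: Act_F intro!: restrict_ext)
qed

definition incl :: "'d \<Rightarrow> 'i \<Rightarrow> 'b \<Rightarrow> 'i \<Rightarrow> 'b" where
  "incl y = finite_support_sum.incl I (\<lambda>i. Hom D (ob i) y)"

lemma Act_incl:
  assumes y: "y \<in> Obj D" and z: "z \<in> Obj D" and g: "g \<in> carrier (Hom D y z)"
    and i: "i \<in> I" and u: "u \<in> carrier (Hom D (ob i) y)"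
  shows "Act F y z g (incl y i u) = incl z i (Comp D (ob i) y z g u)"
proof -
  interpret Y: finite_support_sum K "Val F y" I "\<lambda>i. Hom D (ob i) y" using y by (rule finite_support)
  interpret Z: finite_support_sum K "Val F z" I "\<lambda>i. Hom D (ob i) z" using z by (rule finite_support)
  show ?thesis
    using linear_mapD(6)[OF Comp_linear_right[OF ob y z g]]
    by (auto simp: Act_F incl_def Y.incl_def Z.incl_def intro!: restrict_ext)
qed

lemma incl_closed:
  assumes "y \<in> Obj D" "i \<in> I" "u \<in> carrier (Hom D (ob i) y)"
  shows "incl y i u \<in> carrier (Val F y)"
  unfolding incl_def using finite_support_sum.incl_closed[OF finite_support] assms by blast

text \<open>The Yoneda principle: every element of a summand arises from the identity in that
  summand by the action of a morphism.\<close>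

lemma incl_eq_Act:
  assumes "y \<in> Obj D" "i \<in> I" "u \<in> carrier (Hom D (ob i) y)"
  shows "incl y i u = Act F (ob i) y u (incl (ob i) i (Id D (ob i)))"
  using assms by (simp add: Act_incl ob Id_closed Id_right)

text \<open>The transformation that the Yoneda lemma attaches to the family \<open>\<xi>\<close>:
  the generator of summand i, an identity, goes to \<open>\<xi> i\<close>.\<close>

definition eval :: "('k, 'd, 'b, 'm) vect_functor \<Rightarrow> ('i \<Rightarrow> 'm) \<Rightarrow> 'd \<Rightarrow> ('i \<Rightarrow> 'b) \<Rightarrow> 'm" where
  "eval X \<xi> y = finite_support_sum.sum_map I (\<lambda>i. Hom D (ob i) y) (Val X y)
    (\<lambda>i f. Act X (ob i) y f (\<xi> i))"

text \<open>Naturality moves an element of a summand back to the identity that generates it, so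
  agreement on the identities spreads to all summands and by linearity to their sum.\<close>

lemma nat_trans_eqI_generators:
  assumes X: "linear_functor K D X"
    and \<eta>: "\<eta> \<in> nat_trans K D F X" and \<theta>: "\<theta> \<in> nat_trans K D F X"
    and eq: "\<And>i. i \<in> I \<Longrightarrow> \<eta> (ob i) (incl (ob i) i (Id D (ob i))) = \<theta> (ob i) (incl (ob i) i (Id D (ob i)))"
    and y: "y \<in> Obj D" and p: "p \<in> carrier (Val F y)"
  shows "\<eta> y p = \<theta> y p"
proof (rule finite_support_sum.maps_eqI[OF finite_support[OF y] _ _ _ p])
  note e = nat_transD[OF \<eta> F_functor X] and t = nat_transD[OF \<theta> F_functor X]
  show "linear_map K (Val F y) (Val X y) (\<eta> y)" "linear_map K (Val F y) (Val X y) (\<theta> y)"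
    using e(1) t(1) y by auto
  fix i u assume i: "i \<in> I" and u: "u \<in> carrier (Hom D (ob i) y)"
  have "\<eta> y (incl y i u) = \<theta> y (incl y i u)"
    unfolding incl_eq_Act[OF y i u] using y i u
    by (simp add: e(2) t(2) ob incl_closed Id_closed eq)
  then show "\<eta> y (finite_support_sum.incl I (\<lambda>i. Hom D (ob i) y) i u) =
      \<theta> y (finite_support_sum.incl I (\<lambda>i. Hom D (ob i) y) i u)"
    by (simp add: incl_def)
qed

context
  fixes X :: "('k, 'd, 'b, 'm) vect_functor" and \<xi>
  assumes X: "linear_functor K D X" and \<xi>: "\<And>i. i \<in> I \<Longrightarrow> \<xi> i \<in> carrier (Val X (ob i))"
begin

lemma eval_linear:
  assumes y: "y \<in> Obj D"
  shows "linear_map K (Val F y) (Val X y) (eval X \<xi> y)"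
  unfolding eval_def
  by (rule finite_support_sum.sum_map_linear[OF finite_support[OF y]])
    (simp_all add: y ob \<xi> linear_functor.Val_vectorspace[OF X] linear_functor.Act_linear_Hom[OF X])

lemma eval_incl:
  assumes "y \<in> Obj D" "i \<in> I" "u \<in> carrier (Hom D (ob i) y)"
  shows "eval X \<xi> y (incl y i u) = Act X (ob i) y u (\<xi> i)"
  unfolding eval_def incl_def
  by (rule finite_support_sum.sum_map_incl[OF finite_support[OF assms(1)]])
    (simp_all add: assms ob \<xi> linear_functor.Val_vectorspace[OF X] linear_functor.Act_linear_Hom[OF X])

text \<open>Both sides are linear in p, and on a single summand the claim is the compatibility of
  the action of \<open>X\<close> with composition.\<close>

lemma eval_natural:
  assumes y: "y \<in> Obj D" and z: "z \<in> Obj D" and g: "g \<in> carrier (Hom D y z)"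
    and p: "p \<in> carrier (Val F y)"
  shows "eval X \<xi> z (Act F y z g p) = Act X y z g (eval X \<xi> y p)"
proof (rule finite_support_sum.maps_eqI[OF finite_support[OF y] _ _ _ p])
  show "linear_map K (Val F y) (Val X z) (\<lambda>p. eval X \<xi> z (Act F y z g p))"
    by (rule linear_map_comp[OF linear_functor.Act_linear[OF F_functor y z g] eval_linear[OF z]])
  show "linear_map K (Val F y) (Val X z) (\<lambda>p. Act X y z g (eval X \<xi> y p))"
    by (rule linear_map_comp[OF eval_linear[OF y] linear_functor.Act_linear[OF X y z g]])
  fix i u assume i: "i \<in> I" and u: "u \<in> carrier (Hom D (ob i) y)"
  have "eval X \<xi> z (Act F y z g (incl y i u)) = Act X y z g (eval X \<xi> y (incl y i u))"
    using i u y z g by (simp add: Act_incl eval_incl Comp_closed ob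
        linear_functor.Act_Comp[OF X ob[OF i] y z u g \<xi>[OF i]])
  then show "eval X \<xi> z (Act F y z g (finite_support_sum.incl I (\<lambda>i. Hom D (ob i) y) i u)) =
      Act X y z g (eval X \<xi> y (finite_support_sum.incl I (\<lambda>i. Hom D (ob i) y) i u))"
    by (simp add: incl_def)
qed

lemma eval_nat_trans: "nat_restrict D F (eval X \<xi>) \<in> nat_trans K D F X"
  by (rule nat_transI[OF F_functor X]) (simp_all add: eval_linear eval_natural)

end

text \<open>Preimages of the images of the generators are chosen freely, and \<open>eval\<close>
  extends the choice. The value types of \<open>X\<close> and \<open>Y\<close> need not be that of
  \<open>F\<close>, which goes beyond what \<open>projective_functor\<close> can express.\<close>

lemma free_functor_lifting:
  assumes X: "linear_functor K D X" and Y: "linear_functor K D Y"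
    and \<pi>: "\<pi> \<in> nat_trans K D X Y" and epi: "nat_epi D X Y \<pi>"
    and \<phi>: "\<phi> \<in> nat_trans K D F Y"
  shows "\<exists>\<psi> \<in> nat_trans K D F X. nat_comp D F \<pi> \<psi> = \<phi>"
proof -
  define b where "b i = incl (ob i) i (Id D (ob i))" for i
  have b: "b i \<in> carrier (Val F (ob i))" if "i \<in> I" for i
    using that by (simp add: b_def incl_closed ob Id_closed)
  have "\<exists>x \<in> carrier (Val X (ob i)). \<pi> (ob i) x = \<phi> (ob i) (b i)" if "i \<in> I" for i
    using epi linear_mapD(3)[OF nat_transD(1)[OF \<phi> F_functor Y]] that ob b
    unfolding nat_epi_def by (metis (no_types, lifting) imageE)
  then obtain \<xi> where \<xi>: "\<And>i. i \<in> I \<Longrightarrow> \<xi> i \<in> carrier (Val X (ob i))"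
    and \<pi>\<xi>: "\<And>i. i \<in> I \<Longrightarrow> \<pi> (ob i) (\<xi> i) = \<phi> (ob i) (b i)"
    by metis
  define \<psi> where "\<psi> = nat_restrict D F (eval X \<xi>)"
  have \<psi>: "\<psi> \<in> nat_trans K D F X" unfolding \<psi>_def by (rule eval_nat_trans[OF X \<xi>])
  have comp: "nat_comp D F \<pi> \<psi> \<in> nat_trans K D F Y"
    by (rule nat_comp_closed[OF F_functor X Y \<psi> \<pi>])
  have "nat_comp D F \<pi> \<psi> = \<phi>"
  proof (rule nat_trans_eqI[OF comp \<phi>], rule nat_trans_eqI_generators[OF Y comp \<phi>])
    fix i assume i: "i \<in> I"
    have "eval X \<xi> (ob i) (b i) = \<xi> i"
      unfolding b_def using i
      by (simp add: eval_incl[OF X \<xi>] ob Id_closed linear_functor.Act_Id[OF X] \<xi>)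
    then show "nat_comp D F \<pi> \<psi> (ob i) (incl (ob i) i (Id D (ob i))) = \<phi> (ob i) (incl (ob i) i (Id D (ob i)))"
      using i b[OF i] \<pi>\<xi>[OF i]
      by (simp add: nat_comp_apply ob \<psi>_def nat_restrict_apply flip: b_def)
  qed
  with \<psi> show ?thesis by blast
qed

end

subsection \<open>Transport of structure\<close>

definition image_module :: "('v \<Rightarrow> 'w) \<Rightarrow> ('k, 'v) module \<Rightarrow> ('k, 'w) module" where
  "image_module h V =
    (let h' = inv_into (carrier V) h in
     \<lparr>carrier = h ` carrier V, mult = undefined, one = undefined, zero = h \<zero>\<^bsub>V\<^esub>,
      add = (\<lambda>a b. h (h' a \<oplus>\<^bsub>V\<^esub> h' b)), smult = (\<lambda>c a. h (c \<odot>\<^bsub>V\<^esub> h' a))\<rparr>)"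

lemma image_module:
  assumes V: "vectorspace K V" and inj: "inj_on h (carrier V)"
  shows "vectorspace K (image_module h V)" and "linear_map K V (image_module h V) h"
    and "linear_map K (image_module h V) V (inv_into (carrier V) h)"
proof -
  note cl = vectorspace_closed[OF V]
  have surj: "h ` carrier V = carrier (image_module h V)"
    by (simp add: image_module_def Let_def)
  show vs: "vectorspace K (image_module h V)" and lin: "linear_map K V (image_module h V) h"
    using vectorspace_surj_image[OF V surj] inj by (auto simp: image_module_def Let_def cl)
  show "linear_map K (image_module h V) V (inv_into (carrier V) h)"
  proof (rule linear_mapI[OF vs V], unfold surj[symmetric])
    show "inv_into (carrier V) h w \<in> carrier V" if "w \<in> h ` carrier V" for w
      using that by (rule inv_into_into)
    show "inv_into (carrier V) h (a \<oplus>\<^bsub>image_module h V\<^esub> b) = inv_into (carrier V) h a \<oplus>\<^bsub>V\<^esub> inv_into (carrier V) h b"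
      if "a \<in> h ` carrier V" "b \<in> h ` carrier V" for a b
      using that inj by (auto simp: cl simp flip: linear_mapD(4)[OF lin])
    show "inv_into (carrier V) h (c \<odot>\<^bsub>image_module h V\<^esub> a) = c \<odot>\<^bsub>V\<^esub> inv_into (carrier V) h a"
      if "c \<in> carrier K" "a \<in> h ` carrier V" for a c
      using that inj by (auto simp: cl simp flip: linear_mapD(5)[OF lin])
  qed
qed

lemma carrier_image_module [simp]: "carrier (image_module h V) = h ` carrier V"
  by (simp add: image_module_def Let_def)

definition transport_functor ::
  "('d \<Rightarrow> 'm \<Rightarrow> 'n) \<Rightarrow> ('k, 'd, 'b, 'm) vect_functor \<Rightarrow> ('k, 'd, 'b, 'n) vect_functor" where
  "transport_functor h M =
    \<lparr>Val = (\<lambda>x. image_module (h x) (Val M x)),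
     Act = (\<lambda>x y f n. h y (Act M x y f (inv_into (carrier (Val M x)) (h x) n)))\<rparr>"

text \<open>Injectivity is asked on the carriers only, and \<open>h\<close> may vary with the
  object: the codes used below describe just the finitely supported families, and the support
  depends on the zero of the Hom space at that object.\<close>

locale functor_transport = linear_functor K D M
  for K :: "('k, 'r) ring_scheme" (structure) and D :: "('k, 'd, 'b) linear_cat"
    and M :: "('k, 'd, 'b, 'm) vect_functor" +
  fixes h :: "'d \<Rightarrow> 'm \<Rightarrow> 'n"
  assumes inj: "x \<in> Obj D \<Longrightarrow> inj_on (h x) (carrier (Val M x))"
begin

abbreviation "T \<equiv> transport_functor h M"
abbreviation "h' x \<equiv> inv_into (carrier (Val M x)) (h x)"

lemma Val_T: "Val T x = image_module (h x) (Val M x)"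
  by (simp add: transport_functor_def)

lemma Act_T: "Act T x y f n = h y (Act M x y f (h' x n))"
  by (simp add: transport_functor_def)

lemma h'_h: "\<lbrakk>x \<in> Obj D; m \<in> carrier (Val M x)\<rbrakk> \<Longrightarrow> h' x (h x m) = m"
  by (simp add: inj)

lemma h_linear: "x \<in> Obj D \<Longrightarrow> linear_map K (Val M x) (Val T x) (h x)"
  unfolding Val_T by (rule image_module(2)) (simp_all add: inj Val_vectorspace)

lemma h'_linear: "x \<in> Obj D \<Longrightarrow> linear_map K (Val T x) (Val M x) (h' x)"
  unfolding Val_T by (rule image_module(3)) (simp_all add: inj Val_vectorspace)

lemma carrier_T: "carrier (Val T x) = h x ` carrier (Val M x)"
  by (simp add: Val_T)

lemma T_functor: "linear_functor K D T"
proof (intro linear_functor.intro linear_functor_axioms.intro)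
  show "linear_category K D" by (rule linear_category_axioms)
  show "vectorspace K (Val T x)" if "x \<in> Obj D" for x
    using h_linear[OF that] by (rule linear_mapD)
  show "linear_map K (Val T x) (Val T y) (Act T x y f)"
    if "x \<in> Obj D" "y \<in> Obj D" "f \<in> carrier (Hom D x y)" for x y f
    using linear_map_comp[OF linear_map_comp[OF h'_linear Act_linear] h_linear] that
    by (simp add: Act_T[abs_def])
  show "linear_map K (Hom D x y) (Val T y) (\<lambda>f. Act T x y f m)"
    if "x \<in> Obj D" "y \<in> Obj D" "m \<in> carrier (Val T x)" for x y m
    unfolding Act_T using linear_map_comp[OF Act_linear_Hom h_linear] that linear_mapD(3)[OF h'_linear]
    by blast
qed (auto simp: carrier_T Act_T h'_h Act_Id Act_Comp functor_Act_closed[OF linear_functor_axioms])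

lemma to_T: "nat_restrict D M h \<in> nat_trans K D M T"
  by (rule nat_transI[OF linear_functor_axioms T_functor h_linear]) (auto simp: Act_T h'_h)

lemma from_T: "nat_restrict D T h' \<in> nat_trans K D T M"
  by (rule nat_transI[OF T_functor linear_functor_axioms h'_linear])
    (auto simp: Act_T carrier_T h'_h functor_Act_closed[OF linear_functor_axioms])

text \<open>The lifting property of \<open>M\<close> is taken against functors valued in the target
  type of \<open>h\<close>, not in the value type of \<open>M\<close>; so it appears as a hypothesis
  spelled out in full. Composing with \<open>h\<close> and its inverse moves a lifting problem for
  \<open>T\<close> to \<open>M\<close> and back.\<close>

lemma T_projective:
  assumes lift: "\<And>(X :: ('k, 'd, 'b, 'n) vect_functor) (Y :: ('k, 'd, 'b, 'n) vect_functor) \<pi> \<phi>.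
    \<lbrakk>linear_functor K D X; linear_functor K D Y; \<pi> \<in> nat_trans K D X Y; nat_epi D X Y \<pi>;
      \<phi> \<in> nat_trans K D M Y\<rbrakk> \<Longrightarrow> \<exists>\<psi> \<in> nat_trans K D M X. nat_comp D M \<pi> \<psi> = \<phi>"
  shows "projective_functor K D T"
  unfolding projective_functor_def
proof (intro conjI allI impI ballI T_functor)
  fix X Y :: "('k, 'd, 'b, 'n) vect_functor" and \<pi> \<phi>
  assume X: "linear_functor K D X" and Y: "linear_functor K D Y"
    and \<pi>: "\<pi> \<in> nat_trans K D X Y" and epi: "nat_epi D X Y \<pi>" and \<phi>: "\<phi> \<in> nat_trans K D T Y"
  have "nat_comp D M \<phi> (nat_restrict D M h) \<in> nat_trans K D M Y"
    by (rule nat_comp_closed[OF linear_functor_axioms T_functor Y to_T \<phi>])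
  from lift[OF X Y \<pi> epi this] obtain \<psi> where \<psi>: "\<psi> \<in> nat_trans K D M X"
    and eq: "nat_comp D M \<pi> \<psi> = nat_comp D M \<phi> (nat_restrict D M h)" by blast
  define \<psi>' where "\<psi>' = nat_comp D T \<psi> (nat_restrict D T h')"
  have \<psi>': "\<psi>' \<in> nat_trans K D T X"
    unfolding \<psi>'_def by (rule nat_comp_closed[OF T_functor linear_functor_axioms X from_T \<psi>])
  have "nat_comp D T \<pi> \<psi>' = \<phi>"
  proof (rule nat_trans_eqI[OF nat_comp_closed[OF T_functor X Y \<psi>' \<pi>] \<phi>])
    fix x n assume x: "x \<in> Obj D" and n: "n \<in> carrier (Val T x)"
    then obtain m where m: "m \<in> carrier (Val M x)" and n_eq: "n = h x m" by (auto simp: carrier_T)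
    have "nat_comp D T \<pi> \<psi>' x n = nat_comp D M \<pi> \<psi> x m"
      using x m n by (simp add: nat_comp_apply \<psi>'_def nat_restrict_apply n_eq h'_h)
    also have "\<dots> = \<phi> x n"
      using x m by (simp add: eq nat_comp_apply nat_restrict_apply n_eq)
    finally show "nat_comp D T \<pi> \<psi>' x n = \<phi> x n" .
  qed
  with \<psi>' show "\<exists>\<psi> \<in> nat_trans K D T X. nat_comp D T \<pi> \<psi> = \<phi>" by blast
qed

end

section \<open>Projective resolutions\<close>

text \<open>A function on an infinite index set does not fit into a finite sequence, so only its
  entries over a finite set are recorded, each next to the code of its index.\<close>

definition family_code ::
  "('i \<Rightarrow> ('d, 'b) hf_sequence) \<Rightarrow> 'i set \<Rightarrow> ('i \<Rightarrow> 'b) \<Rightarrow> ('d, 'b) hf_sequence" where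
  "family_code E A p =
    Sequence (map (\<lambda>i. Sequence [E i, Morphism (p i)]) (SOME is. set is = A))"

text \<open>Equal codes have equal index codes entry by entry, so the two enumerations coincide as
  lists, and with them the sets.\<close>

lemma family_code_inject:
  assumes "inj E" and "finite A" "finite B" and "family_code E A p = family_code E B q"
  shows "A = B" and "\<And>i. i \<in> A \<Longrightarrow> p i = q i"
proof -
  define k l where "k = (SOME is. set is = A)" and "l = (SOME is. set is = B)"
  have sets: "set k = A" "set l = B"
    unfolding k_def l_def using assms(2,3) by (auto intro!: someI_ex finite_list)
  have "map (\<lambda>i. Sequence [E i, Morphism (p i)]) k = map (\<lambda>i. Sequence [E i, Morphism (q i)]) l"
    using assms(4) by (simp add: family_code_def k_def l_def)
  then have "k = l \<and> (\<forall>i \<in> set k. p i = q i)"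
  proof (induction k arbitrary: l)
    case (Cons i k)
    then show ?case using assms(1) by (auto simp: Cons_eq_map_conv inj_eq)
  qed simp
  then show "A = B" and "\<And>i. i \<in> A \<Longrightarrow> p i = q i" using sets by auto
qed

text \<open>Two preimages of a vector under \<open>E\<close> differ by an element of the kernel,
  which \<open>T\<close> kills; so \<open>T\<close> is constant on the fibres of \<open>E\<close>.
  This later turns a retraction onto a kernel into a section.\<close>

lemma linear_map_factor:
  assumes E: "linear_map K V A E" and surj: "E ` carrier V = carrier A"
    and T: "linear_map K V W T" and ker: "\<And>v. \<lbrakk>v \<in> carrier V; E v = \<zero>\<^bsub>A\<^esub>\<rbrakk> \<Longrightarrow> T v = \<zero>\<^bsub>W\<^esub>"
  shows "\<exists>S. linear_map K A W S \<and> (\<forall>v \<in> carrier V. S (E v) = T v)"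
proof -
  interpret V: vectorspace K V using E by (rule linear_mapD)
  interpret A: vectorspace K A using E by (rule linear_mapD)
  interpret W: vectorspace K W using T by (rule linear_mapD)
  note E' = linear_mapD[OF E] and T' = linear_mapD[OF T]
  have eq: "T u = T v" if "u \<in> carrier V" "v \<in> carrier V" "E u = E v" for u v
  proof -
    have "T (u \<ominus>\<^bsub>V\<^esub> v) = \<zero>\<^bsub>W\<^esub>"
      using that by (intro ker) (simp_all add: E' A.M.minus_eq A.M.r_neg)
    then show ?thesis using that by (simp add: T')
  qed
  define S where "S a = T (inv_into (carrier V) E a)" for a
  have S: "S (E v) = T v" if "v \<in> carrier V" for v
    unfolding S_def using that
    by (intro eq) (auto intro: inv_into_into f_inv_into_f)
  have "linear_map K A W S"
  proof (rule linear_mapI[OF A.vectorspace_axioms W.vectorspace_axioms], unfold surj[symmetric])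
    show "S a \<in> carrier W" if "a \<in> E ` carrier V" for a
      using that by (auto simp: S T')
    show "S (a \<oplus>\<^bsub>A\<^esub> b) = S a \<oplus>\<^bsub>W\<^esub> S b" if "a \<in> E ` carrier V" "b \<in> E ` carrier V" for a b
      using that by (auto simp: S T'(4) simp flip: E'(4))
    show "S (c \<odot>\<^bsub>A\<^esub> a) = c \<odot>\<^bsub>W\<^esub> S a" if "c \<in> carrier K" "a \<in> E ` carrier V" for a c
      using that by (auto simp: S T'(5) simp flip: E'(5))
  qed
  with S show ?thesis by blast
qed

lemma linear_map_diff:
  assumes S: "linear_map K V W S" and T: "linear_map K V W T"
  shows "linear_map K V W (\<lambda>v. S v \<ominus>\<^bsub>W\<^esub> T v)"
proof (rule linear_mapI)
  interpret W: vectorspace K W using T by (rule linear_mapD)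
  note S' = linear_mapD[OF S] and T' = linear_mapD[OF T]
  show "S (u \<oplus>\<^bsub>V\<^esub> v) \<ominus>\<^bsub>W\<^esub> T (u \<oplus>\<^bsub>V\<^esub> v) = (S u \<ominus>\<^bsub>W\<^esub> T u) \<oplus>\<^bsub>W\<^esub> (S v \<ominus>\<^bsub>W\<^esub> T v)"
    if "u \<in> carrier V" "v \<in> carrier V" for u v
    using that by (simp add: S' T' W.M.minus_eq W.M.minus_add W.M.a_ac)
  show "S (c \<odot>\<^bsub>V\<^esub> v) \<ominus>\<^bsub>W\<^esub> T (c \<odot>\<^bsub>V\<^esub> v) = c \<odot>\<^bsub>W\<^esub> (S v \<ominus>\<^bsub>W\<^esub> T v)"
    if "c \<in> carrier K" "v \<in> carrier V" for c v
    using that by (simp add: S' T' W.M.minus_eq W.smult_r_distr W.smult_r_minus)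
  show "S v \<ominus>\<^bsub>W\<^esub> T v \<in> carrier W" if "v \<in> carrier V" for v
    using that by (simp add: S' T')
qed (use linear_mapD[OF T] in simp_all)

section \<open>Free covers, their coded copies, and resolutions\<close>

context linear_category
begin

lemma nat_restrict_ident: "\<eta> \<in> nat_trans K C M N \<Longrightarrow> nat_restrict C M \<eta> = \<eta>"
  by (auto simp: nat_trans_def nat_restrict_def fun_eq_iff extensional_def)

lemma nat_trans_zero:
  assumes M: "linear_functor K C M" and N: "linear_functor K C N"
  shows "nat_restrict C M (\<lambda>x m. \<zero>\<^bsub>Val N x\<^esub>) \<in> nat_trans K C M N"
proof (rule nat_transI[OF M N])
  show "linear_map K (Val M x) (Val N x) (\<lambda>m. \<zero>\<^bsub>Val N x\<^esub>)" if x: "x \<in> Obj C" for x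
  proof -
    interpret vectorspace K "Val N x" using x by (rule linear_functor.Val_vectorspace[OF N])
    show ?thesis
      using linear_functor.Val_vectorspace[OF M x] linear_functor.Val_vectorspace[OF N x]
      by (intro linear_mapI) simp_all
  qed
  show "\<zero>\<^bsub>Val N y\<^esub> = Act N x y f \<zero>\<^bsub>Val N x\<^esub>"
    if "x \<in> Obj C" "y \<in> Obj C" "f \<in> carrier (Hom C x y)" for x y f
    using linear_mapD(6)[OF linear_functor.Act_linear[OF N that]] by simp
qed

text \<open>Every element of every value serves as a generator, so the cover is visibly onto: m is
  the image of the identity in summand \<open>(x, m)\<close>.\<close>

definition cover_index :: "('k, 'o, 'a, 'm) vect_functor \<Rightarrow> ('o \<times> 'm) set" where
  "cover_index M = {(x, m). x \<in> Obj C \<and> m \<in> carrier (Val M x)}"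

definition free_cover :: "('k, 'o, 'a, 'm) vect_functor \<Rightarrow> ('k, 'o, 'a, 'o \<times> 'm \<Rightarrow> 'a) vect_functor"
  where "free_cover M = free_functor C (cover_index M) fst"

lemma cover_family: "free_functor_family K C (cover_index M) fst"
  by unfold_locales (auto simp: cover_index_def)

definition cover_map :: "('k, 'o, 'a, 'm) vect_functor \<Rightarrow> 'o \<Rightarrow> ('o \<times> 'm \<Rightarrow> 'a) \<Rightarrow> 'm" where
  "cover_map M = nat_restrict C (free_cover M) (free_functor_family.eval C (cover_index M) fst M snd)"

lemma cover_map_nat_trans:
  assumes M: "linear_functor K C M"
  shows "cover_map M \<in> nat_trans K C (free_cover M) M"
  unfolding cover_map_def free_cover_def
  by (rule free_functor_family.eval_nat_trans[OF cover_family M]) (auto simp: cover_index_def)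

lemma free_cover_functor: "linear_functor K C (free_cover M)"
  unfolding free_cover_def by (rule free_functor_family.F_functor[OF cover_family])

lemma cover_map_epi:
  assumes M: "linear_functor K C M"
  shows "nat_epi C (free_cover M) M (cover_map M)"
  unfolding nat_epi_def
proof (intro ballI equalityI subsetI)
  interpret free_functor_family K C "cover_index M" fst by (rule cover_family)
  fix x m assume x: "x \<in> Obj C" and m: "m \<in> carrier (Val M x)"
  then have i: "(x, m) \<in> cover_index M" by (simp add: cover_index_def)
  have b: "incl x (x, m) (Id C x) \<in> carrier (Val (free_cover M) x)"
    unfolding free_cover_def using x i by (intro incl_closed) (auto simp: Id_closed)
  have "eval M snd x (incl x (x, m) (Id C x)) = m"
    using eval_incl[OF M, of snd x "(x, m)" "Id C x"] x i m
    by (auto simp: cover_index_def Id_closed linear_functor.Act_Id[OF M])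
  then have "cover_map M x (incl x (x, m) (Id C x)) = m"
    using x b by (simp add: cover_map_def nat_restrict_apply)
  with b show "m \<in> cover_map M x ` carrier (Val (free_cover M) x)" by force
next
  fix x m assume "x \<in> Obj C" and "m \<in> cover_map M x ` carrier (Val (free_cover M) x)"
  then show "m \<in> carrier (Val M x)"
    using linear_mapD(3)[OF nat_transD(1)[OF cover_map_nat_trans[OF M] free_cover_functor M]] by auto
qed

text \<open>\<open>j\<close> codes the values of \<open>M\<close>. For a functor that already takes
  values in \<open>hf_sequence\<close> it can be \<open>id\<close>, so the construction can be
  iterated without leaving the type.\<close>

definition cover_code ::
  "('m \<Rightarrow> ('o, 'a) hf_sequence) \<Rightarrow> ('k, 'o, 'a, 'm) vect_functor \<Rightarrow> 'o \<Rightarrow> ('o \<times> 'm \<Rightarrow> 'a)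
    \<Rightarrow> ('o, 'a) hf_sequence" where
  "cover_code j M y p = family_code (\<lambda>(x, m). Sequence [Object x, j m])
    {i \<in> cover_index M. p i \<noteq> \<zero>\<^bsub>Hom C (fst i) y\<^esub>} p"

text \<open>The code reveals the support of a family and its entries there; off the support all
  entries are zero.\<close>

lemma cover_transport:
  assumes j: "inj j"
  shows "functor_transport K C (free_cover M) (cover_code j M)"
proof (intro functor_transport.intro functor_transport_axioms.intro free_cover_functor inj_onI)
  fix y p q
  assume y: "y \<in> Obj C" and p: "p \<in> carrier (Val (free_cover M) y)"
    and q: "q \<in> carrier (Val (free_cover M) y)" and eq: "cover_code j M y p = cover_code j M y q"
  interpret free_functor_family K C "cover_index M" fst by (rule cover_family)
  interpret Y: finite_support_sum K "Val (free_cover M) y" "cover_index M" "\<lambda>i. Hom C (fst i) y"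
    unfolding free_cover_def using y by (rule finite_support)
  have E: "inj (\<lambda>(x, m). Sequence [Object x, j m])"
    using j by (auto simp: inj_def)
  note c = family_code_inject[OF E Y.finite_supp[OF p, unfolded Y.supp_def]
      Y.finite_supp[OF q, unfolded Y.supp_def] eq[unfolded cover_code_def], folded Y.supp_def]
  show "p = q"
  proof (rule Y.eqI[OF p q])
    fix i assume i: "i \<in> cover_index M"
    show "p i = q i"
    proof (cases "i \<in> Y.supp p")
      case True
      then show ?thesis by (rule c(2))
    next
      case False
      then show ?thesis using Y.not_supp[OF i] c(1) by metis
    qed
  qed
qed

lemma free_cover_lifting:
  assumes "linear_functor K C X" "linear_functor K C Y" "\<pi> \<in> nat_trans K C X Y" "nat_epi C X Y \<pi>"
    and "\<phi> \<in> nat_trans K C (free_cover M) Y"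
  shows "\<exists>\<psi> \<in> nat_trans K C (free_cover M) X. nat_comp C (free_cover M) \<pi> \<psi> = \<phi>"
  using free_functor_family.free_functor_lifting[OF cover_family assms[unfolded free_cover_def]]
  unfolding free_cover_def .

definition coded_cover :: "('m \<Rightarrow> ('o, 'a) hf_sequence) \<Rightarrow> ('k, 'o, 'a, 'm) vect_functor
    \<Rightarrow> ('k, 'o, 'a, ('o, 'a) hf_sequence) vect_functor" where
  "coded_cover j M = transport_functor (cover_code j M) (free_cover M)"

definition coded_cover_map :: "('m \<Rightarrow> ('o, 'a) hf_sequence) \<Rightarrow> ('k, 'o, 'a, 'm) vect_functor
    \<Rightarrow> 'o \<Rightarrow> ('o, 'a) hf_sequence \<Rightarrow> 'm" where
  "coded_cover_map j M = nat_comp C (coded_cover j M) (cover_map M)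
    (nat_restrict C (coded_cover j M)
      (\<lambda>x. inv_into (carrier (Val (free_cover M) x)) (cover_code j M x)))"

text \<open>Enough projectives within the type of codes: \<open>j = id\<close> covers functors
  valued in codes, any other injection \<open>j\<close> covers a functor with a different value
  type.\<close>

lemma coded_cover:
  assumes M: "linear_functor K C M" and j: "inj j"
  shows "projective_functor K C (coded_cover j M)"
    and "coded_cover_map j M \<in> nat_trans K C (coded_cover j M) M"
    and "nat_epi C (coded_cover j M) M (coded_cover_map j M)"
proof -
  interpret functor_transport K C "free_cover M" "cover_code j M" by (rule cover_transport[OF j])
  show "projective_functor K C (coded_cover j M)"
    unfolding coded_cover_def by (rule T_projective) (rule free_cover_lifting)
  show "coded_cover_map j M \<in> nat_trans K C (coded_cover j M) M"
    unfolding coded_cover_def coded_cover_map_def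
    by (rule nat_comp_closed[OF T_functor free_cover_functor M from_T cover_map_nat_trans[OF M]])
  show "nat_epi C (coded_cover j M) M (coded_cover_map j M)"
    unfolding nat_epi_def
  proof
    fix x assume x: "x \<in> Obj C"
    have "coded_cover_map j M x (cover_code j M x p) = cover_map M x p"
      if "p \<in> carrier (Val (free_cover M) x)" for p
      using x that
      by (simp add: coded_cover_map_def nat_comp_apply nat_restrict_apply carrier_T h'_h coded_cover_def)
    then have "coded_cover_map j M x ` carrier (Val (coded_cover j M) x)
        = cover_map M x ` carrier (Val (free_cover M) x)"
      by (auto simp: coded_cover_def carrier_T image_image)
    then show "coded_cover_map j M x ` carrier (Val (coded_cover j M) x) = carrier (Val M x)"
      using cover_map_epi[OF M] x by (simp add: nat_epi_def)
  qed
qed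

text \<open>The identity of \<open>P\<close> is lifted along a cover. As projectivity of
  \<open>P\<close> is tested only inside the type of codes, the lift goes to the coded cover first
  and is then decoded into the honest direct sum of representables.\<close>

lemma projective_summand:
  fixes P :: "('k, 'o, 'a, ('o, 'a) hf_sequence) vect_functor"
  assumes P: "projective_functor K C P"
  shows "\<exists>\<rho> \<in> nat_trans K C P (free_cover P).
    \<forall>x \<in> Obj C. \<forall>p \<in> carrier (Val P x). cover_map P x (\<rho> x p) = p"
proof -
  have lin: "linear_functor K C P" using P by (simp add: projective_functor_def)
  interpret functor_transport K C "free_cover P" "cover_code id P" by (rule cover_transport) simp
  note cc = coded_cover[OF lin inj_on_id]
  have "linear_functor K C (coded_cover id P)"
    using cc(1) by (simp add: projective_functor_def)
  then obtain \<psi> where \<psi>: "\<psi> \<in> nat_trans K C P (coded_cover id P)"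
    and eq: "nat_comp C P (coded_cover_map id P) \<psi> = nat_restrict C P (\<lambda>_ m. m)"
    using P cc(2,3) lin nat_trans_id[OF lin] unfolding projective_functor_def by metis
  define \<rho> where "\<rho> = nat_comp C P (nat_restrict C T h') \<psi>"
  have "\<rho> \<in> nat_trans K C P (free_cover P)"
    unfolding \<rho>_def by (rule nat_comp_closed[OF lin T_functor free_cover_functor
          \<psi>[unfolded coded_cover_def] from_T])
  moreover have "cover_map P x (\<rho> x p) = p" if x: "x \<in> Obj C" and p: "p \<in> carrier (Val P x)" for x p
  proof -
    have "\<psi> x p \<in> carrier (Val T x)"
      using linear_mapD(3)[OF nat_transD(1)[OF \<psi>[unfolded coded_cover_def] lin T_functor x] p] .
    then have "cover_map P x (\<rho> x p) = nat_comp C P (coded_cover_map id P) \<psi> x p"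
      using x p by (simp add: \<rho>_def nat_comp_apply coded_cover_map_def coded_cover_def nat_restrict_apply)
    then show ?thesis using x p by (simp add: eq nat_restrict_apply)
  qed
  ultimately show ?thesis by blast
qed

text \<open>The usual iteration of covers and kernels. Only the first cover uses \<open>j\<close>;
  the kernels are valued in codes and are covered with \<open>id\<close>.\<close>

lemma projective_resolution_exists:
  fixes A :: "('k, 'o, 'a, 'm) vect_functor" and j :: "'m \<Rightarrow> ('o, 'a) hf_sequence"
  assumes A: "linear_functor K C A" and j: "inj j"
  shows "\<exists>(P :: nat \<Rightarrow> ('k, 'o, 'a, ('o, 'a) hf_sequence) vect_functor) d \<epsilon>.
    projective_resolution K C A P d \<epsilon>"
proof -
  define \<epsilon> where "\<epsilon> = coded_cover_map j A"
  \<comment> \<open>Indices: \<open>Z n\<close> is the kernel of the map leaving \<open>P n\<close>,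
    and \<open>P (Suc n)\<close> covers \<open>Z n\<close> by \<open>d n\<close>. The inclusion of
    \<open>Z n\<close> into \<open>P n\<close> is the identity on values, so \<open>d n\<close> is
    at the same time the differential into \<open>P n\<close>.\<close>
  define Z where "Z = rec_nat (kernel_functor (coded_cover j A) A \<epsilon>)
    (\<lambda>_ M. kernel_functor (coded_cover id M) M (coded_cover_map id M))"
  define P where "P = case_nat (coded_cover j A) (\<lambda>n. coded_cover id (Z n))"
  define d where "d n = coded_cover_map id (Z n)" for n
  have Z_0: "Z 0 = kernel_functor (P 0) A \<epsilon>"
    and Z_Suc: "Z (Suc n) = kernel_functor (P (Suc n)) (Z n) (d n)" for n
    by (simp_all add: Z_def P_def d_def)
  note cA = coded_cover[OF A j]
  have fA: "linear_functor K C (P 0)" using cA(1) by (simp add: projective_functor_def P_def)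
  have \<epsilon>: "\<epsilon> \<in> nat_trans K C (P 0) A" using cA(2) by (simp add: \<epsilon>_def P_def)
  have Z: "linear_functor K C (Z n)" for n
  proof (induction n)
    case 0
    show ?case unfolding Z_0 by (rule kernel_functor_functor[OF fA A \<epsilon>])
  next
    case (Suc n)
    note c = coded_cover[OF Suc inj_on_id]
    then have "linear_functor K C (P (Suc n))" by (simp add: projective_functor_def P_def)
    then show ?case unfolding Z_Suc
      using c(2) by (intro kernel_functor_functor Suc) (auto simp: P_def d_def)
  qed
  have proj: "projective_functor K C (P n)" for n
    using cA(1) coded_cover(1)[OF Z inj_on_id] by (cases n) (auto simp: P_def)
  then have fP: "linear_functor K C (P n)" for n by (simp add: projective_functor_def)
  have dZ: "d n \<in> nat_trans K C (P (Suc n)) (Z n)"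
    and epi: "nat_epi C (P (Suc n)) (Z n) (d n)" for n
    using coded_cover(2,3)[OF Z inj_on_id] by (auto simp: P_def d_def)
  have d: "d n \<in> nat_trans K C (P (Suc n)) (P n)" for n
  proof (cases n)
    case 0
    then show ?thesis
      using dZ[of 0] nat_trans_into_kernel[OF fP fA A \<epsilon>] by (auto simp: Z_0)
  next
    case (Suc k)
    then show ?thesis
      using dZ[of "Suc k"] nat_trans_into_kernel[OF fP fP Z dZ[of k]] by (auto simp: Z_Suc)
  qed
  \<comment> \<open>A subfunctor shares the zeros of the ambient functor, so the kernel of
    \<open>d n\<close> is the same for the targets \<open>Z n\<close> and
    \<open>P n\<close>.\<close>
  have zero: "\<zero>\<^bsub>Val (Z n) x\<^esub> = \<zero>\<^bsub>Val (P n) x\<^esub>" for n x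
    by (cases n) (simp_all add: Z_0 Z_Suc)
  have img: "d n x ` carrier (Val (P (Suc n)) x) = carrier (Val (Z n) x)" if "x \<in> Obj C" for n x
    using epi[of n] that by (simp add: nat_epi_def)
  have ker: "a_kernel (Val (P (Suc n)) x) (Val (Z n) x) (d n x) =
      a_kernel (Val (P (Suc n)) x) (Val (P n) x) (d n x)" for n x
    by (auto simp: a_kernel_iff zero)
  have "projective_resolution K C A P d \<epsilon>"
    unfolding projective_resolution_def
    using proj d \<epsilon> cA(3) by (auto simp: img Z_0 Z_Suc ker simp flip: P_def) (simp add: \<epsilon>_def P_def)
  then show ?thesis by blast
qed

text \<open>Vanishing on the kernel \<open>\<Omega>\<close> of \<open>\<epsilon> : P 0 \<rightarrow> A\<close> makes \<open>d 0\<close>, viewed as a cocycle with values in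
  \<open>\<Omega>\<close>, a coboundary \<open>\<phi> \<circ> d 0\<close>; then \<open>\<phi>\<close> retracts \<open>P 0\<close> onto \<open>\<Omega>\<close>, and \<open>\<epsilon>\<close> splits.\<close>
lemma resolution_splits:
  fixes P :: "nat \<Rightarrow> ('k, 'o, 'a, 'm) vect_functor"
  assumes A: "linear_functor K C A" and res: "projective_resolution K C A P d \<epsilon>"
    and M_def: "M = kernel_functor (P 0) A \<epsilon>"
    and H: "carrier (quotient_module ((nat_module K C (P 1) M)\<lparr>carrier := cocycles K C P d M 1\<rparr>)
      (coboundaries K C P d M 1)) = {coboundaries K C P d M 1}"
  shows "\<exists>\<sigma> \<in> nat_trans K C A (P 0). \<forall>x \<in> Obj C. \<forall>a \<in> carrier (Val A x). \<epsilon> x (\<sigma> x a) = a"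
proof -
  have fP: "linear_functor K C (P n)" for n
    using res by (simp add: projective_resolution_def projective_functor_def)
  have d: "\<And>n. d n \<in> nat_trans K C (P (Suc n)) (P n)"
    and \<epsilon>: "\<epsilon> \<in> nat_trans K C (P 0) A" and epi: "nat_epi C (P 0) A \<epsilon>"
    and ex0: "\<And>x. x \<in> Obj C \<Longrightarrow> a_kernel (Val (P 0) x) (Val A x) (\<epsilon> x) = d 0 x ` carrier (Val (P 1) x)"
    and ex1: "\<And>x n. x \<in> Obj C \<Longrightarrow> a_kernel (Val (P (Suc n)) x) (Val (P n) x) (d n x)
        = d (Suc n) x ` carrier (Val (P (Suc (Suc n))) x)"
    using res by (auto simp: projective_resolution_def)
  have fM: "linear_functor K C M" unfolding M_def by (rule kernel_functor_functor[OF fP A \<epsilon>])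
  note e = nat_transD[OF \<epsilon> fP A]
  have carrier_M: "carrier (Val M x) = d 0 x ` carrier (Val (P 1) x)" if "x \<in> Obj C" for x
    using ex0[OF that] by (simp add: M_def)
  have zero_M: "\<zero>\<^bsub>Val M x\<^esub> = \<zero>\<^bsub>Val (P 0) x\<^esub>" for x by (simp add: M_def)
  have d0: "d 0 \<in> nat_trans K C (P 1) M"
  proof -
    have "d 0 x m \<in> a_kernel (Val (P 0) x) (Val A x) (\<epsilon> x)"
      if "x \<in> Obj C" "m \<in> carrier (Val (P 1) x)" for x m
      using that by (simp add: ex0)
    then show ?thesis
      unfolding M_def using d[of 0] nat_trans_into_kernel[OF fP fP A \<epsilon>] by (simp add: a_kernel_iff)
  qed
  have "d 0 x (d 1 x p) = \<zero>\<^bsub>Val M x\<^esub>" if "x \<in> Obj C" "p \<in> carrier (Val (P 2) x)" for x p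
  proof -
    have "d 1 x p \<in> a_kernel (Val (P 1) x) (Val (P 0) x) (d 0 x)"
      using ex1[of x 0] that by (auto simp: numeral_2_eq_2)
    then show ?thesis by (simp add: a_kernel_iff zero_M)
  qed
  then have "d 0 \<in> cocycles K C P d M 1"
    using d0 by (auto simp: cocycles_def nat_comp_eq nat_restrict_def nat_module_def numeral_2_eq_2
        intro!: restrict_ext)
  \<comment> \<open>\<open>H\<close> describes the carrier of the quotient, so it says of each
    cocycle that its coset is the set of coboundaries; here the cocycle is
    \<open>d 0\<close>.\<close>
  then have coset: "a_r_coset ((nat_module K C (P 1) M)\<lparr>carrier := cocycles K C P d M 1\<rparr>)
      (coboundaries K C P d M 1) (d 0) = coboundaries K C P d M 1"
    using H by (auto simp: quotient_module_def A_RCOSETS_def')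
  \<comment> \<open>The zero transformation, presented as a coboundary. It exhibits
    \<open>d 0\<close> = z + \<open>d 0\<close> as an element of its own coset and thus as a
    coboundary.\<close>
  define z where "z = nat_comp C (P 1) (nat_restrict C (P 0) (\<lambda>x m. \<zero>\<^bsub>Val M x\<^esub>)) (d 0)"
  have "z \<in> coboundaries K C P d M 1"
    using nat_trans_zero[OF fP fM] by (auto simp: z_def)
  then have "z \<oplus>\<^bsub>nat_module K C (P 1) M\<^esub> d 0 \<in> coboundaries K C P d M 1"
    using coset by (auto simp: a_r_coset_def')
  moreover have "z \<oplus>\<^bsub>nat_module K C (P 1) M\<^esub> d 0 = nat_restrict C (P 1) (d 0)"
  proof -
    have "z x m \<oplus>\<^bsub>Val M x\<^esub> d 0 x m = d 0 x m" if "x \<in> Obj C" "m \<in> carrier (Val (P 1) x)" for x m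
    proof -
      interpret vectorspace K "Val M x" using that fM by (intro linear_functor.Val_vectorspace)
      have "d 0 x m \<in> carrier (Val M x)" using that by (simp add: carrier_M)
      moreover have "d 0 x m \<in> carrier (Val (P 0) x)"
        using linear_mapD(3)[OF nat_transD(1)[OF d fP fP]] that by simp
      ultimately show ?thesis using that by (simp add: z_def nat_comp_apply nat_restrict_apply)
    qed
    then show ?thesis by (auto simp: nat_module_def nat_restrict_def intro!: restrict_ext)
  qed
  ultimately obtain \<phi> where \<phi>: "\<phi> \<in> nat_trans K C (P 0) M" and eq: "d 0 = nat_comp C (P 1) \<phi> (d 0)"
    by (auto simp: nat_restrict_ident[OF d0, unfolded One_nat_def])
  have \<phi>P: "\<phi> \<in> nat_trans K C (P 0) (P 0)" and \<epsilon>\<phi>: "\<And>x p. \<lbrakk>x \<in> Obj C; p \<in> carrier (Val (P 0) x)\<rbrakk>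
      \<Longrightarrow> \<epsilon> x (\<phi> x p) = \<zero>\<^bsub>Val A x\<^esub>"
    using \<phi> nat_trans_into_kernel[OF fP fP A \<epsilon>] by (auto simp: M_def)
  note p = nat_transD[OF \<phi>P fP fP]
  \<comment> \<open>By exactness \<open>M\<close> consists of the values of \<open>d 0\<close>, and
    composing \<open>d 0\<close> with \<open>\<phi>\<close> changes nothing, so
    \<open>\<phi>\<close> fixes \<open>M\<close>.\<close>
  have retract: "\<phi> x m = m" if xm: "x \<in> Obj C" "m \<in> carrier (Val M x)" for x m
  proof -
    obtain q where q: "q \<in> carrier (Val (P 1) x)" and m: "m = d 0 x q"
      using xm by (auto simp: carrier_M)
    have "d 0 x q = \<phi> x (d 0 x q)"
      by (subst eq) (use xm(1) q in \<open>simp add: nat_comp_apply\<close>)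
    then show ?thesis by (simp add: m)
  qed
  \<comment> \<open>The complementary map 1 - \<open>\<phi>\<close> vanishes on the kernel of
    \<open>\<epsilon>\<close> and therefore factors through \<open>\<epsilon>\<close>. The factor is
    a section of \<open>\<epsilon>\<close>, because \<open>\<epsilon>\<close> kills the values of
    \<open>\<phi>\<close>.\<close>
  define \<theta> where "\<theta> x m = m \<ominus>\<^bsub>Val (P 0) x\<^esub> \<phi> x m" for x m
  have \<theta>: "linear_map K (Val (P 0) x) (Val (P 0) x) (\<theta> x)" if "x \<in> Obj C" for x
    unfolding \<theta>_def
    by (rule linear_map_diff[OF linear_map_id p(1)[OF that]])
      (rule linear_functor.Val_vectorspace[OF fP that])
  have "\<exists>S. linear_map K (Val A x) (Val (P 0) x) S \<and> (\<forall>m \<in> carrier (Val (P 0) x). S (\<epsilon> x m) = \<theta> x m)"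
    if x: "x \<in> Obj C" for x
  proof (rule linear_map_factor[OF e(1)[OF x] _ \<theta>[OF x]])
    show "\<epsilon> x ` carrier (Val (P 0) x) = carrier (Val A x)" using epi x by (simp add: nat_epi_def)
    interpret V: vectorspace K "Val (P 0) x" using x by (rule linear_functor.Val_vectorspace[OF fP])
    show "\<theta> x m = \<zero>\<^bsub>Val (P 0) x\<^esub>" if "m \<in> carrier (Val (P 0) x)" "\<epsilon> x m = \<zero>\<^bsub>Val A x\<^esub>" for m
      using that x retract[of x m] by (simp add: \<theta>_def M_def a_kernel_iff V.M.minus_eq V.M.r_neg)
  qed
  then obtain S where S: "\<And>x. x \<in> Obj C \<Longrightarrow> linear_map K (Val A x) (Val (P 0) x) (S x)"
    and S\<epsilon>: "\<And>x m. \<lbrakk>x \<in> Obj C; m \<in> carrier (Val (P 0) x)\<rbrakk> \<Longrightarrow> S x (\<epsilon> x m) = \<theta> x m"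
    by metis
  have lift: "\<exists>m \<in> carrier (Val (P 0) x). a = \<epsilon> x m" if "x \<in> Obj C" "a \<in> carrier (Val A x)" for x a
    using epi that by (auto simp: nat_epi_def)
  have "nat_restrict C A S \<in> nat_trans K C A (P 0)"
  proof (rule nat_transI[OF A fP S])
    fix x y f a
    assume x: "x \<in> Obj C" and y: "y \<in> Obj C" and f: "f \<in> carrier (Hom C x y)" and "a \<in> carrier (Val A x)"
    then obtain m where m: "m \<in> carrier (Val (P 0) x)" and a: "a = \<epsilon> x m" using lift by blast
    note act = linear_mapD(3,7)[OF linear_functor.Act_linear[OF fP x y f]]
    have "S y (Act A x y f a) = \<theta> y (Act (P 0) x y f m)"
      using x y f m act by (simp add: a S\<epsilon> flip: e(2))
    also have "\<dots> = Act (P 0) x y f (\<theta> x m)"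
      using x y f m act linear_mapD(3)[OF p(1)[OF x]] by (simp add: \<theta>_def p(2))
    also have "\<dots> = Act (P 0) x y f (S x a)" using x m by (simp add: a S\<epsilon>)
    finally show "S y (Act A x y f a) = Act (P 0) x y f (S x a)" .
  qed
  moreover have "\<epsilon> x (nat_restrict C A S x a) = a" if x: "x \<in> Obj C" and a: "a \<in> carrier (Val A x)" for x a
  proof -
    interpret A: vectorspace K "Val A x" using x by (rule linear_functor.Val_vectorspace[OF A])
    obtain m where m: "m \<in> carrier (Val (P 0) x)" and a_eq: "a = \<epsilon> x m" using lift x a by blast
    have "\<epsilon> x (nat_restrict C A S x a) = \<epsilon> x (\<theta> x m)"
      using x a m by (simp add: nat_restrict_apply a_eq S\<epsilon>)
    also have "\<dots> = a"
      using x m a linear_mapD(3)[OF p(1)[OF x]] linear_mapD(7)[OF e(1)[OF x]]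
      by (simp add: \<theta>_def \<epsilon>\<phi> a_eq A.M.minus_eq)
    finally show ?thesis .
  qed
  ultimately show ?thesis by blast
qed

end

section \<open>The enveloping category\<close>

lemma opposite_cat_simps [simp]:
  "Obj (opposite_cat C) = Obj C" "Hom (opposite_cat C) x y = Hom C y x"
  "Comp (opposite_cat C) x y z g f = Comp C z y x f g" "Id (opposite_cat C) = Id C"
  by (simp_all add: opposite_cat_def)

lemma (in linear_category) opposite_linear_category: "linear_category K (opposite_cat C)"
proof (intro linear_category.intro linear_category_axioms.intro)
  show "field K" by (rule field_axioms)
qed (simp_all add: Hom_vectorspace Comp_linear_left Comp_linear_right Comp_assoc Id_closed Id_left Id_right)

section \<open>The tensor product of two linear categories\<close>

locale linear_category_pair = C: linear_category K C + D: linear_category K D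
  for K :: "('k, 'r) ring_scheme" and C :: "('k, 'o, 'a) linear_cat" and D :: "('k, 'p, 'b) linear_cat"
begin

abbreviation "E \<equiv> tensor_cat K C D"

abbreviation "tens x y x' y' \<equiv> pure_tensor K (Hom C x x') (Hom D y y')"

lemma tensor_cat_simps [simp]:
  "Obj E = Obj C \<times> Obj D"
  "Hom E (x, y) (x', y') = tensor_product K (Hom C x x') (Hom D y y')"
  "Id E (x, y) = tens x y x y (Id C x) (Id D y)"
  by (simp_all add: tensor_cat_def)

lemma pair:
  "\<lbrakk>x \<in> Obj C; x' \<in> Obj C; y \<in> Obj D; y' \<in> Obj D\<rbrakk>
    \<Longrightarrow> vectorspace_pair K (Hom C x x') (Hom D y y')"
  by (simp add: vectorspace_pair_def C.Hom_vectorspace D.Hom_vectorspace)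

lemma E_vectorspace:
  "\<lbrakk>x \<in> Obj C; x' \<in> Obj C; y \<in> Obj D; y' \<in> Obj D\<rbrakk> \<Longrightarrow> vectorspace K (Hom E (x, y) (x', y'))"
  using vectorspace_pair.tensor_vectorspace[OF pair] by simp

lemma tens_closed:
  "\<lbrakk>x \<in> Obj C; x' \<in> Obj C; y \<in> Obj D; y' \<in> Obj D; f \<in> carrier (Hom C x x'); g \<in> carrier (Hom D y y')\<rbrakk>
    \<Longrightarrow> tens x y x' y' f g \<in> carrier (Hom E (x, y) (x', y'))"
  using vectorspace_pair.pure_closed[OF pair] by simp

context
  fixes x x' x'' y y' y''
  assumes x: "x \<in> Obj C" "x' \<in> Obj C" "x'' \<in> Obj C" and y: "y \<in> Obj D" "y' \<in> Obj D" "y'' \<in> Obj D"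
begin

interpretation H: vectorspace_pair K "Hom C x x'" "Hom D y y'" using x y by (simp add: pair)
interpretation H': vectorspace_pair K "Hom C x' x''" "Hom D y' y''" using x y by (simp add: pair)
interpretation H'': vectorspace_pair K "Hom C x x''" "Hom D y y''" using x y by (simp add: pair)

private abbreviation "\<beta> f' g' f g \<equiv> H''.pure (Comp C x x' x'' f' f) (Comp D y y' y'' g' g)"
private abbreviation "L f' g' \<equiv> tensor_lift K (Hom C x x') (Hom D y y') H''.VW (\<beta> f' g')"

lemma Comp_E: "Comp E (x, y) (x', y') (x'', y'') t' t =
    tensor_lift K (Hom C x' x'') (Hom D y' y'') H''.VW (\<lambda>f' g'. L f' g' t) t'"
  by (simp add: tensor_cat_def Let_def)

lemma inner_bilinear:
  assumes "f' \<in> carrier (Hom C x' x'')" "g' \<in> carrier (Hom D y' y'')"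
  shows "bilinear_map K (Hom C x x') (Hom D y y') H''.VW (\<beta> f' g')"
  by (rule bilinear_map_precomp[OF H''.pure_bilinear
        C.Comp_linear_right[OF x assms(1)] D.Comp_linear_right[OF y assms(2)]])

text \<open>Composition is a lift inside a lift. The inner one is taken at the fixed tensor t, and
  by \<open>tensor_lift_linear_parameter\<close> it depends linearly on each of the outer variables
  f' and g'.\<close>

lemma outer_bilinear:
  assumes t: "t \<in> carrier H.VW"
  shows "bilinear_map K (Hom C x' x'') (Hom D y' y'') H''.VW (\<lambda>f' g'. L f' g' t)"
proof (rule bilinear_mapI)
  have \<beta>: "bilinear_map K (Hom C x' x'') (Hom D y' y'') H''.VW (\<lambda>f' g'. \<beta> f' g' f g)"
    if "f \<in> carrier (Hom C x x')" "g \<in> carrier (Hom D y y')" for f g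
    by (rule bilinear_map_precomp[OF H''.pure_bilinear
          C.Comp_linear_left[OF x that(1)] D.Comp_linear_left[OF y that(2)]])
  show "linear_map K (Hom C x' x'') H''.VW (\<lambda>f'. L f' g' t)"
    if "g' \<in> carrier (Hom D y' y'')" for g'
    by (rule H.tensor_lift_linear_parameter[OF t H'.V.vectorspace_axioms H''.tensor_vectorspace])
      (rule bilinear_mapD(1)[OF \<beta> that])
  show "linear_map K (Hom D y' y'') H''.VW (\<lambda>g'. L f' g' t)"
    if "f' \<in> carrier (Hom C x' x'')" for f'
    by (rule H.tensor_lift_linear_parameter[OF t H'.W.vectorspace_axioms H''.tensor_vectorspace])
      (rule bilinear_mapD(2)[OF \<beta> that])
qed

lemma E_Comp_linear_left:
  assumes "t \<in> carrier (Hom E (x, y) (x', y'))"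
  shows "linear_map K (Hom E (x', y') (x'', y'')) (Hom E (x, y) (x'', y''))
    (\<lambda>t'. Comp E (x, y) (x', y') (x'', y'') t' t)"
  using H'.tensor_lift_linear[OF outer_bilinear] assms by (simp add: Comp_E)

text \<open>Here t' is fixed and t is a parameter inside the outer lift, so the linearity of the
  inner lift is passed on by \<open>tensor_lift_linear_parameter\<close>.\<close>

lemma E_Comp_linear_right:
  assumes "t' \<in> carrier (Hom E (x', y') (x'', y''))"
  shows "linear_map K (Hom E (x, y) (x', y')) (Hom E (x, y) (x'', y''))
    (\<lambda>t. Comp E (x, y) (x', y') (x'', y'') t' t)"
  unfolding Comp_E tensor_cat_simps
  by (rule H'.tensor_lift_linear_parameter[OF _ H.tensor_vectorspace H''.tensor_vectorspace])
    (use assms in \<open>simp_all add: H.tensor_lift_linear[OF inner_bilinear]\<close>)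

lemma E_Comp_pure:
  assumes "f \<in> carrier (Hom C x x')" "g \<in> carrier (Hom D y y')"
    and "f' \<in> carrier (Hom C x' x'')" "g' \<in> carrier (Hom D y' y'')"
  shows "Comp E (x, y) (x', y') (x'', y'') (H'.pure f' g') (H.pure f g) = \<beta> f' g' f g"
  using assms
  by (simp add: Comp_E H'.tensor_lift_pure[OF outer_bilinear] H.pure_closed
      H.tensor_lift_pure[OF inner_bilinear])

end

lemma E_Comp_closed:
  assumes "x \<in> Obj C" "x' \<in> Obj C" "x'' \<in> Obj C" and "y \<in> Obj D" "y' \<in> Obj D" "y'' \<in> Obj D"
    and "t \<in> carrier (Hom E (x, y) (x', y'))" "t' \<in> carrier (Hom E (x', y') (x'', y''))"
  shows "Comp E (x, y) (x', y') (x'', y'') t' t \<in> carrier (Hom E (x, y) (x'', y''))"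
  using linear_mapD(3)[OF E_Comp_linear_left] assms by blast

lemma E_maps_eqI:
  assumes "x \<in> Obj C" "x' \<in> Obj C" "y \<in> Obj D" "y' \<in> Obj D"
    and "linear_map K (Hom E (x, y) (x', y')) X R" and "linear_map K (Hom E (x, y) (x', y')) X T"
    and "\<And>f g. \<lbrakk>f \<in> carrier (Hom C x x'); g \<in> carrier (Hom D y y')\<rbrakk>
      \<Longrightarrow> R (tens x y x' y' f g) = T (tens x y x' y' f g)"
    and "t \<in> carrier (Hom E (x, y) (x', y'))"
  shows "R t = T t"
  using assms(5-8) unfolding tensor_cat_simps
  by (rule vectorspace_pair.tensor_maps_eqI[OF pair[OF assms(1-4)]])

text \<open>Both sides are linear in each of the three tensors, so these can be made pure one after
  another: r in 1, s in 2, and t at the end. On pure tensors the claim is associativity in each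
  factor.\<close>

lemma E_Comp_assoc:
  assumes w: "w \<in> Obj C" and x: "x \<in> Obj C" and y: "y \<in> Obj C" and z: "z \<in> Obj C"
    and w': "w' \<in> Obj D" and x': "x' \<in> Obj D" and y': "y' \<in> Obj D" and z': "z' \<in> Obj D"
    and r: "r \<in> carrier (Hom E (w, w') (x, x'))" and s: "s \<in> carrier (Hom E (x, x') (y, y'))"
    and t: "t \<in> carrier (Hom E (y, y') (z, z'))"
  shows "Comp E (w, w') (y, y') (z, z') t (Comp E (w, w') (x, x') (y, y') s r) =
    Comp E (w, w') (x, x') (z, z') (Comp E (x, x') (y, y') (z, z') t s) r"
proof -
  note cl = tens_closed E_Comp_closed
  note ll = E_Comp_linear_left and lr = E_Comp_linear_right
  have 1: "Comp E (w, w') (y, y') (z, z') (tens y y' z z' h h') (Comp E (w, w') (x, x') (y, y')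
        (tens x x' y y' g g') r) =
      Comp E (w, w') (x, x') (z, z') (Comp E (x, x') (y, y') (z, z') (tens y y' z z' h h')
        (tens x x' y y' g g')) r"
    if g: "g \<in> carrier (Hom C x y)" and g': "g' \<in> carrier (Hom D x' y')"
      and h: "h \<in> carrier (Hom C y z)" and h': "h' \<in> carrier (Hom D y' z')" for g g' h h'
  proof (rule E_maps_eqI[OF w x w' x' _ _ _ r])
    show "linear_map K (Hom E (w, w') (x, x')) (Hom E (w, w') (z, z'))
      (\<lambda>r. Comp E (w, w') (y, y') (z, z') (tens y y' z z' h h') (Comp E (w, w') (x, x') (y, y')
        (tens x x' y y' g g') r))"
      using that w x y z w' x' y' z' by (intro linear_map_comp[OF lr lr] cl)
    show "linear_map K (Hom E (w, w') (x, x')) (Hom E (w, w') (z, z'))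
      (Comp E (w, w') (x, x') (z, z') (Comp E (x, x') (y, y') (z, z') (tens y y' z z' h h')
        (tens x x' y y' g g')))"
      using that w x y z w' x' y' z' by (intro lr cl)
    fix f f' assume f: "f \<in> carrier (Hom C w x)" and f': "f' \<in> carrier (Hom D w' x')"
    show "Comp E (w, w') (y, y') (z, z') (tens y y' z z' h h') (Comp E (w, w') (x, x') (y, y')
        (tens x x' y y' g g') (tens w w' x x' f f')) =
      Comp E (w, w') (x, x') (z, z') (Comp E (x, x') (y, y') (z, z') (tens y y' z z' h h')
        (tens x x' y y' g g')) (tens w w' x x' f f')"
      using that f f' w x y z w' x' y' z'
      by (simp add: E_Comp_pure C.Comp_closed D.Comp_closed C.Comp_assoc[OF w x y z f g h]
          D.Comp_assoc[OF w' x' y' z' f' g' h'])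
  qed
  have 2: "Comp E (w, w') (y, y') (z, z') (tens y y' z z' h h') (Comp E (w, w') (x, x') (y, y') s r) =
      Comp E (w, w') (x, x') (z, z') (Comp E (x, x') (y, y') (z, z') (tens y y' z z' h h') s) r"
    if h: "h \<in> carrier (Hom C y z)" and h': "h' \<in> carrier (Hom D y' z')" for h h'
  proof (rule E_maps_eqI[OF x y x' y' _ _ _ s])
    show "linear_map K (Hom E (x, x') (y, y')) (Hom E (w, w') (z, z'))
      (\<lambda>s. Comp E (w, w') (y, y') (z, z') (tens y y' z z' h h') (Comp E (w, w') (x, x') (y, y') s r))"
      using that r w x y z w' x' y' z' by (intro linear_map_comp[OF ll lr] cl)
    show "linear_map K (Hom E (x, x') (y, y')) (Hom E (w, w') (z, z'))
      (\<lambda>s. Comp E (w, w') (x, x') (z, z') (Comp E (x, x') (y, y') (z, z') (tens y y' z z' h h') s) r)"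
      using that r w x y z w' x' y' z' by (intro linear_map_comp[OF lr ll] cl)
  qed (use 1 h h' in blast)
  show ?thesis
  proof (rule E_maps_eqI[OF y z y' z' _ _ _ t])
    show "linear_map K (Hom E (y, y') (z, z')) (Hom E (w, w') (z, z'))
      (\<lambda>t. Comp E (w, w') (y, y') (z, z') t (Comp E (w, w') (x, x') (y, y') s r))"
      using r s w x y z w' x' y' z' by (intro ll cl)
    show "linear_map K (Hom E (y, y') (z, z')) (Hom E (w, w') (z, z'))
      (\<lambda>t. Comp E (w, w') (x, x') (z, z') (Comp E (x, x') (y, y') (z, z') t s) r)"
      using r s w x y z w' x' y' z' by (intro linear_map_comp[OF ll ll] cl)
  qed (rule 2)
qed

lemma tensor_cat_linear_category: "linear_category K E"
proof (intro linear_category.intro linear_category_axioms.intro)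
  show "field K" by (rule C.field_axioms)
next
  fix p q assume "p \<in> Obj E" "q \<in> Obj E"
  then show "vectorspace K (Hom E p q)" using E_vectorspace by (cases p, cases q) auto
next
  fix p q r f assume "p \<in> Obj E" "q \<in> Obj E" "r \<in> Obj E" "f \<in> carrier (Hom E p q)"
  then show "linear_map K (Hom E q r) (Hom E p r) (\<lambda>g. Comp E p q r g f)"
    using E_Comp_linear_left by (cases p, cases q, cases r) auto
next
  fix p q r g assume "p \<in> Obj E" "q \<in> Obj E" "r \<in> Obj E" "g \<in> carrier (Hom E q r)"
  then show "linear_map K (Hom E p q) (Hom E p r) (\<lambda>f. Comp E p q r g f)"
    using E_Comp_linear_right by (cases p, cases q, cases r) auto
next
  fix o' p q r f g h
  assume "o' \<in> Obj E" "p \<in> Obj E" "q \<in> Obj E" "r \<in> Obj E"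
    and "f \<in> carrier (Hom E o' p)" "g \<in> carrier (Hom E p q)" "h \<in> carrier (Hom E q r)"
  then show "Comp E o' q r h (Comp E o' p q g f) = Comp E o' p r (Comp E p q r h g) f"
    using E_Comp_assoc by (cases o', cases p, cases q, cases r) auto
next
  fix p assume "p \<in> Obj E"
  then show "Id E p \<in> carrier (Hom E p p)"
    using tens_closed by (cases p) (auto simp: C.Id_closed D.Id_closed)
next
  fix p q f assume pq: "p \<in> Obj E" "q \<in> Obj E" and f: "f \<in> carrier (Hom E p q)"
  obtain x y x' y' where [simp]: "p = (x, y)" "q = (x', y')" by (cases p, cases q)
  have xy: "x \<in> Obj C" "x' \<in> Obj C" "y \<in> Obj D" "y' \<in> Obj D" using pq by auto
  have "Comp E (x, y) (x', y') (x', y') (Id E (x', y')) f = f"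
  proof (rule E_maps_eqI[OF xy, where t = f])
    show "linear_map K (Hom E (x, y) (x', y')) (Hom E (x, y) (x', y'))
        (Comp E (x, y) (x', y') (x', y') (Id E (x', y')))"
      using xy tens_closed[OF xy(2,2,4,4) C.Id_closed D.Id_closed]
      by (intro E_Comp_linear_right) auto
    show "linear_map K (Hom E (x, y) (x', y')) (Hom E (x, y) (x', y')) (\<lambda>f. f)"
      using E_vectorspace[OF xy] by (rule linear_map_id)
  qed (use xy f in \<open>simp_all add: E_Comp_pure C.Id_closed D.Id_closed C.Id_left D.Id_left\<close>)
  then show "Comp E p q q (Id E q) f = f" by simp
  have "Comp E (x, y) (x, y) (x', y') f (Id E (x, y)) = f"
  proof (rule E_maps_eqI[OF xy, where t = f])
    show "linear_map K (Hom E (x, y) (x', y')) (Hom E (x, y) (x', y'))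
        (\<lambda>f. Comp E (x, y) (x, y) (x', y') f (Id E (x, y)))"
      using xy tens_closed[OF xy(1,1,3,3) C.Id_closed D.Id_closed]
      by (intro E_Comp_linear_left) auto
    show "linear_map K (Hom E (x, y) (x', y')) (Hom E (x, y) (x', y')) (\<lambda>f. f)"
      using E_vectorspace[OF xy] by (rule linear_map_id)
  qed (use xy f in \<open>simp_all add: E_Comp_pure C.Id_closed D.Id_closed C.Id_right D.Id_right\<close>)
  then show "Comp E p p q f (Id E p) = f" by simp
qed

end

section \<open>The regular bimodule\<close>

context linear_category
begin

interpretation env: linear_category_pair K C "opposite_cat C"
  by (simp add: linear_category_pair_def linear_category_axioms opposite_linear_category)

abbreviation "Env \<equiv> tensor_cat K C (opposite_cat C)"

abbreviation "Reg \<equiv> regular_bimodule K C"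

lemma Val_regular [simp]: "Val Reg (x, y) = Hom C y x"
  by (simp add: regular_bimodule_def)

context
  fixes x x' y y'
  assumes x: "x \<in> Obj C" "x' \<in> Obj C" and y: "y \<in> Obj C" "y' \<in> Obj C"
begin

lemma sandwich_bilinear:
  assumes "m \<in> carrier (Hom C y x)"
  shows "bilinear_map K (Hom C x x') (Hom C y' y) (Hom C y' x')
    (\<lambda>f g. Comp C y' x x' f (Comp C y' y x m g))"
proof (rule bilinear_mapI)
  show "linear_map K (Hom C x x') (Hom C y' x') (\<lambda>f. Comp C y' x x' f (Comp C y' y x m g))"
    if "g \<in> carrier (Hom C y' y)" for g
    using that assms x y by (intro Comp_linear_left Comp_closed)
  show "linear_map K (Hom C y' y) (Hom C y' x') (\<lambda>g. Comp C y' x x' f (Comp C y' y x m g))"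
    if "f \<in> carrier (Hom C x x')" for f
    using linear_map_comp[OF Comp_linear_right Comp_linear_right] that assms x y by blast
qed

lemma Act_regular:
  "Act Reg (x, y) (x', y') t m = tensor_lift K (Hom C x x') (Hom C y' y) (Hom C y' x')
    (\<lambda>f g. Comp C y' x x' f (Comp C y' y x m g)) t"
  by (simp add: regular_bimodule_def)

interpretation H: vectorspace_pair K "Hom C x x'" "Hom C y' y"
  using x y by (simp add: vectorspace_pair_def Hom_vectorspace)

lemma Act_regular_pure:
  assumes "m \<in> carrier (Hom C y x)" "f \<in> carrier (Hom C x x')" "g \<in> carrier (Hom C y' y)"
  shows "Act Reg (x, y) (x', y') (env.tens x y x' y' f g) m = Comp C y' x x' f (Comp C y' y x m g)"
  using assms by (simp add: Act_regular H.tensor_lift_pure[OF sandwich_bilinear])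

lemma Act_regular_linear_Hom:
  assumes "m \<in> carrier (Hom C y x)"
  shows "linear_map K (Hom Env (x, y) (x', y')) (Hom C y' x') (\<lambda>t. Act Reg (x, y) (x', y') t m)"
  using H.tensor_lift_linear[OF sandwich_bilinear[OF assms]] by (simp add: Act_regular[abs_def])

lemma Act_regular_linear:
  assumes "t \<in> carrier (Hom Env (x, y) (x', y'))"
  shows "linear_map K (Hom C y x) (Hom C y' x') (Act Reg (x, y) (x', y') t)"
  unfolding Act_regular[abs_def]
proof (rule H.tensor_lift_linear_parameter)
  show "linear_map K (Hom C y x) (Hom C y' x') (\<lambda>m. Comp C y' x x' f (Comp C y' y x m g))"
    if "f \<in> carrier (Hom C x x')" "g \<in> carrier (Hom C y' y)" for f g
    using linear_map_comp[OF Comp_linear_left Comp_linear_right] that x y by blast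
qed (use assms x y in \<open>simp_all add: Hom_vectorspace\<close>)

end

lemma env_linear_category: "linear_category K Env"
  by (rule env.tensor_cat_linear_category)

text \<open>For pure tensors, compatibility with composition reads (f' f) m (g g') = f' ((f m g)
  g'), where the opposite category has reversed g and g'. Linearity in t and then in u gives the
  general case.\<close>

lemma regular_bimodule_functor: "linear_functor K Env Reg"
proof (intro linear_functor.intro linear_functor_axioms.intro env_linear_category)
  fix p assume "p \<in> Obj Env"
  then show "vectorspace K (Val Reg p)" by (cases p) (simp add: Hom_vectorspace)
next
  fix p q f assume "p \<in> Obj Env" "q \<in> Obj Env" "f \<in> carrier (Hom Env p q)"
  then show "linear_map K (Val Reg p) (Val Reg q) (Act Reg p q f)"
    using Act_regular_linear by (cases p, cases q) auto
next
  fix p q m assume "p \<in> Obj Env" "q \<in> Obj Env" "m \<in> carrier (Val Reg p)"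
  then show "linear_map K (Hom Env p q) (Val Reg q) (\<lambda>f. Act Reg p q f m)"
    using Act_regular_linear_Hom by (cases p, cases q) auto
next
  fix p m assume "p \<in> Obj Env" "m \<in> carrier (Val Reg p)"
  then show "Act Reg p p (Id Env p) m = m"
    using Act_regular_pure by (cases p) (auto simp: Id_closed Id_left Id_right)
next
  fix p q r t u m
  assume pqr: "p \<in> Obj Env" "q \<in> Obj Env" "r \<in> Obj Env" and t: "t \<in> carrier (Hom Env p q)"
    and u: "u \<in> carrier (Hom Env q r)" and m: "m \<in> carrier (Val Reg p)"
  obtain x y x' y' x'' y'' where eqs: "p = (x, y)" "q = (x', y')" "r = (x'', y'')"
    by (cases p, cases q, cases r)
  note t = t[unfolded eqs] and u = u[unfolded eqs]
  have xy: "x \<in> Obj C" "x' \<in> Obj C" "x'' \<in> Obj C" "y \<in> Obj C" "y' \<in> Obj C" "y'' \<in> Obj C"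
    and m: "m \<in> carrier (Hom C y x)" using pqr m by (auto simp: eqs)
  have o: "y \<in> Obj (opposite_cat C)" "y' \<in> Obj (opposite_cat C)" "y'' \<in> Obj (opposite_cat C)"
    using xy by simp_all
  note ll = env.E_Comp_linear_left[OF xy(1-3) o] and lr = env.E_Comp_linear_right[OF xy(1-3) o]
  have 1: "Act Reg (x, y) (x'', y'') (Comp Env (x, y) (x', y') (x'', y'') (env.tens x' y' x'' y'' f' g') t) m
      = Act Reg (x', y') (x'', y'') (env.tens x' y' x'' y'' f' g') (Act Reg (x, y) (x', y') t m)"
    if f': "f' \<in> carrier (Hom C x' x'')" and g': "g' \<in> carrier (Hom C y'' y')" for f' g'
  proof (rule env.E_maps_eqI[OF xy(1,2) o(1,2) _ _ _ t])
    have fg': "env.tens x' y' x'' y'' f' g' \<in> carrier (Hom Env (x', y') (x'', y''))"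
      using f' g' xy by (intro env.tens_closed) auto
    show "linear_map K (Hom Env (x, y) (x', y')) (Hom C y'' x'') (\<lambda>t. Act Reg (x, y) (x'', y'')
        (Comp Env (x, y) (x', y') (x'', y'') (env.tens x' y' x'' y'' f' g') t) m)"
      by (rule linear_map_comp[OF lr[OF fg'] Act_regular_linear_Hom[OF xy(1,3,4,6) m]])
    show "linear_map K (Hom Env (x, y) (x', y')) (Hom C y'' x'') (\<lambda>t. Act Reg (x', y') (x'', y'')
        (env.tens x' y' x'' y'' f' g') (Act Reg (x, y) (x', y') t m))"
      by (rule linear_map_comp[OF Act_regular_linear_Hom[OF xy(1,2,4,5) m]
            Act_regular_linear[OF xy(2,3,5,6) fg']])
    fix f g assume f: "f \<in> carrier (Hom C x x')" and "g \<in> carrier (Hom (opposite_cat C) y y')"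
    then have g: "g \<in> carrier (Hom C y' y)" by simp
    have "Act Reg (x, y) (x'', y'') (Comp Env (x, y) (x', y') (x'', y'') (env.tens x' y' x'' y'' f' g')
        (env.tens x y x' y' f g)) m =
      Comp C y'' x x'' (Comp C x x' x'' f' f) (Comp C y'' y x m (Comp C y'' y' y g g'))"
      using f g f' g' m xy
      by (simp add: env.E_Comp_pure[OF xy(1-3) o, simplified] Act_regular_pure[simplified] Comp_closed)
    also have "\<dots> = Comp C y'' x' x'' f' (Comp C y'' y' x' (Comp C y' x x' f (Comp C y' y x m g)) g')"
    proof -
      have "Comp C y'' y x m (Comp C y'' y' y g g') = Comp C y'' y' x (Comp C y' y x m g) g'"
        using Comp_assoc[OF xy(6,5,4,1) g' g m] .
      moreover have "Comp C y'' x x'' (Comp C x x' x'' f' f) b = Comp C y'' x' x'' f' (Comp C y'' x x' f b)"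
        if "b \<in> carrier (Hom C y'' x)" for b
        using Comp_assoc[OF xy(6,1,2,3) that f f'] by simp
      moreover have "Comp C y'' x x' f (Comp C y'' y' x b g') = Comp C y'' y' x' (Comp C y' x x' f b) g'"
        if "b \<in> carrier (Hom C y' x)" for b
        using Comp_assoc[OF xy(6,5,1,2) g' that f] .
      ultimately show ?thesis using Comp_closed xy m g g' by simp
    qed
    also have "\<dots> = Act Reg (x', y') (x'', y'') (env.tens x' y' x'' y'' f' g')
        (Act Reg (x, y) (x', y') (env.tens x y x' y' f g) m)"
      using f g f' g' m xy by (simp add: Act_regular_pure[simplified] Comp_closed)
    finally show "Act Reg (x, y) (x'', y'') (Comp Env (x, y) (x', y') (x'', y'') (env.tens x' y' x'' y'' f' g')
        (env.tens x y x' y' f g)) m = Act Reg (x', y') (x'', y'') (env.tens x' y' x'' y'' f' g')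
        (Act Reg (x, y) (x', y') (env.tens x y x' y' f g) m)" .
  qed
  have "Act Reg (x, y) (x'', y'') (Comp Env (x, y) (x', y') (x'', y'') u t) m =
      Act Reg (x', y') (x'', y'') u (Act Reg (x, y) (x', y') t m)"
  proof (rule env.E_maps_eqI[OF xy(2,3) o(2,3) _ _ _ u])
    show "linear_map K (Hom Env (x', y') (x'', y'')) (Hom C y'' x'') (\<lambda>u. Act Reg (x, y) (x'', y'')
        (Comp Env (x, y) (x', y') (x'', y'') u t) m)"
      by (rule linear_map_comp[OF ll[OF t] Act_regular_linear_Hom[OF xy(1,3,4,6) m]])
    show "linear_map K (Hom Env (x', y') (x'', y'')) (Hom C y'' x'') (\<lambda>u. Act Reg (x', y') (x'', y'') u
        (Act Reg (x, y) (x', y') t m))"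
      by (rule Act_regular_linear_Hom[OF xy(2,3,5,6)])
        (rule linear_mapD(3)[OF Act_regular_linear_Hom[OF xy(1,2,4,5) m] t])
  qed (use 1 in simp)
  then show "Act Reg p r (Comp Env p q r u t) m = Act Reg q r u (Act Reg p q t m)"
    by (simp add: eqs)
qed

end

section \<open>Finiteness\<close>

lemma subspace_finsum:
  assumes N: "subspace K N V" and f: "f \<in> A \<rightarrow> N"
  shows "(\<Oplus>\<^bsub>V\<^esub>i\<in>A. f i) \<in> N"
proof -
  interpret V: vectorspace K V using N by (rule subspaceD)
  show ?thesis using f
  proof (induction A rule: infinite_finite_induct)
    case (insert a A)
    then have "f a \<in> N" "f \<in> A \<rightarrow> carrier V" "f a \<in> carrier V"
      using subspaceD(2)[OF N] by auto
    with insert show ?case by (simp add: V.M.finsum_insert subspaceD(4)[OF N])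
  qed (simp_all add: subspaceD(3)[OF N])
qed

lemma linear_map_equalizer_subspace:
  assumes "linear_map K V W R" and "linear_map K V W T"
  shows "subspace K {v \<in> carrier V. R v = T v} V"
  by (rule subspaceI)
    (use assms in \<open>auto simp: linear_mapD vectorspace_closed[OF linear_mapD(1)[OF assms(1)]]\<close>)

lemma linear_map_vimage_subspace:
  assumes T: "linear_map K V W T" and N: "subspace K N W"
  shows "subspace K {v \<in> carrier V. T v \<in> N} V"
  by (rule subspaceI)
    (auto simp: linear_mapD[OF T] vectorspace_closed[OF linear_mapD(1)[OF T]] subspaceD[OF N])

text \<open>The finitely many pure tensors of one expression for t, used as a test set: membership
  of t in a subspace may be checked on them. Unlike \<open>tensor_maps_eqI\<close>, this handles
  statements that hold for one particular tensor but not throughout the space; equalizers and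
  preimages are the subspaces it is applied to.\<close>

lemma (in vectorspace_pair) tensor_support:
  assumes t: "t \<in> carrier VW"
  shows "\<exists>A. finite A \<and> A \<subseteq> S \<and> (\<forall>N. subspace K N VW \<longrightarrow> (\<forall>(v, w) \<in> A. pure v w \<in> N) \<longrightarrow> t \<in> N)"
proof -
  obtain A c where A: "finite A" "A \<subseteq> S" and c: "c \<in> A \<rightarrow> carrier K"
    and t_eq: "t = (\<Oplus>\<^bsub>VW\<^esub>s\<in>A. c s \<odot>\<^bsub>VW\<^esub> pure (fst s) (snd s))"
    using tensor_decompose[OF t] by blast
  have "t \<in> N" if N: "subspace K N VW" and pure: "\<forall>(v, w) \<in> A. pure v w \<in> N" for N
    unfolding t_eq
  proof (rule subspace_finsum[OF N], rule funcsetI)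
    fix s assume "s \<in> A"
    then show "c s \<odot>\<^bsub>VW\<^esub> pure (fst s) (snd s) \<in> N"
      using pure c by (intro subspaceD(5)[OF N]) auto
  qed
  with A show ?thesis by blast
qed

context linear_category
begin

interpretation env: linear_category_pair K C "opposite_cat C"
  by (simp add: linear_category_pair_def linear_category_axioms opposite_linear_category)

text \<open>Let \<open>e z\<close> be the image of the identity of \<open>z\<close> in a direct sum of representables of which the
  regular bimodule is a summand. Naturality gives \<open>f \<cdot> e x = e y \<cdot> f\<close>. The right tensor factors of the
  left side lie in a finite-dimensional space that does not depend on \<open>f\<close>, and so do the left factors of
  the right side. Projecting the right factors of the right side onto the former space therefore
  confines \<open>f\<close>, recovered by multiplying out, to a finite-dimensional space.\<close>
lemma fin_dim_if_summand_of_free: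
  assumes fam: "free_functor_family K Env I ob"
    and s: "s \<in> nat_trans K Env Reg (free_functor Env I ob)"
    and \<tau>: "\<tau> \<in> nat_trans K Env (free_functor Env I ob) Reg"
    and \<tau>s: "\<And>z m. \<lbrakk>z \<in> Obj Env; m \<in> carrier (Val Reg z)\<rbrakk> \<Longrightarrow> \<tau> z (s z m) = m"
    and x: "x \<in> Obj C" and y: "y \<in> Obj C"
  shows "vectorspace.fin_dim K (Hom C x y)"
proof -
  interpret fr: free_functor_family K Env I ob by (rule fam)
  interpret Hxy: vectorspace K "Hom C x y" using x y by (rule Hom_vectorspace)
  note Reg = regular_bimodule_functor
  note s' = linear_category.nat_transD[OF env_linear_category s Reg fr.F_functor]
  note \<tau>' = linear_category.nat_transD[OF env_linear_category \<tau> fr.F_functor Reg]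
  have objs: "(x, x) \<in> Obj Env" "(y, y) \<in> Obj Env" "(y, x) \<in> Obj Env" using x y by simp_all
  define ex where "ex = s (x, x) (Id C x)"
  define ey where "ey = s (y, y) (Id C y)"
  have ex: "ex \<in> carrier (Val fr.F (x, x))" and ey: "ey \<in> carrier (Val fr.F (y, y))"
    unfolding ex_def ey_def using linear_mapD(3)[OF s'(1)] objs x y by (simp_all add: Id_closed)
  interpret X: finite_support_sum K "Val fr.F (x, x)" I "\<lambda>i. Hom Env (ob i) (x, x)"
    using objs(1) by (rule fr.finite_support)
  interpret Y: finite_support_sum K "Val fr.F (y, y)" I "\<lambda>i. Hom Env (ob i) (y, y)"
    using objs(2) by (rule fr.finite_support)
  interpret YX: finite_support_sum K "Val fr.F (y, x)" I "\<lambda>i. Hom Env (ob i) (y, x)"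
    using objs(3) by (rule fr.finite_support)
  \<comment> \<open>The image under \<open>\<tau>\<close> of the generator of summand i. On that
    summand \<open>\<tau>\<close> is the action on \<open>m i\<close>, so a tensor a \<otimes> b
    there goes to the composite of a, \<open>m i\<close> and b.\<close>
  define m where "m i = \<tau> (ob i) (fr.incl (ob i) i (Id Env (ob i)))" for i
  define u v where "u i = fst (ob i)" and "v i = snd (ob i)" for i
  have ob_eq: "ob i = (u i, v i)" for i by (simp add: u_def v_def)
  have uv: "u i \<in> Obj C" "v i \<in> Obj C" if "i \<in> I" for i
    using fr.ob[OF that] by (simp_all add: ob_eq)
  have m: "m i \<in> carrier (Hom C (v i) (u i))" if "i \<in> I" for i
  proof -
    have "m i \<in> carrier (Val Reg (ob i))"
      unfolding m_def using that fr.ob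
      by (intro linear_mapD(3)[OF \<tau>'(1)] fr.incl_closed linear_category.Id_closed[OF env_linear_category])
    then show ?thesis by (simp add: ob_eq)
  qed
  \<comment> \<open>\<open>L f\<close> is f \<otimes> 1 and \<open>R f\<close> is 1 \<otimes> f.
    Acting on the identities of x and y respectively, both give f; hence by naturality
    \<open>t f\<close> can be computed from \<open>ex\<close> as well as from
    \<open>ey\<close>.\<close>
  define L where "L f = env.tens x x y x f (Id C x)" for f
  define R where "R f = env.tens y y y x (Id C y) f" for f
  have L: "L f \<in> carrier (Hom Env (x, x) (y, x))" and R: "R f \<in> carrier (Hom Env (y, y) (y, x))"
    if "f \<in> carrier (Hom C x y)" for f
    unfolding L_def R_def using that x y by (auto intro!: env.tens_closed[simplified] simp: Id_closed)
  define t where "t f = Act fr.F (x, x) (y, x) (L f) ex" for f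
  have t_eq: "t f = s (y, x) f" and t_eq': "t f = Act fr.F (y, y) (y, x) (R f) ey"
    if f: "f \<in> carrier (Hom C x y)" for f
  proof -
    have "Act Reg (x, x) (y, x) (L f) (Id C x) = f"
      unfolding L_def using f x y by (simp add: Act_regular_pure[simplified] Id_closed Id_left Id_right)
    then show 1: "t f = s (y, x) f"
      unfolding t_def ex_def using s'(2)[OF objs(1,3) L[OF f], of "Id C x"] x by (simp add: Id_closed)
    have "Act Reg (y, y) (y, x) (R f) (Id C y) = f"
      unfolding R_def using f x y by (simp add: Act_regular_pure[simplified] Id_closed Id_left Id_right)
    then show "t f = Act fr.F (y, y) (y, x) (R f) ey"
      unfolding 1 ey_def using s'(2)[OF objs(2,3) R[OF f], of "Id C y"] y by (simp add: Id_closed)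
  qed
  \<comment> \<open>One summand at a time; the finite set \<open>G\<close> has to be chosen before
    f.\<close>
  have "\<exists>G. finite G \<and> G \<subseteq> carrier (Hom C x y) \<and>
      (\<forall>f \<in> carrier (Hom C x y). Act Reg (ob i) (y, x) (t f i) (m i) \<in> Hxy.span G)"
    if i: "i \<in> I" for i
  proof -
    note o = uv[OF i]
    interpret B: vectorspace K "Hom C x (v i)" using x o(2) by (rule Hom_vectorspace)
    interpret TX: vectorspace_pair K "Hom C (u i) x" "Hom C x (v i)"
      using o x by (simp add: vectorspace_pair_def Hom_vectorspace)
    interpret TY: vectorspace_pair K "Hom C (u i) y" "Hom C y (v i)"
      using o y by (simp add: vectorspace_pair_def Hom_vectorspace)
    interpret T: vectorspace_pair K "Hom C (u i) y" "Hom C x (v i)"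
      using o x y by (simp add: vectorspace_pair_def Hom_vectorspace)
    have exi: "ex i \<in> carrier TX.VW" and eyi: "ey i \<in> carrier TY.VW"
      using X.apply_closed[OF ex i] Y.apply_closed[OF ey i] by (simp_all add: ob_eq)
    obtain A where A: "finite A" "A \<subseteq> TX.S"
      and A_supp: "\<And>N. \<lbrakk>subspace K N TX.VW; \<forall>(a, b) \<in> A. TX.pure a b \<in> N\<rbrakk> \<Longrightarrow> ex i \<in> N"
      using TX.tensor_support[OF exi] by blast
    obtain A' where A': "finite A'" "A' \<subseteq> TY.S"
      and A'_supp: "\<And>N. \<lbrakk>subspace K N TY.VW; \<forall>(a, b) \<in> A'. TY.pure a b \<in> N\<rbrakk> \<Longrightarrow> ey i \<in> N"
      using TY.tensor_support[OF eyi] by blast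
    \<comment> \<open>The right factors of \<open>ex i\<close>. Composing with \<open>L f\<close>
      affects left factors only, so they stay the same for all f.\<close>
    define B where "B = snd ` A"
    have B: "finite B" "B \<subseteq> carrier (Hom C x (v i))" using A by (auto simp: B_def)
    define \<gamma> where "\<gamma> a b = Comp C x (u i) y a (Comp C x (v i) (u i) (m i) b)" for a b
    have \<gamma>: "bilinear_map K (Hom C (u i) y) (Hom C x (v i)) (Hom C x y) \<gamma>"
      unfolding \<gamma>_def by (rule sandwich_bilinear[OF o(1) y o(2) x m[OF i]])
    obtain p where p: "linear_map K (Hom C x (v i)) (Hom C x (v i)) p"
      and p_span: "\<And>b. b \<in> carrier (Hom C x (v i)) \<Longrightarrow> p b \<in> B.span B"
      and p_id: "\<And>b. b \<in> B.span B \<Longrightarrow> p b = b"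
      using projection_exists[OF B.span_is_subspace[OF B(2)]] by blast
    have \<gamma>p: "bilinear_map K (Hom C (u i) y) (Hom C x (v i)) (Hom C x y) (\<lambda>a b. \<gamma> a (p b))"
      by (rule bilinear_map_precomp[OF \<gamma> linear_map_id[OF Hom_vectorspace[OF o(1) y]] p])
    \<comment> \<open>\<open>l\<close> multiplies out a tensor in summand i; \<open>lp\<close> first
      projects its right factor to the span of \<open>B\<close>.\<close>
    define l where "l = tensor_lift K (Hom C (u i) y) (Hom C x (v i)) (Hom C x y) \<gamma>"
    define lp where "lp = tensor_lift K (Hom C (u i) y) (Hom C x (v i)) (Hom C x y) (\<lambda>a b. \<gamma> a (p b))"
    have l: "linear_map K T.VW (Hom C x y) l" and lp: "linear_map K T.VW (Hom C x y) lp"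
      unfolding l_def lp_def by (rule T.tensor_lift_linear[OF \<gamma>] T.tensor_lift_linear[OF \<gamma>p])+
    have l_pure: "l (T.pure a b) = \<gamma> a b" and lp_pure: "lp (T.pure a b) = \<gamma> a (p b)"
      if "a \<in> carrier (Hom C (u i) y)" "b \<in> carrier (Hom C x (v i))" for a b
      unfolding l_def lp_def using that by (rule T.tensor_lift_pure[OF \<gamma>] T.tensor_lift_pure[OF \<gamma>p])+
    \<comment> \<open>Left factors come from \<open>ey i\<close> and right factors from
      \<open>ex i\<close>, so no f enters.\<close>
    define G where "G = (\<lambda>(a, b). \<gamma> a b) ` (fst ` A' \<times> B)"
    have G: "finite G" "G \<subseteq> carrier (Hom C x y)"
      using A' B bilinear_map_closed[OF \<gamma>] by (auto simp: G_def subset_iff)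
    have span_G: "subspace K (Hxy.span G) (Hom C x y)" by (rule Hxy.span_is_subspace[OF G(2)])
    have \<gamma>_span: "\<gamma> a b \<in> Hxy.span G" if a: "a \<in> fst ` A'" and b: "b \<in> B.span B" for a b
    proof -
      have lin: "linear_map K (Hom C x (v i)) (Hom C x y) (\<gamma> a)"
        using a A' by (intro bilinear_mapD(2)[OF \<gamma>]) auto
      have "B \<subseteq> {b \<in> carrier (Hom C x (v i)). \<gamma> a b \<in> Hxy.span G}"
        using B a Hxy.span_mem[OF G(2)] by (auto simp: G_def subset_iff)
      then have "B.span B \<subseteq> {b \<in> carrier (Hom C x (v i)). \<gamma> a b \<in> Hxy.span G}"
        using linear_map_vimage_subspace[OF lin span_G]
        by (intro B.span_is_subset) (auto simp: subspace_def)
      then show ?thesis using b by blast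
    qed
    have "Act Reg (ob i) (y, x) (t f i) (m i) \<in> Hxy.span G" if f: "f \<in> carrier (Hom C x y)" for f
    proof -
      have Lf: "linear_map K TX.VW T.VW (Comp Env (u i, v i) (x, x) (y, x) (L f))"
        using env.E_Comp_linear_right[of "u i" x y "v i" x x] L[OF f] o x y by simp
      have Rf: "linear_map K TY.VW T.VW (Comp Env (u i, v i) (y, y) (y, x) (R f))"
        using env.E_Comp_linear_right[of "u i" y y "v i" y x] R[OF f] o x y by simp
      have L_pure: "Comp Env (u i, v i) (x, x) (y, x) (L f) (TX.pure a b) = T.pure (Comp C (u i) x y f a) b"
        if "a \<in> carrier (Hom C (u i) x)" "b \<in> carrier (Hom C x (v i))" for a b
        using env.E_Comp_pure[of "u i" x y "v i" x x a b f "Id C x"] that f o x y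
        by (simp add: L_def Id_closed Id_right)
      have R_pure: "Comp Env (u i, v i) (y, y) (y, x) (R f) (TY.pure a b) = T.pure a (Comp C x y (v i) b f)"
        if "a \<in> carrier (Hom C (u i) y)" "b \<in> carrier (Hom C y (v i))" for a b
        using env.E_Comp_pure[of "u i" y y "v i" y x a b "Id C y" f] that f o x y
        by (simp add: R_def Id_closed Id_left)
      have "Act Reg (ob i) (y, x) (t f i) (m i) = l (Comp Env (u i, v i) (x, x) (y, x) (L f) (ex i))"
        using i by (simp add: t_def fr.Act_F ob_eq Act_regular[OF o(1) y o(2) x] l_def \<gamma>_def[abs_def])
      \<comment> \<open>Seen from \<open>ex\<close>, all right factors lie in \<open>B\<close>,
        where \<open>p\<close> is the identity.\<close>
      also have "\<dots> = lp (Comp Env (u i, v i) (x, x) (y, x) (L f) (ex i))"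
      proof -
        have "l (Comp Env (u i, v i) (x, x) (y, x) (L f) (TX.pure a b)) =
            lp (Comp Env (u i, v i) (x, x) (y, x) (L f) (TX.pure a b))" if "(a, b) \<in> A" for a b
        proof -
          have "b \<in> B.span B" using that B(2) by (intro B.span_mem) (force simp: B_def)+
          moreover have ab: "a \<in> carrier (Hom C (u i) x)" "b \<in> carrier (Hom C x (v i))"
            using that A by auto
          ultimately show ?thesis
            using f o x y by (simp add: L_pure l_pure lp_pure p_id Comp_closed)
        qed
        then have "\<forall>(a, b) \<in> A. TX.pure a b \<in> {r \<in> carrier TX.VW.
            l (Comp Env (u i, v i) (x, x) (y, x) (L f) r) = lp (Comp Env (u i, v i) (x, x) (y, x) (L f) r)}"
          using A TX.pure_closed by auto
        from A_supp[OF linear_map_equalizer_subspace[OF linear_map_comp[OF Lf l] linear_map_comp[OF Lf lp]] this]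
        show ?thesis by simp
      qed
      \<comment> \<open>The same component of \<open>t f\<close>, now seen from \<open>ey\<close>:
        its terms a \<otimes> (b f) have left factors from \<open>ey i\<close>, while their right
        factors vary with f but are sent by \<open>p\<close> into the span of
        \<open>B\<close>.\<close>
      also have "Comp Env (u i, v i) (x, x) (y, x) (L f) (ex i) = Comp Env (u i, v i) (y, y) (y, x) (R f) (ey i)"
        using fun_cong[OF t_eq'[OF f], of i] i by (simp add: t_def fr.Act_F ob_eq)
      also have "lp \<dots> \<in> Hxy.span G"
      proof -
        have "lp (Comp Env (u i, v i) (y, y) (y, x) (R f) (TY.pure a b)) \<in> Hxy.span G"
          if "(a, b) \<in> A'" for a b
        proof -
          have "a \<in> carrier (Hom C (u i) y)" "b \<in> carrier (Hom C y (v i))" using that A' by auto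
          moreover have "a \<in> fst ` A'" using that by force
          ultimately show ?thesis
            using f o x y by (simp add: R_pure lp_pure Comp_closed \<gamma>_span p_span)
        qed
        then have "\<forall>(a, b) \<in> A'. TY.pure a b \<in> {r \<in> carrier TY.VW.
            lp (Comp Env (u i, v i) (y, y) (y, x) (R f) r) \<in> Hxy.span G}"
          using A' TY.pure_closed by auto
        from A'_supp[OF linear_map_vimage_subspace[OF linear_map_comp[OF Rf lp] span_G] this]
        show ?thesis by simp
      qed
      finally show ?thesis .
    qed
    with G show ?thesis by blast
  qed
  then obtain G where G: "\<And>i. i \<in> I \<Longrightarrow> finite (G i)" "\<And>i. i \<in> I \<Longrightarrow> G i \<subseteq> carrier (Hom C x y)"
    and act: "\<And>i f. \<lbrakk>i \<in> I; f \<in> carrier (Hom C x y)\<rbrakk>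
      \<Longrightarrow> Act Reg (ob i) (y, x) (t f i) (m i) \<in> Hxy.span (G i)"
    by metis
  \<comment> \<open>The index set I may be infinite. As component i of \<open>t f\<close> is a
    composite with \<open>ex i\<close>, only the finitely many summands in the support of
    \<open>ex\<close> matter, for every f.\<close>
  define H where "H = (\<Union>i \<in> X.supp ex. G i)"
  have H: "finite H" "H \<subseteq> carrier (Hom C x y)"
    using G X.finite_supp[OF ex] X.suppD by (auto simp: H_def)
  have "f \<in> Hxy.span H" if f: "f \<in> carrier (Hom C x y)" for f
  proof -
    have tf: "t f \<in> carrier (Val fr.F (y, x))"
      unfolding t_def by (rule fr.F_Act_closed[OF objs(1,3) L[OF f] ex])
    have supp: "YX.supp (t f) \<subseteq> X.supp ex"
    proof
      fix i assume i: "i \<in> YX.supp (t f)"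
      then have iI: "i \<in> I" by (rule YX.suppD)
      show "i \<in> X.supp ex"
      proof (rule ccontr)
        assume "i \<notin> X.supp ex"
        then have "t f i = \<zero>\<^bsub>Hom Env (ob i) (y, x)\<^esub>"
          using linear_mapD(6)[OF fr.Comp_linear_right[OF fr.ob[OF iI] objs(1,3) L[OF f]]] iI
          by (simp add: t_def fr.Act_F X.not_supp)
        then show False using i by (simp add: YX.supp_def)
      qed
    qed
    have cl: "(\<lambda>i. YX.incl i (t f i)) \<in> YX.supp (t f) \<rightarrow> carrier (Val fr.F (y, x))"
      by (rule funcsetI) (intro YX.incl_closed YX.apply_closed[OF tf] YX.suppD)
    \<comment> \<open>f is recovered from \<open>t f\<close> by the splitting, summand by
      summand.\<close>
    have "f = \<tau> (y, x) (t f)" using \<tau>s[OF objs(3), of f] f by (simp add: t_eq)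
    also have "\<dots> = \<tau> (y, x) (\<Oplus>\<^bsub>Val fr.F (y, x)\<^esub>i\<in>YX.supp (t f). YX.incl i (t f i))"
      using YX.decompose[OF tf] by (rule arg_cong)
    also have "\<dots> = (\<Oplus>\<^bsub>Hom C x y\<^esub>i\<in>YX.supp (t f). \<tau> (y, x) (YX.incl i (t f i)))"
      using linear_map_finsum[OF \<tau>'(1)[OF objs(3)] cl] by simp
    also have "\<dots> \<in> Hxy.span H"
    proof (rule subspace_finsum[OF Hxy.span_is_subspace[OF H(2)]], rule funcsetI)
      fix i assume i: "i \<in> YX.supp (t f)"
      then have iI: "i \<in> I" by (rule YX.suppD)
      have ti: "t f i \<in> carrier (Hom Env (ob i) (y, x))" using YX.apply_closed[OF tf iI] .
      have "\<tau> (y, x) (YX.incl i (t f i)) = \<tau> (y, x) (fr.incl (y, x) i (t f i))" by (simp add: fr.incl_def)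
      also have "\<dots> = Act Reg (ob i) (y, x) (t f i) (m i)"
        unfolding fr.incl_eq_Act[OF objs(3) iI ti] m_def
        using iI fr.ob by (intro \<tau>'(2)[OF _ objs(3) ti] fr.incl_closed fr.Id_closed)
      also have "\<dots> \<in> Hxy.span H"
        using act[OF iI f] Hxy.span_is_monotone[of "G i" H] supp i by (auto simp: H_def)
      finally show "\<tau> (y, x) (YX.incl i (t f i)) \<in> Hxy.span H" .
    qed
    finally show ?thesis .
  qed
  then have "Hxy.span H = carrier (Hom C x y)"
    using subspaceD(2)[OF Hxy.span_is_subspace[OF H(2)]] by blast
  then show ?thesis using H by (auto simp: Hxy.fin_dim_def)
qed

end

section \<open>From separability to finite dimension\<close>

theorem theorem2p5:
  fixes K :: "('k, 'r) ring_scheme" and C :: "('k, 'o, 'a) linear_cat"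
  assumes "field K" and "linear_category K C" and "separable K C"
  shows "locally_finite_dimensional K C"
proof -
  interpret linear_category K C by fact
  interpret E: linear_category K Env by (rule env_linear_category)
  \<comment> \<open>The regular bimodule is valued in morphisms of \<open>C\<close>, whereas codes
    are built from morphisms of \<open>Env\<close>, which are sets of formal sums. The singleton of
    an indicator function is just an injective way to place a in that type; it distinguishes
    morphisms because one and zero differ in a field.\<close>
  define j :: "'a \<Rightarrow> ('o \<times> 'o, ('a \<times> 'a \<Rightarrow> 'k) set) hf_sequence" where
    "j a = Morphism {\<lambda>p. if p = (a, a) then \<one>\<^bsub>K\<^esub> else \<zero>\<^bsub>K\<^esub>}" for a
  have "inj j"
  proof (rule injI)
    fix a b assume "j a = j b"
    then have "(\<lambda>p. if p = (a, a) then \<one>\<^bsub>K\<^esub> else \<zero>\<^bsub>K\<^esub>) = (\<lambda>p. if p = (b, b) then \<one>\<^bsub>K\<^esub> else \<zero>\<^bsub>K\<^esub>)"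
      by (simp add: j_def)
    from fun_cong[OF this, of "(a, a)"] show "a = b" by (simp split: if_splits)
  qed
  note Reg = regular_bimodule_functor
  \<comment> \<open>The very choice made inside \<open>Ext\<close>, since separability speaks of
    this resolution and of no other. The resolution constructed from \<open>j\<close> only certifies
    that the choice is a resolution.\<close>
  define P\<epsilon> :: "(nat \<Rightarrow> ('k, 'o, 'a, ('o \<times> 'o, ('a \<times> 'a \<Rightarrow> 'k) set) hf_sequence) bimodule) \<times> _ \<times> _"
    where "P\<epsilon> = (SOME (P, d, \<epsilon>). projective_resolution K Env Reg P d \<epsilon>)"
  obtain P d \<epsilon> where P\<epsilon>: "P\<epsilon> = (P, d, \<epsilon>)" by (cases P\<epsilon>)
  obtain P' :: "nat \<Rightarrow> ('k, 'o, 'a, ('o \<times> 'o, ('a \<times> 'a \<Rightarrow> 'k) set) hf_sequence) bimodule"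
    and d' \<epsilon>' where "projective_resolution K Env Reg P' d' \<epsilon>'"
    using E.projective_resolution_exists[OF Reg \<open>inj j\<close>] by blast
  then have "case P\<epsilon> of (P, d, \<epsilon>) \<Rightarrow> projective_resolution K Env Reg P d \<epsilon>"
    unfolding P\<epsilon>_def
    by (intro someI[of "\<lambda>(P, d, \<epsilon>). projective_resolution K Env Reg P d \<epsilon>" "(P', d', \<epsilon>')"]) simp
  then have res: "projective_resolution K Env Reg P d \<epsilon>" by (simp add: P\<epsilon>)
  then have proj: "projective_functor K Env (P 0)" and \<epsilon>: "\<epsilon> \<in> nat_trans K Env (P 0) Reg"
    by (simp_all add: projective_resolution_def)
  then have P0: "linear_functor K Env (P 0)" by (simp add: projective_functor_def)
  \<comment> \<open>The first syzygy of the regular bimodule. Being a subfunctor of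
    \<open>P 0\<close>, it is valued in codes, so separability applies to it.\<close>
  define M where "M = E.kernel_functor (P 0) Reg \<epsilon>"
  have "bimodule K C M"
    unfolding M_def enveloping_cat_def by (rule E.kernel_functor_functor[OF P0 Reg \<epsilon>])
  then have "carrier (Hochschild_Mitchell K C 1 M) = {\<zero>\<^bsub>Hochschild_Mitchell K C 1 M\<^esub>}"
    using assms(3) by (simp add: separable_def)
  moreover have "Hochschild_Mitchell K C 1 M =
      quotient_module ((nat_module K Env (P 1) M)\<lparr>carrier := cocycles K Env P d M 1\<rparr>)
        (coboundaries K Env P d M 1)"
    unfolding Hochschild_Mitchell_def Ext_def enveloping_cat_def
    by (simp only: P\<epsilon>_def[symmetric] P\<epsilon> Let_def prod.case)
  ultimately have "carrier (quotient_module ((nat_module K Env (P 1) M)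
      \<lparr>carrier := cocycles K Env P d M 1\<rparr>) (coboundaries K Env P d M 1)) = {coboundaries K Env P d M 1}"
    by (simp add: quotient_module_def)
  from E.resolution_splits[OF Reg res M_def this] obtain \<sigma> where \<sigma>: "\<sigma> \<in> nat_trans K Env Reg (P 0)"
    and \<epsilon>\<sigma>: "\<And>z m. \<lbrakk>z \<in> Obj Env; m \<in> carrier (Val Reg z)\<rbrakk> \<Longrightarrow> \<epsilon> z (\<sigma> z m) = m" by blast
  obtain \<rho> where \<rho>: "\<rho> \<in> nat_trans K Env (P 0) (E.free_cover (P 0))"
    and \<pi>\<rho>: "\<And>z p. \<lbrakk>z \<in> Obj Env; p \<in> carrier (Val (P 0) z)\<rbrakk> \<Longrightarrow> E.cover_map (P 0) z (\<rho> z p) = p"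
    using E.projective_summand[OF proj] by blast
  have \<pi>: "E.cover_map (P 0) \<in> nat_trans K Env (E.free_cover (P 0)) (P 0)"
    by (rule E.cover_map_nat_trans[OF P0])
  show ?thesis
    unfolding locally_finite_dimensional_def
  \<comment> \<open>Two splittings are composed: the regular bimodule is a summand of
    \<open>P 0\<close>, and \<open>P 0\<close> is a summand of its free cover.\<close>
  proof (intro ballI fin_dim_if_summand_of_free[OF E.cover_family, of _ "P 0"])
    show "nat_comp Env Reg \<rho> \<sigma> \<in> nat_trans K Env Reg (free_functor Env (E.cover_index (P 0)) fst)"
      using E.nat_comp_closed[OF Reg P0 E.free_cover_functor \<sigma> \<rho>] by (simp add: E.free_cover_def)
    show "nat_comp Env (E.free_cover (P 0)) \<epsilon> (E.cover_map (P 0))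
        \<in> nat_trans K Env (free_functor Env (E.cover_index (P 0)) fst) Reg"
      using E.nat_comp_closed[OF E.free_cover_functor P0 Reg \<pi> \<epsilon>] by (simp add: E.free_cover_def)
    fix z m assume z: "z \<in> Obj Env" and m: "m \<in> carrier (Val Reg z)"
    have "\<sigma> z m \<in> carrier (Val (P 0) z)"
      using linear_mapD(3)[OF E.nat_transD(1)[OF \<sigma> Reg P0 z] m] .
    moreover from this have "\<rho> z (\<sigma> z m) \<in> carrier (Val (E.free_cover (P 0)) z)"
      using linear_mapD(3)[OF E.nat_transD(1)[OF \<rho> P0 E.free_cover_functor z]] by blast
    ultimately show "nat_comp Env (E.free_cover (P 0)) \<epsilon> (E.cover_map (P 0)) z
        (nat_comp Env Reg \<rho> \<sigma> z m) = m"
      using z m by (simp add: nat_comp_apply \<pi>\<rho> \<epsilon>\<sigma>)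
  qed
qed

end
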